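(* Consider a Friedmann-Robertson-Walker space-time with line element $ds^2=dt^2-R^2(t)\,d\sigma^2$, where $R>0$ is the smooth scale function and $d\sigma^2$ is the line element of the unit three-sphere, of flat $\mathbb{R}^3$ or of three-dimensional hyperbolic space. Let $\mathscr{L}$ be a family of parametrized maximal null geodesics (as described in the context) which is spatially homogeneous and isotropic, so that there is a positive function $\varepsilon(t)$ with $$D_{(t,x)}\mathscr{L}=\Big\{\pm\tfrac1{\varepsilon(t)}\,(1,\vec n) : R(t)^2\,\sigma(\vec n,\vec n)=1\Big\}$$ for all $(t,x)$. Then the DGC function depends only on $t$ and there is a constant $\kappa_0>0$ such that $$\kappa(t)=R^2(t)\,\kappa_0\qquad\text{for all }t.$$
   Context: $\mathscr{L}$ is a set of parametrized (affinely, $\nabla_\tau\dot\gamma=0$) maximal null geodesics $(\gamma,I)$ of the space-time $\mathscr{M}$, such that (a) $\mathscr{L}$ is invariant under additive reparametrizations $\gamma(\tau)\mapsto\gamma(\tau+c)$ and orientation reversal $\gamma(\tau)\mapsto\gamma(-\tau)$; (b) for every maximal null geodesic $\gamma$ there is exactly one $\lambda>0$ such that $\tau\mapsto\gamma(\lambda\tau)$ belongs to $\mathscr{L}$. Set $D_p\mathscr{L}=\{\dot\gamma(\tau) : (\gamma,I)\in\mathscr{L},\ \tau\in I,\ \gamma(\tau)=p\}\subset T_p\mathscr{M}$. The Lorentzian inner product on $T_p\mathscr{M}$ induces (up to sign) a Riemannian metric on $D_p\mathscr{L}$; $\mu_p$ is its volume measure and $K_p$ its Gaussian curvature. The DGC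 function is defined by $$\frac1{\kappa(p)}=\frac{8\pi}{\mu_p(D_p\mathscr{L})}\int_{D_p\mathscr{L}}\frac{d\mu_p(x)}{K_p(x)}.$$ Here $(1,\vec n)$ denotes the tangent vector $\partial_t+\vec n$ with $\vec n$ tangent to the spatial slice. *)

theory Defs
  imports "HOL-Analysis.Analysis"
begin

section \<open>Smooth maps and parametrized submanifolds\<close>

text \<open>Intended for open \<open>S\<close> in a finite-dimensional space: all iterated directional derivatives
  exist (as total derivatives) and are continuous.\<close>

primrec Ck_on :: "nat \<Rightarrow> 'a::real_normed_vector set \<Rightarrow> ('a \<Rightarrow> 'b::real_normed_vector) \<Rightarrow> bool" where
  "Ck_on 0 S f \<longleftrightarrow> continuous_on S f"
| "Ck_on (Suc k) S f \<longleftrightarrow>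
     (\<forall>x\<in>S. f differentiable (at x)) \<and> (\<forall>v. Ck_on k S (\<lambda>x. frechet_derivative f (at x) v))"

definition smooth_on :: "'a::real_normed_vector set \<Rightarrow> ('a \<Rightarrow> 'b::real_normed_vector) \<Rightarrow> bool" where
  "smooth_on S f \<longleftrightarrow> (\<forall>k. Ck_on k S f)"

text \<open>Manifolds are subsets \<open>M\<close> of an ambient Euclidean space, and charts are given by their inverses.
  The ambient space only supplies the smooth structure; metrics on \<open>M\<close> are separate data.\<close>

definition local_param ::
    "'e::euclidean_space set \<Rightarrow> (real^'n) set \<Rightarrow> (real^'n \<Rightarrow> 'e) \<Rightarrow> bool" where
  "local_param M U \<phi> \<longleftrightarrow>
     open U \<and> smooth_on U \<phi> \<and> (\<forall>u\<in>U. inj (frechet_derivative \<phi> (at u))) \<and>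
     inj_on \<phi> U \<and> openin (top_of_set M) (\<phi> ` U) \<and> continuous_on (\<phi> ` U) (inv_into U \<phi>)"

definition tangent_space :: "'e::euclidean_space set \<Rightarrow> 'e \<Rightarrow> 'e set" where
  "tangent_space M p =
     {v. \<exists>c \<delta>. \<delta> > 0 \<and> smooth_on {-\<delta><..<\<delta>} c \<and> c ` {-\<delta><..<\<delta>} \<subseteq> M \<and>
            c (0::real) = p \<and> (c has_vector_derivative v) (at 0)}"

section \<open>Levi-Civita connection and curvature in local coordinates\<close>

definition partial_deriv ::
    "'n \<Rightarrow> (real^'n \<Rightarrow> 'b::real_normed_vector) \<Rightarrow> real^'n \<Rightarrow> 'b" where
  "partial_deriv i f u = frechet_derivative f (at u) (axis i 1)"

text \<open>A metric is a function \<open>g\<close> such that \<open>g p\<close> is the inner product on the tangent space at \<open>p\<close>;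
  its values on vectors that are not tangent are never used.\<close>

definition coord_metric ::
    "('e \<Rightarrow> 'e \<Rightarrow> 'e \<Rightarrow> real) \<Rightarrow> (real^'n \<Rightarrow> 'e::euclidean_space) \<Rightarrow> real^'n \<Rightarrow> real^'n^'n" where
  "coord_metric g \<phi> u = (\<chi> i j. g (\<phi> u) (partial_deriv i \<phi> u) (partial_deriv j \<phi> u))"

definition christoffel :: "(real^'n \<Rightarrow> real^'n^'n) \<Rightarrow> 'n \<Rightarrow> 'n \<Rightarrow> 'n \<Rightarrow> real^'n \<Rightarrow> real" where
  "christoffel G k i j u =
     (1/2) * (\<Sum>l\<in>UNIV. matrix_inv (G u) $ k $ l *
        (partial_deriv i (\<lambda>w. G w $ j $ l) u + partial_deriv j (\<lambda>w. G w $ i $ l) u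
           - partial_deriv l (\<lambda>w. G w $ i $ j) u))"

text \<open>The \<open>l\<close>-th component of \<open>R(\<partial>\<^sub>i, \<partial>\<^sub>j)\<partial>\<^sub>k = \<nabla>\<^sub>i\<nabla>\<^sub>j\<partial>\<^sub>k - \<nabla>\<^sub>j\<nabla>\<^sub>i\<partial>\<^sub>k\<close>.\<close>

definition riemann_curvature ::
    "(real^'n \<Rightarrow> real^'n^'n) \<Rightarrow> 'n \<Rightarrow> 'n \<Rightarrow> 'n \<Rightarrow> 'n \<Rightarrow> real^'n \<Rightarrow> real" where
  "riemann_curvature G l k i j u =
     partial_deriv i (christoffel G l j k) u - partial_deriv j (christoffel G l i k) u
     + (\<Sum>m\<in>UNIV. christoffel G l i m u * christoffel G m j k u
                    - christoffel G l j m u * christoffel G m i k u)"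

definition coord_gaussian_curvature :: "(real^2 \<Rightarrow> real^2^2) \<Rightarrow> real^2 \<Rightarrow> real" where
  "coord_gaussian_curvature G u =
     (\<Sum>l\<in>UNIV. G u $ 1 $ l * riemann_curvature G l 2 1 2 u) / det (G u)"

definition gaussian_curvature ::
    "'e::euclidean_space set \<Rightarrow> ('e \<Rightarrow> 'e \<Rightarrow> 'e \<Rightarrow> real) \<Rightarrow> 'e \<Rightarrow> real" where
  "gaussian_curvature D h x =
     (THE K. \<forall>U (\<phi> :: real^2 \<Rightarrow> 'e). \<forall>u\<in>U. local_param D U \<phi> \<and> \<phi> u = x \<longrightarrow>
         K = coord_gaussian_curvature (coord_metric h \<phi>) u)"

text \<open>The volume measure of a Riemannian surface \<open>(D, h)\<close>.\<close>

definition surface_measure ::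
    "'e::euclidean_space set \<Rightarrow> ('e \<Rightarrow> 'e \<Rightarrow> 'e \<Rightarrow> real) \<Rightarrow> 'e measure" where
  "surface_measure D h =
     (THE \<mu>. space \<mu> = D \<and> sets \<mu> = sets (restrict_space borel D) \<and>
        (\<forall>U (\<phi> :: real^2 \<Rightarrow> 'e). local_param D U \<phi> \<longrightarrow>
           (\<forall>A\<in>sets borel. A \<subseteq> U \<longrightarrow>
              emeasure \<mu> (\<phi> ` A) =
                (\<integral>\<^sup>+ u\<in>A. ennreal (sqrt (det (coord_metric h \<phi> u))) \<partial>lborel))))"

section \<open>Null geodesics of a space-time\<close>

text \<open>Components in the coordinates \<open>\<phi>\<close> of the covariant derivative of the velocity of \<open>\<gamma>\<close> along
  \<open>\<gamma>\<close>.\<close>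

definition coord_acceleration ::
    "('e \<Rightarrow> 'e \<Rightarrow> 'e \<Rightarrow> real) \<Rightarrow> (real^'n) set \<Rightarrow> (real^'n \<Rightarrow> 'e::euclidean_space) \<Rightarrow>
     (real \<Rightarrow> 'e) \<Rightarrow> real \<Rightarrow> real^'n" where
  "coord_acceleration g U \<phi> \<gamma> \<tau> =
     (let u = (\<lambda>s. inv_into U \<phi> (\<gamma> s));
          u' = (\<lambda>s. vector_derivative u (at s));
          u'' = vector_derivative u' (at \<tau>)
      in (\<chi> k. u'' $ k + (\<Sum>i\<in>UNIV. \<Sum>j\<in>UNIV.
            christoffel (coord_metric g \<phi>) k i j (u \<tau>) * u' \<tau> $ i * u' \<tau> $ j)))"

text \<open>Affinely parametrized geodesics of a four-dimensional space-time \<open>(M, g)\<close>. A curve with domain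
  \<open>I\<close> is a pair \<open>(\<gamma>, I)\<close> with \<open>\<gamma>\<close> normalised to \<open>undefined\<close> outside \<open>I\<close>, so that equality of pairs is
  equality of curves.\<close>

definition geodesic ::
    "'e::euclidean_space set \<Rightarrow> ('e \<Rightarrow> 'e \<Rightarrow> 'e \<Rightarrow> real) \<Rightarrow> (real \<Rightarrow> 'e) \<times> real set \<Rightarrow> bool" where
  "geodesic M g = (\<lambda>(\<gamma>, I).
     open I \<and> is_interval I \<and> I \<noteq> {} \<and> \<gamma> \<in> extensional I \<and> \<gamma> ` I \<subseteq> M \<and> smooth_on I \<gamma> \<and>
     (\<forall>\<tau>\<in>I. \<forall>U (\<phi> :: real^4 \<Rightarrow> 'e). local_param M U \<phi> \<and> \<gamma> \<tau> \<in> \<phi> ` U \<longrightarrow>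
        coord_acceleration g U \<phi> \<gamma> \<tau> = 0))"

definition maximal_geodesic ::
    "'e::euclidean_space set \<Rightarrow> ('e \<Rightarrow> 'e \<Rightarrow> 'e \<Rightarrow> real) \<Rightarrow> (real \<Rightarrow> 'e) \<times> real set \<Rightarrow> bool" where
  "maximal_geodesic M g = (\<lambda>(\<gamma>, I).
     geodesic M g (\<gamma>, I) \<and>
     (\<forall>\<gamma>' I'. geodesic M g (\<gamma>', I') \<and> I \<subseteq> I' \<and> (\<forall>\<tau>\<in>I. \<gamma>' \<tau> = \<gamma> \<tau>) \<longrightarrow> I' = I))"

text \<open>Null vectors are nonzero by convention, so constant curves are not null geodesics.\<close>

definition maximal_null_geodesic ::
    "'e::euclidean_space set \<Rightarrow> ('e \<Rightarrow> 'e \<Rightarrow> 'e \<Rightarrow> real) \<Rightarrow> (real \<Rightarrow> 'e) \<times> real set \<Rightarrow> bool" where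
  "maximal_null_geodesic M g = (\<lambda>(\<gamma>, I).
     maximal_geodesic M g (\<gamma>, I) \<and>
     (\<forall>\<tau>\<in>I. vector_derivative \<gamma> (at \<tau>) \<noteq> 0 \<and>
        g (\<gamma> \<tau>) (vector_derivative \<gamma> (at \<tau>)) (vector_derivative \<gamma> (at \<tau>)) = 0))"

section \<open>Families of parametrized null geodesics and the DGC function\<close>

definition affine_reparam ::
    "real \<Rightarrow> real \<Rightarrow> (real \<Rightarrow> 'e) \<times> real set \<Rightarrow> (real \<Rightarrow> 'e) \<times> real set" where
  "affine_reparam a c = (\<lambda>(\<gamma>, I). (\<lambda>\<tau>. \<gamma> (a * \<tau> + c), {\<tau>. a * \<tau> + c \<in> I}))"

definition null_geodesic_family ::
    "'e::euclidean_space set \<Rightarrow> ('e \<Rightarrow> 'e \<Rightarrow> 'e \<Rightarrow> real) \<Rightarrow> ((real \<Rightarrow> 'e) \<times> real set) set \<Rightarrow> bool" where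
  "null_geodesic_family M g L \<longleftrightarrow>
     (\<forall>\<Gamma>\<in>L. maximal_null_geodesic M g \<Gamma>) \<and>
     (\<forall>\<Gamma>\<in>L. \<forall>c. affine_reparam 1 c \<Gamma> \<in> L) \<and>
     (\<forall>\<Gamma>\<in>L. affine_reparam (-1) 0 \<Gamma> \<in> L) \<and>
     (\<forall>\<Gamma>. maximal_null_geodesic M g \<Gamma> \<longrightarrow> (\<exists>!l. l > 0 \<and> affine_reparam l 0 \<Gamma> \<in> L))"

definition family_directions ::
    "((real \<Rightarrow> 'e::euclidean_space) \<times> real set) set \<Rightarrow> 'e \<Rightarrow> 'e set" where
  "family_directions L p =
     {v. \<exists>\<gamma> I \<tau>. (\<gamma>, I) \<in> L \<and> \<tau> \<in> I \<and> \<gamma> \<tau> = p \<and> v = vector_derivative \<gamma> (at \<tau>)}"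

text \<open>For signature \<open>(+,-,-,-)\<close>. The surface \<open>family_directions L p\<close> lies in the tangent space at
  \<open>p\<close>, and its induced metric is made positive definite by a change of sign; the metric does not
  depend on the point of the surface.\<close>

definition directions_metric ::
    "('e \<Rightarrow> 'e \<Rightarrow> 'e \<Rightarrow> real) \<Rightarrow> 'e \<Rightarrow> 'e \<Rightarrow> 'e \<Rightarrow> 'e \<Rightarrow> real" where
  "directions_metric g p = (\<lambda>x v w. - g p v w)"

definition dgc ::
    "('e::euclidean_space \<Rightarrow> 'e \<Rightarrow> 'e \<Rightarrow> real) \<Rightarrow> ((real \<Rightarrow> 'e) \<times> real set) set \<Rightarrow> 'e \<Rightarrow> real" where
  "dgc g L p =
     (let D = family_directions L p;
          h = directions_metric g p;
          \<mu> = surface_measure D h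
      in 1 / (8 * pi / measure \<mu> D * (\<integral>x. 1 / gaussian_curvature D h x \<partial>\<mu>)))"

section \<open>Friedmann-Robertson-Walker space-times\<close>

text \<open>All three spatial geometries are realised in \<open>\<real>\<^sup>4\<close>: as the unit sphere, as a coordinate
  hyperplane, and as the upper sheet of the unit hyperboloid in Minkowski space, whose time
  coordinate is the first one.\<close>

datatype space_form = Spherical | Flat | Hyperbolic

fun slice :: "space_form \<Rightarrow> (real^4) set" where
  "slice Spherical = {x. x \<bullet> x = 1}"
| "slice Flat = {x. x $ 1 = 0}"
| "slice Hyperbolic = {x. x \<bullet> x - 2 * (x $ 1)\<^sup>2 = -1 \<and> x $ 1 > 0}"

fun slice_metric :: "space_form \<Rightarrow> real^4 \<Rightarrow> real^4 \<Rightarrow> real" where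
  "slice_metric Spherical v w = v \<bullet> w"
| "slice_metric Flat v w = v \<bullet> w"
| "slice_metric Hyperbolic v w = v \<bullet> w - 2 * (v $ 1) * (w $ 1)"

definition frw_manifold :: "space_form \<Rightarrow> real set \<Rightarrow> (real \<times> (real^4)) set" where
  "frw_manifold k J = J \<times> slice k"

definition frw_metric ::
    "space_form \<Rightarrow> (real \<Rightarrow> real) \<Rightarrow> real \<times> (real^4) \<Rightarrow> real \<times> (real^4) \<Rightarrow> real \<times> (real^4) \<Rightarrow> real" where
  "frw_metric k R p v w =
     fst v * fst w - (R (fst p))\<^sup>2 * slice_metric k (snd v) (snd w)"

end

theory Submission
  imports Defs
begin

text \<open>The directions at \<open>(t, x)\<close> form two round spheres of radius \<open>1 / \<epsilon> t\<close>, of constant curvature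
  \<open>(\<epsilon> t)\<^sup>2\<close>, so the mean of \<open>1 / K\<close> is \<open>1 / (\<epsilon> t)\<^sup>2\<close> whatever the total area is, as long as it is positive
  and finite, and \<open>\<kappa> = \<epsilon>\<^sup>2 / (8 \<pi>)\<close>. Along an affinely parametrized null geodesic \<open>R t'\<close> is conserved,
  while \<open>t' = \<plusminus> 1 / \<epsilon> t\<close> for a member of the family; hence \<open>R / \<epsilon>\<close> is locally constant on \<open>J\<close>, and \<open>\<kappa>\<close> is
  proportional to \<open>R\<^sup>2\<close>.

  Curvature and area are characterised by all parametrizations at once. For the curvature, the Gauss
  formula of a sphere is differentiated in an arbitrary parametrization. For the area, existence of
  the measure follows from a coordinate-free description as three times the volume of the cone,
  divided by the radius.\<close>

section \<open>Smooth maps\<close>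

text \<open>\<open>gaussian_curvature\<close> and \<open>surface_measure\<close> are definite
  descriptions over all local parametrizations, so a computation in one convenient chart does not
  evaluate them: the defining formula must be checked in every chart, even one whose domain is
  disconnected and meets both sheets, and uniqueness needs a chart around each point. Gluing local
  areas into a measure is avoided by pushing Lebesgue measure on \<open>real^3\<close> forward along
  radial projection, which makes countable additivity automatic. Both sheets lie over the same
  sphere of \<open>real^3\<close>, so the distance from the origin has to encode the sheet. The
  three spatial geometries are unified by a linear isometric frame of each tangent hyperplane: in
  such a frame the directions at any event look the same, and only the hyperboloid needs extra care
  because its ambient form is indefinite. A single geodesic need not run through all of J. It is
  only shown to cover a neighbourhood of its starting time, and connectedness of J joins these
  neighbourhoods.\<close>

lemma Ck_on_cong:
  assumes "open S" "\<And>x. x \<in> S \<Longrightarrow> f x = g x" "Ck_on k S f"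
  shows "Ck_on k S g"
  using assms(2,3)
proof (induction k arbitrary: f g)
  case 0
  then show ?case by (metis Ck_on.simps(1) continuous_on_eq)
next
  case (Suc k)
  have d: "(g has_derivative frechet_derivative f (at x)) (at x)" if "x \<in> S" for x
  proof -
    have "(f has_derivative frechet_derivative f (at x)) (at x)"
      using Suc.prems(2) that by (subst frechet_derivative_works[symmetric]) (metis Ck_on.simps(2))
    then show ?thesis
      by (rule has_derivative_transform_within_open[OF _ assms(1) that Suc.prems(1)])
  qed
  have e: "frechet_derivative f (at x) = frechet_derivative g (at x)" if "x \<in> S" for x
    by (rule frechet_derivative_at[OF d[OF that]])
  have "Ck_on k S (\<lambda>x. frechet_derivative g (at x) v)" for v
    by (rule Suc.IH[of "\<lambda>x. frechet_derivative f (at x) v"]) (use Suc.prems(2) e in simp_all)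
  moreover have "\<forall>x\<in>S. g differentiable at x" using d differentiableI by metis
  ultimately show ?case by (simp only: Ck_on.simps) metis
qed

text \<open>\<open>Ck_on\<close> speaks of the chosen \<open>frechet_derivative\<close>; this rule
  lets a derivative computed by the usual calculus rules stand in for it.\<close>

lemma Ck_on_SucI:
  assumes "open S" "\<And>x. x \<in> S \<Longrightarrow> (f has_derivative f' x) (at x)"
    and "\<And>v. Ck_on k S (\<lambda>x. f' x v)"
  shows "Ck_on (Suc k) S f"
proof -
  have "f' x = frechet_derivative f (at x)" if "x \<in> S" for x
    by (rule frechet_derivative_at[OF assms(2)[OF that]])
  then have "Ck_on k S (\<lambda>x. frechet_derivative f (at x) v)" for v
    by (intro Ck_on_cong[OF assms(1) _ assms(3)[of v]]) auto
  then show ?thesis using assms(2) by (auto simp: differentiable_def)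
qed

lemma Ck_on_SucD: "Ck_on (Suc k) S f \<Longrightarrow> Ck_on k S f"
proof (induction k arbitrary: f)
  case 0
  then show ?case
    by (auto intro!: continuous_at_imp_continuous_on differentiable_imp_continuous_within)
next
  case (Suc k)
  then show ?case by (auto simp del: Ck_on.simps(1))
qed

lemma Ck_on_Suc_has_derivative:
  "Ck_on (Suc k) S f \<Longrightarrow> x \<in> S \<Longrightarrow> (f has_derivative frechet_derivative f (at x)) (at x)"
  by (simp add: frechet_derivative_works)

lemma Ck_on_const: "open S \<Longrightarrow> Ck_on k S (\<lambda>x. c)"
proof (induction k arbitrary: c)
  case (Suc k)
  then show ?case by (intro Ck_on_SucI[where f' = "\<lambda>x v. 0"]) (auto simp del: Ck_on.simps)
qed simp

lemma Ck_on_bounded_linear: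
  assumes "open S" "bounded_linear L"
  shows "Ck_on k S L"
proof (cases k)
  case 0
  then show ?thesis using assms by (simp add: linear_continuous_on)
next
  case (Suc j)
  show ?thesis
    unfolding Suc
    by (rule Ck_on_SucI[OF assms(1) bounded_linear_imp_has_derivative[OF assms(2)]])
      (rule Ck_on_const[OF assms(1)])
qed

lemma Ck_on_linear_compose:
  assumes "open S" "bounded_linear L" "Ck_on k S f"
  shows "Ck_on k S (\<lambda>x. L (f x))"
  using assms(3)
proof (induction k arbitrary: f)
  case 0
  then show ?case using assms(2) by (simp add: bounded_linear.continuous_on)
next
  case (Suc k)
  have d: "Ck_on k S (\<lambda>x. L (frechet_derivative f (at x) v))" for v
    by (intro Suc.IH) (use Suc.prems in simp)
  show ?case
    by (rule Ck_on_SucI[OF assms(1) bounded_linear.has_derivative[OF assms(2)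
          Ck_on_Suc_has_derivative[OF Suc.prems]] d])
qed

lemma Ck_on_add:
  assumes "open S" "Ck_on k S f" "Ck_on k S g"
  shows "Ck_on k S (\<lambda>x. f x + g x)"
  using assms(2,3)
proof (induction k arbitrary: f g)
  case 0
  then show ?case by (simp add: continuous_on_add)
next
  case (Suc k)
  have d: "Ck_on k S (\<lambda>x. frechet_derivative f (at x) v + frechet_derivative g (at x) v)" for v
    by (intro Suc.IH) (use Suc.prems in simp_all)
  show ?case
    by (rule Ck_on_SucI[OF assms(1) has_derivative_add[OF
          Ck_on_Suc_has_derivative[OF Suc.prems(1)] Ck_on_Suc_has_derivative[OF Suc.prems(2)]] d])
qed

text \<open>The product rule pairs each factor with the derivative of the other, so the induction
  runs over all pairs of maps, and \<open>Ck_on_SucD\<close> lowers the order of the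
  undifferentiated factor.\<close>

lemma Ck_on_bilinear:
  assumes "open S" "bounded_bilinear B" "Ck_on k S f" "Ck_on k S g"
  shows "Ck_on k S (\<lambda>x. B (f x) (g x))"
  using assms(3,4)
proof (induction k arbitrary: f g)
  case 0
  then show ?case using assms(2) by (simp add: bounded_bilinear.continuous_on)
next
  case (Suc k)
  show ?case
  proof (rule Ck_on_SucI[OF assms(1)])
    show "((\<lambda>x. B (f x) (g x)) has_derivative
       (\<lambda>v. B (f x) (frechet_derivative g (at x) v) + B (frechet_derivative f (at x) v) (g x))) (at x)"
      if "x \<in> S" for x
      by (intro bounded_bilinear.FDERIV[OF assms(2)] Ck_on_Suc_has_derivative[OF Suc.prems(1) that]
          Ck_on_Suc_has_derivative[OF Suc.prems(2) that])
    show "Ck_on k S (\<lambda>x. B (f x) (frechet_derivative g (at x) v) + B (frechet_derivative f (at x) v) (g x))" for v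
      using Suc.prems Suc.prems[THEN Ck_on_SucD] by (intro Ck_on_add assms(1) Suc.IH) auto
  qed
qed

lemma Ck_on_subset: "Ck_on n S f \<Longrightarrow> S' \<subseteq> S \<Longrightarrow> Ck_on n S' f"
  by (induction n arbitrary: f) (auto intro: continuous_on_subset)

lemma Ck_on_compose_linear:
  assumes "open S" "bounded_linear L" "Ck_on k S f"
  shows "Ck_on k (L -` S) (\<lambda>x. f (L x))"
  using assms(3)
proof (induction k arbitrary: f)
  case 0
  then have "continuous_on S f" by simp
  then have "continuous_on (L -` S) (\<lambda>x. f (L x))"
    by (rule continuous_on_compose2[OF _ linear_continuous_on[OF assms(2)]]) auto
  then show ?case by simp
next
  case (Suc k)
  have opn: "open (L -` S)" using assms(1,2) by (intro open_vimage linear_continuous_on)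
  have d: "((\<lambda>x. f (L x)) has_derivative (\<lambda>v. frechet_derivative f (at (L x)) (L v))) (at x)"
    if "x \<in> L -` S" for x
    using diff_chain_at[OF bounded_linear_imp_has_derivative[OF assms(2)]
        Ck_on_Suc_has_derivative[OF Suc.prems]] that by (simp add: o_def)
  have c: "Ck_on k (L -` S) (\<lambda>x. frechet_derivative f (at (L x)) (L v))" for v
    by (rule Suc.IH) (use Suc.prems in simp)
  show ?case by (rule Ck_on_SucI[OF opn d c])
qed

text \<open>The derivative of 1/f is a product of 1/f, the derivative of f and 1/f again, so order k
  for 1/f yields order k + 1; the induction therefore keeps f fixed. \<open>Ck_on_sqrt\<close>
  bootstraps in the same way.\<close>

lemma Ck_on_inverse:
  fixes f :: "'a::real_normed_vector \<Rightarrow> real"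
  assumes "open S" "\<And>x. x \<in> S \<Longrightarrow> f x \<noteq> 0" "Ck_on k S f"
  shows "Ck_on k S (\<lambda>x. inverse (f x))"
  using assms(3)
proof (induction k)
  case 0
  then show ?case using assms(2) by (auto intro: continuous_on_inverse)
next
  case (Suc k)
  have IH: "Ck_on k S (\<lambda>x. inverse (f x))" using Suc.IH Suc.prems[THEN Ck_on_SucD] by blast
  show ?case
  proof (rule Ck_on_SucI[OF assms(1)])
    show "((\<lambda>x. inverse (f x)) has_derivative
       (\<lambda>v. - (inverse (f x) * frechet_derivative f (at x) v * inverse (f x)))) (at x)"
      if "x \<in> S" for x
      using Ck_on_Suc_has_derivative[OF Suc.prems that] assms(2)[OF that]
      by (auto intro!: derivative_eq_intros)
    show "Ck_on k S (\<lambda>x. - (inverse (f x) * frechet_derivative f (at x) v * inverse (f x)))" for v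
      by (intro Ck_on_linear_compose[OF assms(1), of uminus] bounded_linear_minus bounded_linear_ident
          Ck_on_bilinear[OF assms(1) bounded_bilinear_mult] IH)
        (use Suc.prems in auto)
  qed
qed

lemma Ck_on_sqrt:
  fixes f :: "'a::real_normed_vector \<Rightarrow> real"
  assumes "open S" "\<And>x. x \<in> S \<Longrightarrow> f x > 0" "Ck_on k S f"
  shows "Ck_on k S (\<lambda>x. sqrt (f x))"
  using assms(3)
proof (induction k)
  case 0
  then show ?case by (auto intro: continuous_on_real_sqrt)
next
  case (Suc k)
  have IH: "Ck_on k S (\<lambda>x. sqrt (f x))" using Suc.IH Suc.prems[THEN Ck_on_SucD] by blast
  show ?case
  proof (rule Ck_on_SucI[OF assms(1)])
    show "((\<lambda>x. sqrt (f x)) has_derivative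
       (\<lambda>v. frechet_derivative f (at x) v * (inverse (sqrt (f x)) * (1/2)))) (at x)"
      if "x \<in> S" for x
      using Ck_on_Suc_has_derivative[OF Suc.prems that] assms(2)[OF that]
      by (auto intro!: derivative_eq_intros)
    have *: "Ck_on k S (\<lambda>x. inverse (sqrt (f x)))"
      by (intro Ck_on_inverse assms(1) IH) (use assms(2) in \<open>force\<close>)
    show "Ck_on k S (\<lambda>x. frechet_derivative f (at x) v * (inverse (sqrt (f x)) * (1/2)))" for v
      by (intro Ck_on_bilinear[OF assms(1) bounded_bilinear_mult] * Ck_on_const assms(1))
        (use Suc.prems in auto)
  qed
qed

lemma smooth_on_cong:
  "open S \<Longrightarrow> (\<And>x. x \<in> S \<Longrightarrow> f x = g x) \<Longrightarrow> smooth_on S f \<Longrightarrow> smooth_on S g"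
  unfolding smooth_on_def by (blast intro: Ck_on_cong)

lemma smooth_on_frechet:
  "smooth_on S f \<Longrightarrow> smooth_on S (\<lambda>x. frechet_derivative f (at x) v)"
  unfolding smooth_on_def by (metis Ck_on.simps(2))

lemma smooth_on_has_derivative:
  "smooth_on S f \<Longrightarrow> x \<in> S \<Longrightarrow> (f has_derivative frechet_derivative f (at x)) (at x)"
  unfolding smooth_on_def using Ck_on_Suc_has_derivative by blast

lemma smooth_on_differentiable:
  "smooth_on S f \<Longrightarrow> x \<in> S \<Longrightarrow> f differentiable at x"
  using smooth_on_has_derivative by (auto simp: differentiable_def)

lemma smooth_on_continuous: "smooth_on S f \<Longrightarrow> continuous_on S f"
  unfolding smooth_on_def by (metis Ck_on.simps(1))

lemma smooth_on_const: "open S \<Longrightarrow> smooth_on S (\<lambda>x. c)"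
  by (simp add: smooth_on_def Ck_on_const del: Ck_on.simps)

lemma smooth_on_bounded_linear: "open S \<Longrightarrow> bounded_linear L \<Longrightarrow> smooth_on S L"
  by (simp add: smooth_on_def Ck_on_bounded_linear)

lemma smooth_on_linear_compose:
  "open S \<Longrightarrow> bounded_linear L \<Longrightarrow> smooth_on S f \<Longrightarrow> smooth_on S (\<lambda>x. L (f x))"
  by (simp add: smooth_on_def Ck_on_linear_compose)

lemma smooth_on_compose_linear:
  "open S \<Longrightarrow> bounded_linear L \<Longrightarrow> smooth_on S f \<Longrightarrow> smooth_on (L -` S) (\<lambda>x. f (L x))"
  by (simp add: smooth_on_def Ck_on_compose_linear)

lemma smooth_on_add:
  "open S \<Longrightarrow> smooth_on S f \<Longrightarrow> smooth_on S g \<Longrightarrow> smooth_on S (\<lambda>x. f x + g x)"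
  by (simp add: smooth_on_def Ck_on_add)

lemma smooth_on_bilinear:
  "open S \<Longrightarrow> bounded_bilinear B \<Longrightarrow> smooth_on S f \<Longrightarrow> smooth_on S g \<Longrightarrow>
    smooth_on S (\<lambda>x. B (f x) (g x))"
  by (simp add: smooth_on_def Ck_on_bilinear)

lemma smooth_on_sqrt:
  fixes f :: "'a::real_normed_vector \<Rightarrow> real"
  shows "open S \<Longrightarrow> (\<And>x. x \<in> S \<Longrightarrow> f x > 0) \<Longrightarrow> smooth_on S f \<Longrightarrow> smooth_on S (\<lambda>x. sqrt (f x))"
  by (simp add: smooth_on_def Ck_on_sqrt)

lemma frechet_derivative_linear_compose:
  assumes "bounded_linear L" "f differentiable at x"
  shows "frechet_derivative (\<lambda>y. L (f y)) (at x) v = L (frechet_derivative f (at x) v)"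
  by (rule fun_cong[OF frechet_derivative_at[symmetric], of _ "\<lambda>v. L (frechet_derivative f (at x) v)"])
    (use assms in \<open>simp add: bounded_linear.has_derivative frechet_derivative_works[symmetric]\<close>)

lemma frechet_derivative_eqI:
  "(f has_derivative f') (at x) \<Longrightarrow> frechet_derivative f (at x) v = f' v"
  by (simp add: frechet_derivative_at[symmetric])

section \<open>Symmetry of second derivatives\<close>

text \<open>The mean value theorem is applied twice: along v to the difference of f at base points
  shifted by \<open>h *\<^sub>R w\<close>, then along w to the derivative of f in direction
  v.\<close>

lemma second_difference_mean_value:
  fixes f :: "'a::real_normed_vector \<Rightarrow> real"
  assumes "smooth_on S f" "h > 0"
    and inS: "\<And>s t. 0 \<le> s \<Longrightarrow> s \<le> h \<Longrightarrow> 0 \<le> t \<Longrightarrow> t \<le> h \<Longrightarrow> x + s *\<^sub>R v + t *\<^sub>R w \<in> S"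
  shows "\<exists>s t. 0 < s \<and> s < h \<and> 0 < t \<and> t < h \<and>
     f (x + h *\<^sub>R v + h *\<^sub>R w) - f (x + h *\<^sub>R v) - f (x + h *\<^sub>R w) + f x =
     h * (h * frechet_derivative (\<lambda>y. frechet_derivative f (at y) v) (at (x + s *\<^sub>R v + t *\<^sub>R w)) w)"
proof -
  let ?D = "\<lambda>y. frechet_derivative f (at y) v"
  have along: "((\<lambda>s. g (a + s *\<^sub>R u)) has_real_derivative frechet_derivative g (at (a + s *\<^sub>R u)) u) (at s)"
    if "smooth_on S g" "a + s *\<^sub>R u \<in> S" for g :: "'a \<Rightarrow> real" and a u s
  proof -
    have "(g \<circ> (\<lambda>s. a + s *\<^sub>R u) has_derivative
        frechet_derivative g (at (a + s *\<^sub>R u)) \<circ> (\<lambda>h. h *\<^sub>R u)) (at s)"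
      by (rule diff_chain_at) (auto intro!: derivative_eq_intros smooth_on_has_derivative that)
    moreover have "linear (frechet_derivative g (at (a + s *\<^sub>R u)))"
      using that smooth_on_differentiable linear_frechet_derivative by blast
    ultimately show ?thesis
      by (simp add: has_field_derivative_def o_def linear_scale mult_commute_abs)
  qed
  have "((\<lambda>s. f (x + s *\<^sub>R v + h *\<^sub>R w) - f (x + s *\<^sub>R v)) has_real_derivative
      ?D (x + s *\<^sub>R v + h *\<^sub>R w) - ?D (x + s *\<^sub>R v)) (at s)" if "0 \<le> s" "s \<le> h" for s
    using along[OF assms(1), of "x + h *\<^sub>R w" s v] along[OF assms(1), of x s v]
      inS[of s h] inS[of s 0] that assms(2)
    by (auto intro!: derivative_eq_intros simp: algebra_simps)
  from MVT2[OF assms(2) this] obtain s where s: "0 < s" "s < h" and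
    1: "(f (x + h *\<^sub>R v + h *\<^sub>R w) - f (x + h *\<^sub>R v)) - (f (x + h *\<^sub>R w) - f x) =
       h * (?D (x + s *\<^sub>R v + h *\<^sub>R w) - ?D (x + s *\<^sub>R v))" by auto
  have "((\<lambda>t. ?D (x + s *\<^sub>R v + t *\<^sub>R w)) has_real_derivative
      frechet_derivative ?D (at (x + s *\<^sub>R v + t *\<^sub>R w)) w) (at t)" if "0 \<le> t" "t \<le> h" for t
    using along[OF smooth_on_frechet[OF assms(1), of v], of "x + s *\<^sub>R v" t w] inS[of s t] that s by auto
  from MVT2[OF assms(2) this] obtain t where t: "0 < t" "t < h" and
    2: "?D (x + s *\<^sub>R v + h *\<^sub>R w) - ?D (x + s *\<^sub>R v) =
       h * frechet_derivative ?D (at (x + s *\<^sub>R v + t *\<^sub>R w)) w" by auto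
  show ?thesis
    using s t 1 2 by (intro exI[of _ s] exI[of _ t]) (simp add: algebra_simps)
qed

text \<open>The second difference does not depend on the order of v and w, so the two mixed
  derivatives agree at two points near x; continuity carries the equality to x.\<close>

lemma second_derivative_symmetric_real:
  fixes f :: "'a::real_normed_vector \<Rightarrow> real"
  assumes "open S" "smooth_on S f" "x \<in> S"
  shows "frechet_derivative (\<lambda>y. frechet_derivative f (at y) v) (at x) w =
         frechet_derivative (\<lambda>y. frechet_derivative f (at y) w) (at x) v"
proof -
  define A where "A = (\<lambda>v w x. frechet_derivative (\<lambda>y. frechet_derivative f (at y) v) (at x) w)"
  have "\<bar>A v w x - A w v x\<bar> \<le> e" if "e > 0" for e
  proof -
    have near: "\<exists>d>0. \<forall>y. dist y x < d \<longrightarrow> \<bar>A v w y - A v w x\<bar> < e/2" for v w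
    proof -
      have "continuous_on S (A v w)"
        unfolding A_def by (intro smooth_on_continuous smooth_on_frechet assms)
      then have "isCont (A v w) x" using assms continuous_on_eq_continuous_at by blast
      then show ?thesis
        using \<open>e > 0\<close> half_gt_zero[of e] unfolding continuous_at_eps_delta dist_real_def
        by blast
    qed
    obtain d0 where d0: "d0 > 0" "ball x d0 \<subseteq> S" using assms openE by blast
    obtain d1 where d1: "d1 > 0" "\<And>y. dist y x < d1 \<Longrightarrow> \<bar>A v w y - A v w x\<bar> < e/2"
      using near by blast
    obtain d2 where d2: "d2 > 0" "\<And>y. dist y x < d2 \<Longrightarrow> \<bar>A w v y - A w v x\<bar> < e/2"
      using near by blast
    define d where "d = min d0 (min d1 d2)"
    \<comment> \<open>The parallelogram with sides \<open>h *\<^sub>R v\<close> and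
      \<open>h *\<^sub>R w\<close> then stays within distance d of x; the summand 1 allows for both
      vectors being zero.\<close>
    define h where "h = d / (norm v + norm w + 1)"
    have "d > 0" using d0 d1 d2 by (simp add: d_def)
    then have h: "h > 0" by (simp add: h_def add_nonneg_pos)
    \<comment> \<open>Stated for any vectors with the same sum of norms, so that it serves both
      orders of v and w.\<close>
    have close: "dist (x + s *\<^sub>R v' + t *\<^sub>R w') x < d"
      if "0 \<le> s" "s \<le> h" "0 \<le> t" "t \<le> h" "norm v' + norm w' = norm v + norm w" for s t v' w'
    proof -
      have "dist (x + s *\<^sub>R v' + t *\<^sub>R w') x = norm (s *\<^sub>R v' + t *\<^sub>R w')"
        by (simp add: dist_norm algebra_simps)
      also have "\<dots> \<le> s * norm v' + t * norm w'"
        using norm_triangle_ineq[of "s *\<^sub>R v'" "t *\<^sub>R w'"] that by simp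
      also have "\<dots> \<le> h * norm v' + h * norm w'"
        using that by (intro add_mono mult_right_mono) auto
      also have "\<dots> = h * (norm v + norm w)" using that by (simp flip: distrib_left)
      also have "\<dots> < h * (norm v + norm w + 1)" using h by simp
      also have "\<dots> = d" unfolding h_def
        by (metis add_nonneg_pos add_nonneg_nonneg less_numeral_extra(1) nonzero_eq_divide_eq norm_ge_zero order_less_irrefl)
      finally show ?thesis .
    qed
    have inS: "x + s *\<^sub>R v' + t *\<^sub>R w' \<in> S"
      if "0 \<le> s" "s \<le> h" "0 \<le> t" "t \<le> h" "norm v' + norm w' = norm v + norm w" for s t v' w'
      using close[OF that] d0 by (auto simp: d_def dist_commute)
    obtain s t where st: "0 < s" "s < h" "0 < t" "t < h" and
      1: "f (x + h *\<^sub>R v + h *\<^sub>R w) - f (x + h *\<^sub>R v) - f (x + h *\<^sub>R w) + f x =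
        h * (h * A v w (x + s *\<^sub>R v + t *\<^sub>R w))"
      unfolding A_def using second_difference_mean_value[OF assms(2) h, of x v w] inS by blast
    obtain s' t' where st': "0 < s'" "s' < h" "0 < t'" "t' < h" and
      2: "f (x + h *\<^sub>R w + h *\<^sub>R v) - f (x + h *\<^sub>R w) - f (x + h *\<^sub>R v) + f x =
        h * (h * A w v (x + s' *\<^sub>R w + t' *\<^sub>R v))"
      unfolding A_def using second_difference_mean_value[OF assms(2) h, of x w v] inS
      by (metis add.commute)
    have "x + h *\<^sub>R w + h *\<^sub>R v = x + h *\<^sub>R v + h *\<^sub>R w" by simp
    with 1 2 h have "A v w (x + s *\<^sub>R v + t *\<^sub>R w) = A w v (x + s' *\<^sub>R w + t' *\<^sub>R v)"
      by (smt (verit) mult_cancel_left)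
    moreover have "\<bar>A v w (x + s *\<^sub>R v + t *\<^sub>R w) - A v w x\<bar> < e/2"
      using close[of s t v w] st by (intro d1) (auto simp: d_def)
    moreover have "\<bar>A w v (x + s' *\<^sub>R w + t' *\<^sub>R v) - A w v x\<bar> < e/2"
      using close[of s' t' w v] st' by (intro d2) (auto simp: d_def)
    ultimately show ?thesis by linarith
  qed
  then have "\<bar>A v w x - A w v x\<bar> \<le> 0" by (rule field_le_epsilon) simp
  then show ?thesis by (simp add: A_def)
qed

lemma second_derivative_symmetric:
  fixes f :: "'a::real_normed_vector \<Rightarrow> 'b::euclidean_space"
  assumes "open S" "smooth_on S f" "x \<in> S"
  shows "frechet_derivative (\<lambda>y. frechet_derivative f (at y) v) (at x) w =
         frechet_derivative (\<lambda>y. frechet_derivative f (at y) w) (at x) v"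
proof (rule euclidean_eqI)
  fix b :: 'b
  have comp: "frechet_derivative (\<lambda>y. frechet_derivative f (at y) v) (at x) w \<bullet> b =
     frechet_derivative (\<lambda>y. frechet_derivative (\<lambda>z. f z \<bullet> b) (at y) v) (at x) w" for v w
  proof -
    have "frechet_derivative (\<lambda>z. f z \<bullet> b) (at y) v = frechet_derivative f (at y) v \<bullet> b" if "y \<in> S" for y v
      using frechet_derivative_linear_compose[OF bounded_linear_inner_left smooth_on_differentiable[OF assms(2) that]] .
    moreover have "((\<lambda>y. frechet_derivative f (at y) v \<bullet> b) has_derivative
        (\<lambda>w. frechet_derivative (\<lambda>y. frechet_derivative f (at y) v) (at x) w \<bullet> b)) (at x)"
      by (intro bounded_linear.has_derivative[OF bounded_linear_inner_left]
          smooth_on_has_derivative[OF smooth_on_frechet[OF assms(2)] assms(3)])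
    ultimately have "((\<lambda>y. frechet_derivative (\<lambda>z. f z \<bullet> b) (at y) v) has_derivative
        (\<lambda>w. frechet_derivative (\<lambda>y. frechet_derivative f (at y) v) (at x) w \<bullet> b)) (at x)"
      by (auto intro: has_derivative_transform_within_open[OF _ assms(1,3)])
    then show ?thesis by (rule frechet_derivative_eqI[symmetric])
  qed
  show "frechet_derivative (\<lambda>y. frechet_derivative f (at y) v) (at x) w \<bullet> b =
        frechet_derivative (\<lambda>y. frechet_derivative f (at y) w) (at x) v \<bullet> b"
    unfolding comp
    by (intro second_derivative_symmetric_real[OF assms(1) _ assms(3)]
        smooth_on_linear_compose[OF assms(1) bounded_linear_inner_left assms(2)])
qed

text \<open>A linear left inverse P yields three chart conditions at once: injectivity of \<phi>,
  injectivity of its differential, and continuity of the inverse, which is a restriction of P. All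
  charts built below are graphs of this kind.\<close>

lemma local_param_graph:
  assumes "open U" "smooth_on U \<phi>" "bounded_linear P" "\<And>u. u \<in> U \<Longrightarrow> P (\<phi> u) = u"
    and "openin (top_of_set M) (\<phi> ` U)"
  shows "local_param M U \<phi>"
proof -
  have inj: "inj_on \<phi> U" by (metis assms(4) inj_onI)
  have inv: "inv_into U \<phi> x = P x" if "x \<in> \<phi> ` U" for x
    using that assms(4) inj by (auto simp: inv_into_f_f)
  have "inj (frechet_derivative \<phi> (at u))" if "u \<in> U" for u
  proof (rule inj_on_inverseI)
    fix v
    have "((\<lambda>u. P (\<phi> u)) has_derivative (\<lambda>v. P (frechet_derivative \<phi> (at u) v))) (at u)"
      by (intro bounded_linear.has_derivative[OF assms(3)] smooth_on_has_derivative[OF assms(2) that])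
    then have "((\<lambda>u. u) has_derivative (\<lambda>v. P (frechet_derivative \<phi> (at u) v))) (at u)"
      using has_derivative_transform_within_open[OF _ assms(1) that, of _ _ UNIV "\<lambda>u. u"] assms(4) by auto
    then have "(\<lambda>v. P (frechet_derivative \<phi> (at u) v)) = (\<lambda>v. v)"
      using has_derivative_unique has_derivative_ident by blast
    then show "P (frechet_derivative \<phi> (at u) v) = v" by metis
  qed
  moreover have "continuous_on (\<phi> ` U) (inv_into U \<phi>)"
    using linear_continuous_on[OF assms(3)] by (simp add: inv cong: continuous_on_cong)
  ultimately show ?thesis using assms inj by (simp add: local_param_def)
qed

section \<open>The curvature of a parametrized round sphere\<close>

text \<open>Valid also at points of non-differentiability: f and g have the same derivatives at x,
  so the choice behind \<open>frechet_derivative\<close> coincides.\<close>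

lemma frechet_derivative_cong:
  assumes "open S" "x \<in> S" "\<And>y. y \<in> S \<Longrightarrow> f y = g y"
  shows "frechet_derivative f (at x) = frechet_derivative g (at x)"
proof -
  have "(f has_derivative F) (at x) \<longleftrightarrow> (g has_derivative F) (at x)" for F
    using assms by (auto intro: has_derivative_transform_within_open[OF _ assms(1,2)])
  then show ?thesis by (simp add: frechet_derivative_def)
qed

lemma differentiable_cong_open:
  assumes "f differentiable at x" "open S" "x \<in> S" "\<And>y. y \<in> S \<Longrightarrow> f y = g y"
  shows "g differentiable at x"
proof -
  obtain F where "(f has_derivative F) (at x)" using assms(1) unfolding differentiable_def by blast
  then have "(g has_derivative F) (at x)"
    by (rule has_derivative_transform_within_open[OF _ assms(2,3,4)])
  then show ?thesis unfolding differentiable_def by blast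
qed

lemma partial_deriv_cong:
  "open U \<Longrightarrow> u \<in> U \<Longrightarrow> (\<And>w. w \<in> U \<Longrightarrow> f w = g w) \<Longrightarrow> partial_deriv i f u = partial_deriv i g u"
  unfolding partial_deriv_def by (simp add: frechet_derivative_cong[of U u f g])

lemma smooth_on_partial_deriv: "smooth_on U f \<Longrightarrow> smooth_on U (partial_deriv i f)"
  unfolding partial_deriv_def[abs_def] by (rule smooth_on_frechet)

lemma partial_deriv_inner:
  assumes "f differentiable at u" "g differentiable at u"
  shows "partial_deriv i (\<lambda>w. f w \<bullet> g w) u = partial_deriv i f u \<bullet> g u + f u \<bullet> partial_deriv i g u"
proof -
  have "((\<lambda>w. f w \<bullet> g w) has_derivative
      (\<lambda>h. f u \<bullet> frechet_derivative g (at u) h + frechet_derivative f (at u) h \<bullet> g u)) (at u)"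
    using assms by (intro has_derivative_inner) (auto simp: frechet_derivative_works)
  from frechet_derivative_eqI[OF this] show ?thesis by (simp add: partial_deriv_def)
qed

lemma partial_deriv_commute:
  fixes f :: "real^'n \<Rightarrow> 'b::euclidean_space"
  assumes "open U" "smooth_on U f" "u \<in> U"
  shows "partial_deriv i (partial_deriv j f) u = partial_deriv j (partial_deriv i f) u"
  using second_derivative_symmetric[OF assms] by (simp add: partial_deriv_def[abs_def])

lemma matrix_inv_inverse:
  fixes A :: "real^'n^'n"
  assumes "invertible A"
  shows "A ** matrix_inv A = mat 1" "matrix_inv A ** A = mat 1"
  using someI_ex[OF assms[unfolded invertible_def]] by (simp_all add: matrix_inv_def)

lemma matrix_inv_2:
  fixes A :: "real^2^2"
  assumes "det A \<noteq> 0"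
  shows "matrix_inv A $ 1 $ 1 = A $ 2 $ 2 / det A" "matrix_inv A $ 1 $ 2 = - A $ 1 $ 2 / det A"
    "matrix_inv A $ 2 $ 1 = - A $ 2 $ 1 / det A" "matrix_inv A $ 2 $ 2 = A $ 1 $ 1 / det A"
proof -
  let ?B = "vector [vector [A $ 2 $ 2 / det A, - A $ 1 $ 2 / det A],
                    vector [- A $ 2 $ 1 / det A, A $ 1 $ 1 / det A]] :: real^2^2"
  have AB: "A ** ?B = mat 1"
    using assms
    by (simp add: vec_eq_iff forall_2 matrix_matrix_mult_def sum_2 mat_def det_2 mult.commute
        flip: diff_divide_distrib)
  have inv: "invertible A" using assms by (simp add: invertible_det_nz)
  have "matrix_inv A = matrix_inv A ** (A ** ?B)" by (simp only: AB matrix_mul_rid)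
  also have "\<dots> = ?B" by (simp add: matrix_mul_assoc matrix_inv_inverse[OF inv])
  finally show "matrix_inv A $ 1 $ 1 = A $ 2 $ 2 / det A" "matrix_inv A $ 1 $ 2 = - A $ 1 $ 2 / det A"
    "matrix_inv A $ 2 $ 1 = - A $ 2 $ 1 / det A" "matrix_inv A $ 2 $ 2 = A $ 1 $ 1 / det A" by simp_all
qed

text \<open>The squared determinant is the Gram determinant of the rows. Expanded along its first
  row, it keeps only the first term when x is orthogonal to a and b.\<close>

lemma det_rows_square_orthogonal:
  fixes x a b :: "real^3"
  assumes "x \<bullet> a = 0" "x \<bullet> b = 0"
  shows "(det (vector [x, a, b] :: real^3^3))\<^sup>2 = (x \<bullet> x) * ((a \<bullet> a) * (b \<bullet> b) - (a \<bullet> b)\<^sup>2)"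
proof -
  have "(det (vector [x, a, b] :: real^3^3))\<^sup>2 =
     (x \<bullet> x) * ((a \<bullet> a) * (b \<bullet> b) - (a \<bullet> b)\<^sup>2) - (x \<bullet> a) * ((x \<bullet> a) * (b \<bullet> b) - (a \<bullet> b) * (x \<bullet> b))
      + (x \<bullet> b) * ((x \<bullet> a) * (a \<bullet> b) - (a \<bullet> a) * (x \<bullet> b))"
    by (simp add: det_3 inner_vec_def sum_3 power2_eq_square algebra_simps)
  then show ?thesis by (simp add: assms)
qed

text \<open>By the Gram determinant the three vectors form a basis. This reduces a vector identity
  in the moving frame of a surface to its three inner products.\<close>

lemma orthogonal_to_frame_eq_zero:
  fixes x a b y :: "real^3"
  assumes "x \<bullet> a = 0" "x \<bullet> b = 0" "x \<noteq> 0" "(a \<bullet> a) * (b \<bullet> b) - (a \<bullet> b)\<^sup>2 \<noteq> 0"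
    and "y \<bullet> x = 0" "y \<bullet> a = 0" "y \<bullet> b = 0"
  shows "y = 0"
proof -
  let ?M = "vector [x, a, b] :: real^3^3"
  have "(det ?M)\<^sup>2 \<noteq> 0" using assms by (simp add: det_rows_square_orthogonal)
  then have "invertible ?M" by (simp add: invertible_det_nz)
  moreover have "?M *v y = 0"
    using assms(5-7) by (simp add: vec_eq_iff forall_3 matrix_vector_mul_component inner_commute)
  ultimately show ?thesis using matrix_left_invertible_ker[of ?M] unfolding invertible_def by blast
qed

lemma gram_pos:
  fixes f :: "real^2 \<Rightarrow> 'b::real_inner"
  assumes "linear f" "inj f"
  shows "(f (axis 1 1) \<bullet> f (axis 1 1)) * (f (axis 2 1) \<bullet> f (axis 2 1)) - (f (axis 1 1) \<bullet> f (axis 2 1))\<^sup>2 > 0"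
proof -
  let ?a = "f (axis 1 1)" and ?b = "f (axis 2 1)"
  have b0: "?b \<noteq> 0"
    using assms linear_injective_0[of f] by (metis axis_eq_0_iff zero_neq_one)
  \<comment> \<open>Its image is \<open>?b \<bullet> ?b\<close> times the component of
    \<open>?a\<close> orthogonal to \<open>?b\<close>; the squared length of that component is the
    Gram determinant divided by \<open>?b \<bullet> ?b\<close>.\<close>
  let ?w = "(?b \<bullet> ?b) *\<^sub>R axis 1 1 - (?a \<bullet> ?b) *\<^sub>R axis 2 1 :: real^2"
  have "?w $ 1 = ?b \<bullet> ?b" by (simp add: axis_def)
  then have "?w \<noteq> 0" using b0 by (metis inner_eq_zero_iff zero_index)
  then have "f ?w \<noteq> 0" using assms linear_injective_0 by blast
  then have "f ?w \<bullet> f ?w > 0" by simp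
  moreover have "f ?w \<bullet> f ?w = (?b \<bullet> ?b) * ((?a \<bullet> ?a) * (?b \<bullet> ?b) - (?a \<bullet> ?b)\<^sup>2)"
    using assms(1)
    by (simp add: linear_diff linear_scale inner_diff_left inner_diff_right inner_commute
        power2_eq_square algebra_simps)
  ultimately show ?thesis using b0
    by (metis inner_gt_zero_iff zero_less_mult_pos)
qed

text \<open>Cramer's rule for the symmetric matrix with diagonal a, b and off-diagonal entry c. The
  solution has the shape of the Christoffel symbols of a surface, which identifies the tangential
  part of a second derivative.\<close>

lemma cramer_2:
  fixes a b c p q D :: real
  assumes "D = a * b - c\<^sup>2" "D \<noteq> 0"
  shows "(b * p - c * q) / D * a + (a * q - c * p) / D * c = p"
    and "(b * p - c * q) / D * c + (a * q - c * p) / D * b = q"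
proof -
  have "(b * p - c * q) * a + (a * q - c * p) * c = p * D" "(b * p - c * q) * c + (a * q - c * p) * b = q * D"
    unfolding assms(1) by (simp_all add: algebra_simps power2_eq_square)
  then show "(b * p - c * q) / D * a + (a * q - c * p) / D * c = p"
    "(b * p - c * q) / D * c + (a * q - c * p) / D * b = q"
    using assms(2) by (simp_all add: field_simps)
qed

text \<open>X itself is normal to the sphere, so the Gauss formula is explicit. Differentiating it
  for \<open>H 2 2\<close> and \<open>H 1 2\<close> gives two expressions for one third derivative
  of X. Paired with \<open>E 1\<close>, their Christoffel terms differ by the curvature with lowered
  index, while the terms along X contribute
  \<open>(G 1 1 * G 2 2 - (G 1 2)\<^sup>2) / r\<^sup>2\<close>.\<close>

lemma sphere_coord_curvature:
  fixes X :: "real^2 \<Rightarrow> real^3"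
  assumes U: "open U" and X: "smooth_on U X" and r: "r > 0"
    and sph: "\<And>u. u \<in> U \<Longrightarrow> X u \<bullet> X u = r\<^sup>2"
    and inj: "\<And>u. u \<in> U \<Longrightarrow> inj (frechet_derivative X (at u))"
    and G: "\<And>u i j. u \<in> U \<Longrightarrow> G u $ i $ j = partial_deriv i X u \<bullet> partial_deriv j X u"
    and u: "u \<in> U"
  shows "coord_gaussian_curvature G u = 1 / r\<^sup>2"
proof -
  define E where "E i = partial_deriv i X" for i
  define H where "H i j = partial_deriv i (E j)" for i j
  have sE: "smooth_on U (E i)" for i unfolding E_def by (rule smooth_on_partial_deriv[OF X])
  have sH: "smooth_on U (H i j)" for i j unfolding H_def by (rule smooth_on_partial_deriv[OF sE])
  note diff = smooth_on_differentiable[OF X] smooth_on_differentiable[OF sE] smooth_on_differentiable[OF sH]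
  have Hsym: "H i j w = H j i w" if "w \<in> U" for i j w
    unfolding H_def E_def by (rule partial_deriv_commute[OF U X that])
  have GE: "G w $ i $ j = E i w \<bullet> E j w" if "w \<in> U" for w i j using G[OF that] by (simp add: E_def)
  have detG: "det (G w) = (E 1 w \<bullet> E 1 w) * (E 2 w \<bullet> E 2 w) - (E 1 w \<bullet> E 2 w)\<^sup>2" if "w \<in> U" for w
    using that by (simp add: det_2 GE power2_eq_square inner_commute)
  have detpos: "det (G w) > 0" if "w \<in> U" for w
    unfolding detG[OF that] E_def partial_deriv_def
    by (intro gram_pos inj that linear_frechet_derivative diff)
  have XE: "X w \<bullet> E i w = 0" if "w \<in> U" for w i
  proof -
    have "partial_deriv i (\<lambda>w. X w \<bullet> X w) w = partial_deriv i (\<lambda>w. r\<^sup>2) w"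
      by (rule partial_deriv_cong[OF U that sph])
    then show ?thesis using partial_deriv_inner[OF diff(1)[OF that] diff(1)[OF that], of i]
      by (simp add: partial_deriv_def frechet_derivative_const E_def inner_commute)
  qed
  have XH: "X w \<bullet> H i j w = - G w $ i $ j" if "w \<in> U" for w i j
  proof -
    have "partial_deriv i (\<lambda>w. X w \<bullet> E j w) w = partial_deriv i (\<lambda>w. 0) w"
      by (rule partial_deriv_cong[OF U that XE])
    then show ?thesis using partial_deriv_inner[OF diff(1)[OF that] diff(2)[OF that], of i j]
      by (simp add: partial_deriv_def frechet_derivative_const E_def H_def GE[OF that])
  qed
  have dG: "partial_deriv l (\<lambda>w. G w $ i $ j) w = H l i w \<bullet> E j w + E i w \<bullet> H l j w" if "w \<in> U" for l i j w
    using partial_deriv_cong[OF U that, of "\<lambda>w. G w $ i $ j" "\<lambda>w. E i w \<bullet> E j w" l, OF GE] partial_deriv_inner[OF diff(2)[OF that] diff(2)[OF that], of l i j]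
    by (simp add: H_def GE)
  define \<Gamma> where "\<Gamma> = christoffel G"
  \<comment> \<open>Since second derivatives commute, the three metric derivatives in a Christoffel
    symbol collapse to twice \<open>H i j w \<bullet> E l w\<close>.\<close>
  have \<Gamma>_eq: "\<Gamma> k i j w = (\<Sum>l\<in>UNIV. matrix_inv (G w) $ k $ l * (H i j w \<bullet> E l w))" if "w \<in> U" for k i j w
  proof -
    have 2: "H i j w \<bullet> E l w + E j w \<bullet> H i l w + (H j i w \<bullet> E l w + E i w \<bullet> H j l w)
       - (H l i w \<bullet> E j w + E i w \<bullet> H l j w) = 2 * (H i j w \<bullet> E l w)" for l
      by (simp add: Hsym[OF that, of i l] Hsym[OF that, of j i] Hsym[OF that, of j l] inner_commute)
    show ?thesis
      unfolding \<Gamma>_def christoffel_def dG[OF that] 2 by (simp add: sum_distrib_left mult.left_commute)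
  qed
  have \<Gamma>1: "\<Gamma> 1 i j w = (G w $ 2 $ 2 * (H i j w \<bullet> E 1 w) - G w $ 1 $ 2 * (H i j w \<bullet> E 2 w)) / det (G w)"
    and \<Gamma>2: "\<Gamma> 2 i j w = (G w $ 1 $ 1 * (H i j w \<bullet> E 2 w) - G w $ 1 $ 2 * (H i j w \<bullet> E 1 w)) / det (G w)"
    if "w \<in> U" for i j w
    using detpos[OF that] that
    by (simp_all add: \<Gamma>_eq sum_2 matrix_inv_2 diff_divide_distrib GE inner_commute)
  \<comment> \<open>Gauss formula: the second fundamental form with respect to the normal \<open>X / r\<close> is \<open>- G / r\<close>.\<close>
  have gauss: "H i j w = \<Gamma> 1 i j w *\<^sub>R E 1 w + \<Gamma> 2 i j w *\<^sub>R E 2 w - (G w $ i $ j / r\<^sup>2) *\<^sub>R X w"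
    if w: "w \<in> U" for i j w
  proof -
    let ?y = "H i j w - (\<Gamma> 1 i j w *\<^sub>R E 1 w + \<Gamma> 2 i j w *\<^sub>R E 2 w - (G w $ i $ j / r\<^sup>2) *\<^sub>R X w)"
    have XX: "X w \<bullet> X w = r\<^sup>2" by (rule sph[OF w])
    have "?y = 0"
    proof (rule orthogonal_to_frame_eq_zero[of "X w" "E 1 w" "E 2 w"])
      show "X w \<noteq> 0" using XX r by auto
      show "E 1 w \<bullet> E 1 w * (E 2 w \<bullet> E 2 w) - (E 1 w \<bullet> E 2 w)\<^sup>2 \<noteq> 0"
        using detpos[OF w] detG[OF w] by simp
      show "?y \<bullet> X w = 0"
        using XH[OF w, of i j] XE[OF w] XX r
        by (subst inner_commute) (simp add: inner_diff_right inner_add_right)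
      show "?y \<bullet> E 1 w = 0"
        using XE[OF w] detpos[OF w] detG[OF w]
        unfolding inner_diff_left inner_add_left inner_scaleR_left \<Gamma>1[OF w] \<Gamma>2[OF w] GE[OF w]
        using cramer_2(1)[OF detG[OF w], of "H i j w \<bullet> E 1 w" "H i j w \<bullet> E 2 w"]
        by (simp add: inner_commute[of "E 2 w" "E 1 w"])
      show "?y \<bullet> E 2 w = 0"
        using XE[OF w] detpos[OF w] detG[OF w]
        unfolding inner_diff_left inner_add_left inner_scaleR_left \<Gamma>1[OF w] \<Gamma>2[OF w] GE[OF w]
        using cramer_2(2)[OF detG[OF w], of "H i j w \<bullet> E 1 w" "H i j w \<bullet> E 2 w"]
        by (simp add: inner_commute[of "E 2 w" "E 1 w"])
    qed (use XE[OF w] in auto)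
    then show ?thesis by simp
  qed
  have G_diff: "(\<lambda>w. G w $ i $ j) differentiable at w" if "w \<in> U" for i j w
  proof -
    have "(\<lambda>w. E i w \<bullet> E j w) differentiable at w" using diff(2)[OF that] by simp
    then show ?thesis by (rule differentiable_cong_open[OF _ U that]) (simp add: GE)
  qed
  have \<Gamma>_diff: "\<Gamma> k i j differentiable at w" if "w \<in> U" for i j k w
  proof -
    have dd: "(\<lambda>w. det (G w)) differentiable at w"
      unfolding det_2 using G_diff[OF that] by simp
    have n0: "det (G w) \<noteq> 0" using detpos[OF that] by simp
    have d: "(\<lambda>w. (G w $ 2 $ 2 * (H i j w \<bullet> E 1 w) - G w $ 1 $ 2 * (H i j w \<bullet> E 2 w)) / det (G w)) differentiable at w"
      "(\<lambda>w. (G w $ 1 $ 1 * (H i j w \<bullet> E 2 w) - G w $ 1 $ 2 * (H i j w \<bullet> E 1 w)) / det (G w)) differentiable at w"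
      using G_diff[OF that] diff[OF that] dd n0 by simp_all
    have "\<Gamma> 1 i j differentiable at w" "\<Gamma> 2 i j differentiable at w"
      by (rule differentiable_cong_open[OF d(1) U that], simp add: \<Gamma>1)
        (rule differentiable_cong_open[OF d(2) U that], simp add: \<Gamma>2)
    then show ?thesis using exhaust_2[of k] by auto
  qed
  \<comment> \<open>Pairing with \<open>E 1\<close> is enough because the curvature has its upper
    index lowered to 1; it also kills the derivative of the coefficient of X, as X is orthogonal to
    \<open>E 1\<close>.\<close>
  have dgauss: "partial_deriv i (H j k) u \<bullet> E 1 u =
      partial_deriv i (\<Gamma> 1 j k) u * (E 1 u \<bullet> E 1 u) + \<Gamma> 1 j k u * (H i 1 u \<bullet> E 1 u)
    + partial_deriv i (\<Gamma> 2 j k) u * (E 2 u \<bullet> E 1 u) + \<Gamma> 2 j k u * (H i 2 u \<bullet> E 1 u)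
    - G u $ j $ k / r\<^sup>2 * (E i u \<bullet> E 1 u)" for i j k
  proof -
    have d: "(f has_derivative frechet_derivative f (at u)) (at u)" if "f differentiable at u"
      for f :: "real^2 \<Rightarrow> 'z::real_normed_vector"
      using that frechet_derivative_works by blast
    have g: "((\<lambda>w. G w $ j $ k / r\<^sup>2) has_derivative
        (\<lambda>h. frechet_derivative (\<lambda>w. G w $ j $ k) (at u) h / r\<^sup>2)) (at u)"
      by (rule bounded_linear.has_derivative[OF bounded_linear_divide d[OF G_diff[OF u]]])
    have "((\<lambda>w. \<Gamma> 1 j k w *\<^sub>R E 1 w + \<Gamma> 2 j k w *\<^sub>R E 2 w - (G w $ j $ k / r\<^sup>2) *\<^sub>R X w) has_derivative
       (\<lambda>h. \<Gamma> 1 j k u *\<^sub>R frechet_derivative (E 1) (at u) h + frechet_derivative (\<Gamma> 1 j k) (at u) h *\<^sub>R E 1 u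
          + (\<Gamma> 2 j k u *\<^sub>R frechet_derivative (E 2) (at u) h + frechet_derivative (\<Gamma> 2 j k) (at u) h *\<^sub>R E 2 u)
          - ((G u $ j $ k / r\<^sup>2) *\<^sub>R frechet_derivative X (at u) h
             + (frechet_derivative (\<lambda>w. G w $ j $ k) (at u) h / r\<^sup>2) *\<^sub>R X u))) (at u)"
      by (intro has_derivative_diff[OF has_derivative_add[OF has_derivative_scaleR[OF d d]
            has_derivative_scaleR[OF d d]] has_derivative_scaleR[OF g d]]
          diff[OF u] \<Gamma>_diff[OF u])
    from frechet_derivative_eqI[OF this, of "axis i 1"]
    have pd: "partial_deriv i (H j k) u = \<Gamma> 1 j k u *\<^sub>R H i 1 u + partial_deriv i (\<Gamma> 1 j k) u *\<^sub>R E 1 u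
          + (\<Gamma> 2 j k u *\<^sub>R H i 2 u + partial_deriv i (\<Gamma> 2 j k) u *\<^sub>R E 2 u)
          - ((G u $ j $ k / r\<^sup>2) *\<^sub>R E i u + (partial_deriv i (\<lambda>w. G w $ j $ k) u / r\<^sup>2) *\<^sub>R X u)"
      using partial_deriv_cong[OF U u, of "H j k" _ i, OF gauss]
      by (simp add: partial_deriv_def H_def E_def)
    show ?thesis using XE[OF u, of 1]
      unfolding pd inner_diff_left inner_add_left inner_scaleR_left by simp
  qed
  have HE: "H i j u \<bullet> E 1 u = \<Gamma> 1 i j u * (E 1 u \<bullet> E 1 u) + \<Gamma> 2 i j u * (E 2 u \<bullet> E 1 u)" for i j
    using gauss[OF u, of i j] XE[OF u, of 1] by (simp add: inner_diff_left inner_add_left)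
  have comm: "partial_deriv 1 (H 2 2) u = partial_deriv 2 (H 1 2) u"
    unfolding H_def by (rule partial_deriv_commute[OF U sE u])
  have "(\<Sum>l\<in>UNIV. G u $ 1 $ l * riemann_curvature G l 2 1 2 u) = det (G u) / r\<^sup>2"
    unfolding riemann_curvature_def \<Gamma>_def[symmetric] sum_2 detG[OF u] GE[OF u]
    using dgauss[of 1 2 2, unfolded HE GE[OF u] comm] dgauss[of 2 1 2, unfolded HE GE[OF u]]
    by (simp add: inner_commute[of "E 2 u" "E 1 u"] algebra_simps diff_divide_distrib power2_eq_square)
  then show ?thesis
    using detpos[OF u] by (simp add: coord_gaussian_curvature_def)
qed

section \<open>The area of a round sphere\<close>

text \<open>The first entry will be the radial factor of a cone, the other two the parameters of a
  chart. The cone map then goes from \<open>real^3\<close> to itself and has a Jacobian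
  determinant.\<close>

definition cons3 :: "real \<Rightarrow> real^2 \<Rightarrow> real^3" where "cons3 s u = vector [s, u $ 1, u $ 2]"
definition tail3 :: "real^3 \<Rightarrow> real^2" where "tail3 w = vector [w $ 2, w $ 3]"

lemma cons3_nth [simp]: "cons3 s u $ 1 = s" "cons3 s u $ 2 = u $ 1" "cons3 s u $ 3 = u $ 2"
  by (simp_all add: cons3_def)

lemma tail3_nth [simp]: "tail3 w $ 1 = w $ 2" "tail3 w $ 2 = w $ 3"
  by (simp_all add: tail3_def)

lemma tail3_cons3 [simp]: "tail3 (cons3 s u) = u"
  by (simp add: vec_eq_iff forall_2)

lemma cons3_tail3 [simp]: "cons3 (w $ 1) (tail3 w) = w"
  by (simp add: vec_eq_iff forall_3)

lemma tail3_axis [simp]: "tail3 (axis 1 1) = 0" "tail3 (axis 2 1) = axis 1 1" "tail3 (axis 3 1) = axis 2 1"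
  by (simp_all add: vec_eq_iff forall_2 axis_def)

lemma bounded_linear_tail3: "bounded_linear tail3"
  by (rule linear_conv_bounded_linear[THEN iffD1], rule linearI) (simp_all add: vec_eq_iff forall_2)

lemma continuous_on_tail3 [continuous_intros]: "continuous_on S tail3"
  by (rule linear_continuous_on[OF bounded_linear_tail3])

lemma bounded_linear_cons3: "bounded_linear (\<lambda>(s, u). cons3 s u)"
  by (rule linear_conv_bounded_linear[THEN iffD1], rule linearI)
    (auto simp: vec_eq_iff forall_3)

lemma borel_measurable_cons3: "(\<lambda>(s, u). cons3 s u) \<in> borel_measurable borel"
  by (rule borel_measurable_continuous_onI[OF linear_continuous_on[OF bounded_linear_cons3]])

lemma prod_Basis_cart:
  fixes x :: "real^'n"
  shows "(\<Prod>b\<in>Basis. x \<bullet> b) = (\<Prod>i\<in>UNIV. x $ i)"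
proof -
  have B: "(Basis :: (real^'n) set) = (\<lambda>i. axis i 1) ` UNIV" by (auto simp: Basis_vec_def)
  show ?thesis unfolding B
    by (subst prod.reindex) (auto simp: inj_on_def axis_eq_axis cart_eq_inner_axis)
qed

text \<open>Lebesgue measure is determined by its values on boxes, and a box pulls back to a product
  of boxes.\<close>

lemma lborel_cons3: "distr (lborel \<Otimes>\<^sub>M lborel) borel (\<lambda>(s, u). cons3 s u) = lborel"
proof (rule lborel_eqI[symmetric])
  fix l u :: "real^3"
  assume le: "\<And>b. b \<in> Basis \<Longrightarrow> l \<bullet> b \<le> u \<bullet> b"
  have lei: "l $ i \<le> u $ i" for i
    using le[of "axis i 1"] by (simp add: cart_eq_inner_axis axis_in_Basis_iff)
  have leB: "tail3 l \<bullet> b \<le> tail3 u \<bullet> b" if "b \<in> Basis" for b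
  proof -
    obtain i where b: "b = axis i 1" using \<open>b \<in> Basis\<close> by (auto simp: Basis_vec_def)
    show ?thesis
      unfolding b cart_eq_inner_axis[symmetric]
      using exhaust_2[of i] lei[of 2] lei[of 3] by (elim disjE) simp_all
  qed
  have pre: "(\<lambda>(s, u). cons3 s u) -` box l u = box (l $ 1) (u $ 1) \<times> box (tail3 l) (tail3 u)"
    by (auto simp: mem_box_cart forall_2 forall_3)
  have "emeasure (distr (lborel \<Otimes>\<^sub>M lborel) borel (\<lambda>(s, u). cons3 s u)) (box l u)
      = emeasure (lborel \<Otimes>\<^sub>M lborel) (box (l $ 1) (u $ 1) \<times> box (tail3 l) (tail3 u))"
    using borel_measurable_cons3
    by (subst emeasure_distr) (auto simp: lborel_prod pre)
  also have "\<dots> = emeasure lborel (box (l $ 1) (u $ 1)) * emeasure lborel (box (tail3 l) (tail3 u))"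
    by (rule lborel.emeasure_pair_measure_Times) auto
  also have "\<dots> = ennreal (u $ 1 - l $ 1) * ennreal (\<Prod>b\<in>Basis. (tail3 u - tail3 l) \<bullet> b)"
    using leB lei by (simp add: emeasure_lborel_box)
  also have "\<dots> = ennreal ((u $ 1 - l $ 1) * (\<Prod>b\<in>Basis. (tail3 u - tail3 l) \<bullet> b))"
    by (rule ennreal_mult'[symmetric]) (use lei in simp)
  also have "(u $ 1 - l $ 1) * (\<Prod>b\<in>Basis. (tail3 u - tail3 l) \<bullet> b) = (\<Prod>b\<in>Basis. (u - l) \<bullet> b)"
    unfolding prod_Basis_cart UNIV_2 UNIV_3 by (simp add: mult.assoc)
  finally show "emeasure (distr (lborel \<Otimes>\<^sub>M lborel) borel (\<lambda>(s, u). cons3 s u)) (box l u)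
      = ennreal (\<Prod>b\<in>Basis. (u - l) \<bullet> b)" .
qed simp

lemma nn_integral_lborel_cons3:
  fixes f :: "real^3 \<Rightarrow> ennreal"
  assumes "f \<in> borel_measurable borel"
  shows "(\<integral>\<^sup>+w. f w \<partial>lborel) = (\<integral>\<^sup>+u. (\<integral>\<^sup>+s. f (cons3 s u) \<partial>lborel) \<partial>lborel)"
proof -
  have m: "(\<lambda>p. f (case p of (s, u) \<Rightarrow> cons3 s u)) \<in> borel_measurable (lborel \<Otimes>\<^sub>M lborel)"
    using measurable_compose[OF borel_measurable_cons3 assms] by (simp add: lborel_prod)
  have "(\<integral>\<^sup>+w. f w \<partial>lborel) = (\<integral>\<^sup>+p. f (case p of (s, u) \<Rightarrow> cons3 s u) \<partial>(lborel \<Otimes>\<^sub>M lborel))"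
    unfolding lborel_cons3[symmetric]
    using assms borel_measurable_cons3 by (subst nn_integral_distr) (auto simp: lborel_prod)
  also have "\<dots> = (\<integral>\<^sup>+u. (\<integral>\<^sup>+s. f (cons3 s u) \<partial>lborel) \<partial>lborel)"
    using lborel_pair.nn_integral_snd[OF m] by simp
  finally show ?thesis .
qed

text \<open>Both shells have the same integral of \<open>s\<^sup>2\<close>; one sheet is coned off over each.\<close>

definition shell :: "bool \<Rightarrow> real set" where
  "shell b = (if b then {0<..<1} else {1<..<root 3 2})"

lemma root_3_2: "root 3 2 ^ 3 = 2" "1 < root 3 2"
  by simp_all

lemma shell_bounds: "s \<in> shell b \<Longrightarrow> 0 < s \<and> s < root 3 2 \<and> (s < 1 \<longleftrightarrow> b) \<and> s \<noteq> 1"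
  using less_trans[of s 1 "root 3 2"] by (auto simp: shell_def split: if_splits)

text \<open>The outer radius \<open>root 3 2\<close> solves \<open>c^3 - 1 = 1\<close>, which is
  what makes the second shell match the first.\<close>

lemma nn_integral_shell: "(\<integral>\<^sup>+s. ennreal (indicator (shell b) s * s\<^sup>2) \<partial>lborel) = ennreal (1/3)"
proof -
  have F: "((\<lambda>s. s\<^sup>2) has_integral (c^3 / 3 - a^3 / 3)) {a<..<c}" if "a \<le> c" for a c :: real
    unfolding box_real(1)[symmetric] has_integral_open_interval
    unfolding box_real(2)
    by (rule fundamental_theorem_of_calculus[OF that])
      (auto intro!: derivative_eq_intros simp: has_real_derivative_iff_has_vector_derivative[symmetric])
  have "((\<lambda>s. s\<^sup>2) has_integral (1/3)) (shell b)"
    using F[of 0 1] F[of 1 "root 3 2"] root_3_2 by (simp add: shell_def)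
  from nn_integral_has_integral_lebesgue[OF _ this] show ?thesis by simp
qed

text \<open>Change of variables for \<open>s *\<^sub>R X u\<close>: the columns X, s times
  \<open>X' u (axis 1 1)\<close> and s times \<open>X' u (axis 2 1)\<close> of the Jacobian have
  determinant \<open>r * s\<^sup>2 * g u\<close> up to sign, and integrating over either shell first
  leaves r / 3 times the area. The predicate \<beta> names the sheet; two parameters over the same
  point of the sphere but on different sheets are separated by their shells.\<close>

lemma nn_integral_cone:
  fixes X :: "real^2 \<Rightarrow> real^3" and \<beta> :: "real^2 \<Rightarrow> bool"
  assumes A: "A \<in> sets borel" and r: "r > 0"
    and sph: "\<And>u. u \<in> A \<Longrightarrow> X u \<bullet> X u = r\<^sup>2"
    and der: "\<And>u. u \<in> A \<Longrightarrow> (X has_derivative X' u) (at u)"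
    and orth: "\<And>u v. u \<in> A \<Longrightarrow> X u \<bullet> X' u v = 0"
    and inj: "\<And>u v. u \<in> A \<Longrightarrow> v \<in> A \<Longrightarrow> X u = X v \<Longrightarrow> \<beta> u = \<beta> v \<Longrightarrow> u = v"
    and \<beta>: "A \<inter> {u. \<beta> u} \<in> sets borel"
    and meas: "(\<lambda>u. indicator A u * g u) \<in> borel_measurable borel"
    and g: "\<And>u. u \<in> A \<Longrightarrow> g u =
        sqrt ((X' u (axis 1 1) \<bullet> X' u (axis 1 1)) * (X' u (axis 2 1) \<bullet> X' u (axis 2 1))
            - (X' u (axis 1 1) \<bullet> X' u (axis 2 1))\<^sup>2)"
    and img: "{s *\<^sub>R X u | s u. u \<in> A \<and> s \<in> shell (\<beta> u)} \<in> sets borel"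
  shows "emeasure lborel {s *\<^sub>R X u | s u. u \<in> A \<and> s \<in> shell (\<beta> u)} =
         ennreal (r / 3) * (\<integral>\<^sup>+u\<in>A. ennreal (g u) \<partial>lborel)"
proof -
  define S where "S = {w. tail3 w \<in> A \<and> w $ 1 \<in> shell (\<beta> (tail3 w))}"
  define F where "F w = (w $ 1) *\<^sub>R X (tail3 w)" for w :: "real^3"
  define F' where "F' w h = (w $ 1) *\<^sub>R X' (tail3 w) (tail3 h) + (h $ 1) *\<^sub>R X (tail3 w)" for w h :: "real^3"
  have FS: "F ` S = {s *\<^sub>R X u | s u. u \<in> A \<and> s \<in> shell (\<beta> u)}" (is "_ = ?C")
  proof (intro equalityI subsetI)
    fix y assume "y \<in> ?C"
    then obtain s u where "y = s *\<^sub>R X u" "u \<in> A" "s \<in> shell (\<beta> u)" by auto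
    then show "y \<in> F ` S" by (intro image_eqI[of _ _ "cons3 s u"]) (auto simp: F_def S_def)
  qed (auto simp: F_def S_def)
  have t3: "tail3 \<in> borel_measurable borel"
    by (intro borel_measurable_continuous_onI continuous_intros)
  have S_borel: "S \<in> sets borel"
  proof -
    have eq: "S = tail3 -` (A \<inter> {u. \<beta> u}) \<inter> {w. w $ 1 \<in> shell True} \<union>
      tail3 -` (A - (A \<inter> {u. \<beta> u})) \<inter> {w. w $ 1 \<in> shell False}"
      by (auto simp: S_def) (metis (full_types))+
    have 1: "tail3 -` B \<in> sets borel" if "B \<in> sets borel" for B
      using measurable_sets[OF t3 that] by simp
    have 2: "{w :: real^3. w $ 1 \<in> shell b} \<in> sets borel" for b
    proof -
      have "(\<lambda>w :: real^3. w $ 1) \<in> borel_measurable borel"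
        by (intro borel_measurable_continuous_onI continuous_intros)
      from measurable_sets[OF this, of "shell b"] show ?thesis by (simp add: shell_def vimage_def)
    qed
    show ?thesis unfolding eq by (intro sets.Un sets.Int 1 2 sets.Diff A \<beta>)
  qed
  have X: "norm (X u) = r" if "u \<in> A" for u
    using sph[OF that] r by (simp add: norm_eq_sqrt_inner)
  have F_inj: "inj_on F S"
  proof (rule inj_onI)
    fix w w' assume w: "w \<in> S" and w': "w' \<in> S" and eq: "F w = F w'"
    have pos: "w $ 1 > 0" "w' $ 1 > 0" using w w' shell_bounds by (auto simp: S_def)
    have "norm (F w) = w $ 1 * r" "norm (F w') = w' $ 1 * r"
      using w w' pos X by (auto simp: F_def S_def)
    then have 1: "w $ 1 = w' $ 1" using eq r by simp
    then have "X (tail3 w) = X (tail3 w')" using eq pos by (simp add: F_def)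
    \<comment> \<open>The shells are disjoint, so the radial factor alone reveals which one was
      used.\<close>
    moreover have "\<beta> (tail3 w) = \<beta> (tail3 w')"
      using w w' 1 shell_bounds unfolding S_def by (metis (mono_tags, lifting) mem_Collect_eq)
    ultimately have "tail3 w = tail3 w'" using inj w w' by (auto simp: S_def)
    then show "w = w'" using 1 by (metis cons3_tail3)
  qed
  have F_der: "(F has_derivative F' w) (at w within S)" if "w \<in> S" for w
  proof -
    have "(X has_derivative X' (tail3 w)) (at (tail3 w))" using der that by (auto simp: S_def)
    from diff_chain_at[OF bounded_linear_imp_has_derivative[OF bounded_linear_tail3] this]
    have "((\<lambda>w. X (tail3 w)) has_derivative (\<lambda>h. X' (tail3 w) (tail3 h))) (at w)" by (simp add: o_def)
    then have "(F has_derivative F' w) (at w)"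
      unfolding F_def[abs_def] F'_def[abs_def]
      by (intro has_derivative_scaleR bounded_linear_imp_has_derivative bounded_linear_vec_nth)
    then show ?thesis by (rule has_derivative_at_withinI)
  qed
  have det: "\<bar>det (matrix (F' w))\<bar> = r * ((w $ 1)\<^sup>2 * g (tail3 w))" if w: "w \<in> S" for w
  proof -
    let ?u = "tail3 w"
    let ?x = "X ?u" and ?a = "(w $ 1) *\<^sub>R X' ?u (axis 1 1)" and ?b = "(w $ 1) *\<^sub>R X' ?u (axis 2 1)"
    have u: "?u \<in> A" using w by (simp add: S_def)
    have 0: "X' ?u 0 = 0" using der[OF u] by (metis has_derivative_bounded_linear linear_0 bounded_linear.linear)
    have "transpose (matrix (F' w)) = vector [?x, ?a, ?b]"
      by (simp add: vec_eq_iff forall_3 transpose_def matrix_def F'_def 0) (simp add: axis_def)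
    then have "(det (matrix (F' w)))\<^sup>2 = (det (vector [?x, ?a, ?b] :: real^3^3))\<^sup>2"
      by (metis det_transpose)
    also have "\<dots> = (?x \<bullet> ?x) * ((?a \<bullet> ?a) * (?b \<bullet> ?b) - (?a \<bullet> ?b)\<^sup>2)"
      by (rule det_rows_square_orthogonal) (simp_all add: orth[OF u])
    also have "\<dots> = (r * (w $ 1)\<^sup>2)\<^sup>2 * ((X' ?u (axis 1 1) \<bullet> X' ?u (axis 1 1)) * (X' ?u (axis 2 1) \<bullet> X' ?u (axis 2 1))
            - (X' ?u (axis 1 1) \<bullet> X' ?u (axis 2 1))\<^sup>2)"
      by (simp add: sph[OF u] power2_eq_square algebra_simps)
    finally have "sqrt ((det (matrix (F' w)))\<^sup>2) = r * (w $ 1)\<^sup>2 * g ?u"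
      using r by (simp add: real_sqrt_mult g[OF u])
    then show ?thesis by simp
  qed
  have g_nonneg: "g u \<ge> 0" if "u \<in> A" for u
    unfolding g[OF that] using Cauchy_Schwarz_ineq by (simp add: real_sqrt_ge_0_iff)
  have bd: "F ` S \<subseteq> cball 0 (root 3 2 * r)"
  proof
    fix y assume "y \<in> F ` S"
    then obtain w where w: "w \<in> S" "y = F w" by blast
    then have "0 < w $ 1" "w $ 1 < root 3 2" using shell_bounds by (auto simp: S_def)
    then show "y \<in> cball 0 (root 3 2 * r)" using w X r by (simp add: F_def S_def)
  qed
  \<comment> \<open>Boundedness and measurability make the image a set of finite measure, so the
    change of variables theorem can express that measure as the integral of the Jacobian.\<close>
  have "bounded (F ` S)" using bounded_subset[OF bounded_cball bd] .
  then have lm: "F ` S \<in> lmeasurable"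
    using img by (intro bounded_set_imp_lmeasurable) (auto simp: FS)
  then have "((\<lambda>w. \<bar>det (matrix (F' w))\<bar>) has_integral measure lebesgue (F ` S)) S"
    using has_measure_differentiable_image[of S F F' "measure lebesgue (F ` S)"] F_der F_inj S_borel by auto
  from nn_integral_has_integral_lebesgue[OF _ this]
  have "ennreal (measure lebesgue (F ` S)) = (\<integral>\<^sup>+w. ennreal (indicator S w * \<bar>det (matrix (F' w))\<bar>) \<partial>lborel)"
    by simp
  \<comment> \<open>On S the extra indicator of A is 1; elsewhere it removes the values of g outside
    A, about which nothing is known, and so makes the integrand measurable.\<close>
  also have "\<dots> = (\<integral>\<^sup>+w. ennreal (indicator S w * (r * ((w $ 1)\<^sup>2 * (indicator A (tail3 w) * g (tail3 w))))) \<partial>lborel)"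
    by (intro nn_integral_cong arg_cong[of _ _ ennreal]) (auto simp: indicator_def det S_def)
  also have "\<dots> = (\<integral>\<^sup>+u. (\<integral>\<^sup>+s. ennreal (indicator S (cons3 s u) * (r * (s\<^sup>2 * (indicator A u * g u)))) \<partial>lborel) \<partial>lborel)"
  proof (subst nn_integral_lborel_cons3)
    have "(\<lambda>w :: real^3. w $ 1) \<in> borel_measurable borel"
      by (intro borel_measurable_continuous_onI continuous_intros)
    then show "(\<lambda>w. ennreal (indicator S w * (r * ((w $ 1)\<^sup>2 * (indicator A (tail3 w) * g (tail3 w)))))) \<in> borel_measurable borel"
      using measurable_compose[OF t3 meas] S_borel by measurable
  qed simp
  also have "\<dots> = (\<integral>\<^sup>+u. ennreal (r * (indicator A u * g u)) * (\<integral>\<^sup>+s. ennreal (indicator (shell (\<beta> u)) s * s\<^sup>2) \<partial>lborel) \<partial>lborel)"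
  proof (rule nn_integral_cong)
    fix u
    have "(\<integral>\<^sup>+s. ennreal (indicator S (cons3 s u) * (r * (s\<^sup>2 * (indicator A u * g u)))) \<partial>lborel) =
      (\<integral>\<^sup>+s. ennreal (r * (indicator A u * g u)) * ennreal (indicator (shell (\<beta> u)) s * s\<^sup>2) \<partial>lborel)"
      using r g_nonneg
      by (intro nn_integral_cong) (auto simp: indicator_def S_def ennreal_mult'[symmetric] mult_ac)
    also have "\<dots> = ennreal (r * (indicator A u * g u)) * (\<integral>\<^sup>+s. ennreal (indicator (shell (\<beta> u)) s * s\<^sup>2) \<partial>lborel)"
      by (rule nn_integral_cmult) (simp add: shell_def)
    finally show "(\<integral>\<^sup>+s. ennreal (indicator S (cons3 s u) * (r * (s\<^sup>2 * (indicator A u * g u)))) \<partial>lborel) = \<dots>" .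
  qed
  also have "\<dots> = (\<integral>\<^sup>+u. ennreal (r / 3) * (ennreal (g u) * indicator A u) \<partial>lborel)"
    unfolding nn_integral_shell using r g_nonneg
    by (intro nn_integral_cong) (auto simp: indicator_def ennreal_mult'[symmetric])
  also have "\<dots> = ennreal (r / 3) * (\<integral>\<^sup>+u\<in>A. ennreal (g u) \<partial>lborel)"
  proof (rule nn_integral_cmult)
    have "(\<lambda>u. ennreal (g u) * indicator A u) = (\<lambda>u. ennreal (indicator A u * g u))"
      by (auto simp: indicator_def fun_eq_iff)
    then show "(\<lambda>u. ennreal (g u) * indicator A u) \<in> borel_measurable lborel" using meas by simp
  qed
  finally have "ennreal (measure lebesgue (F ` S)) = \<dots>" .
  moreover have "ennreal (measure lebesgue (F ` S)) = emeasure lborel (F ` S)"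
    using emeasure_eq_measure2[OF lm] img[folded FS] by simp
  ultimately show ?thesis by (simp add: FS)
qed

section \<open>Uniqueness of the surface measure\<close>

lemma local_param_smooth: "local_param M U \<phi> \<Longrightarrow> smooth_on U \<phi>"
  and local_param_open: "local_param M U \<phi> \<Longrightarrow> open U"
  and local_param_inj: "local_param M U \<phi> \<Longrightarrow> inj_on \<phi> U"
  and local_param_openin: "local_param M U \<phi> \<Longrightarrow> openin (top_of_set M) (\<phi> ` U)"
  by (simp_all add: local_param_def)

lemma local_param_subset: "local_param M U \<phi> \<Longrightarrow> \<phi> ` U \<subseteq> M"
  using local_param_openin openin_imp_subset by blast

lemma local_param_range_borel:
  assumes "local_param M U \<phi>" "M \<in> sets borel"
  shows "\<phi> ` U \<in> sets borel"
proof -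
  obtain V where "open V" "\<phi> ` U = M \<inter> V"
    using local_param_openin[OF assms(1)] by (auto simp: openin_open)
  then show ?thesis using assms(2) by simp
qed

text \<open>The image of A is the preimage of A under the inverse of \<phi>, which is continuous on
  the chart range; the range itself is Borel because it is relatively open in M.\<close>

lemma local_param_image_borel:
  assumes "local_param M U \<phi>" "M \<in> sets borel" "A \<in> sets borel" "A \<subseteq> U"
  shows "\<phi> ` A \<in> sets (restrict_space borel M)"
proof -
  have "inv_into U \<phi> \<in> borel_measurable (restrict_space borel (\<phi> ` U))"
    using assms(1) by (intro borel_measurable_continuous_on_restrict) (simp add: local_param_def)
  from measurable_sets[OF this assms(3)]
  have "inv_into U \<phi> -` A \<inter> \<phi> ` U \<in> sets (restrict_space borel (\<phi> ` U))"
    by (simp add: space_restrict_space)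
  moreover have "inv_into U \<phi> -` A \<inter> \<phi> ` U = \<phi> ` A"
    using local_param_inj[OF assms(1)] assms(4) by (auto simp: inv_into_f_f subset_iff)
  ultimately have "\<phi> ` A \<in> sets borel"
    using local_param_range_borel[OF assms(1,2)] by (simp add: sets_restrict_space_iff)
  moreover have "\<phi> ` A \<subseteq> M" using local_param_subset[OF assms(1)] assms(4) by blast
  ultimately show ?thesis using assms(2) by (simp add: sets_restrict_space_iff)
qed

lemma local_param_vimage_borel:
  assumes "local_param M U \<phi>" "B \<in> sets borel"
  shows "\<phi> -` B \<inter> U \<in> sets borel"
proof -
  have "\<phi> \<in> borel_measurable (restrict_space borel U)"
    using assms(1) by (intro borel_measurable_continuous_on_restrict smooth_on_continuous local_param_smooth)
  from measurable_sets[OF this assms(2)]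
  show ?thesis using local_param_open[OF assms(1)] by (simp add: space_restrict_space sets_restrict_space_iff)
qed

text \<open>Two measures with the area formula agree on every Borel set inside one chart. By the
  Lindelof property countably many charts cover M, so any Borel set splits into disjoint pieces,
  each the image of a Borel parameter set, and countable additivity finishes.\<close>

lemma surface_measure_eqI:
  fixes M :: "'e::euclidean_space set"
  assumes M: "M \<in> sets borel" "M \<noteq> {}"
    and cover: "\<And>x. x \<in> M \<Longrightarrow> \<exists>U (\<phi> :: real^2 \<Rightarrow> 'e). local_param M U \<phi> \<and> x \<in> \<phi> ` U"
    and space: "space \<mu> = M" and sets: "sets \<mu> = sets (restrict_space borel M)"
    and area: "\<And>U (\<phi> :: real^2 \<Rightarrow> 'e) A. local_param M U \<phi> \<Longrightarrow> A \<in> sets borel \<Longrightarrow> A \<subseteq> U \<Longrightarrow>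
      emeasure \<mu> (\<phi> ` A) = (\<integral>\<^sup>+ u\<in>A. ennreal (sqrt (det (coord_metric h \<phi> u))) \<partial>lborel)"
  shows "surface_measure M h = \<mu>"
  unfolding surface_measure_def
proof (rule the_equality, intro conjI allI impI ballI)
  fix \<nu> :: "'e measure"
  assume *: "space \<nu> = M \<and> sets \<nu> = sets (restrict_space borel M) \<and>
    (\<forall>U (\<phi> :: real^2 \<Rightarrow> 'e). local_param M U \<phi> \<longrightarrow> (\<forall>A\<in>sets borel. A \<subseteq> U \<longrightarrow>
      emeasure \<nu> (\<phi> ` A) = (\<integral>\<^sup>+ u\<in>A. ennreal (sqrt (det (coord_metric h \<phi> u))) \<partial>lborel)))"
  define \<F> where "\<F> = {\<phi> ` U | U (\<phi> :: real^2 \<Rightarrow> 'e). local_param M U \<phi>}"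
  have opn: "openin (top_of_set M) S" if "S \<in> \<F>" for S
    using that local_param_openin by (auto simp: \<F>_def)
  obtain \<F>' where \<F>': "\<F>' \<subseteq> \<F>" "countable \<F>'" "\<Union>\<F>' = \<Union>\<F>"
    using Lindelof_openin[OF opn] by blast
  have un: "\<Union>\<F>' = M"
    unfolding \<F>'(3)
  proof (intro equalityI Union_least subsetI)
    show "x \<in> \<Union>\<F>" if "x \<in> M" for x using cover[OF that] by (auto simp: \<F>_def)
    show "x \<in> M" if "S \<in> \<F>" "x \<in> S" for S x using openin_imp_subset[OF opn] that by blast
  qed
  then have ne: "\<F>' \<noteq> {}" using M by auto
  define C where "C = from_nat_into \<F>'"
  have C: "C n \<in> \<F>" for n using from_nat_into[OF ne] \<F>'(1) by (auto simp: C_def)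
  have C_un: "(\<Union>n. C n) = M" using un range_from_nat_into[OF ne \<F>'(2)] by (simp add: C_def)
  have C_borel: "C n \<in> sets borel" for n
    using C[of n] local_param_range_borel M(1) by (auto simp: \<F>_def)
  show "\<nu> = \<mu>"
  proof (rule measure_eqI)
    show "sets \<nu> = sets \<mu>" using * sets by simp
    fix A assume "A \<in> sets \<nu>"
    then have A: "A \<in> sets borel" "A \<subseteq> M" using * M(1) by (simp_all add: sets_restrict_space_iff)
    define B where "B n = disjointed C n \<inter> A" for n
    have B_borel: "B n \<in> sets borel" for n
    proof -
      have "range (disjointed C) \<subseteq> sets borel"
        using C_borel by (intro sets.range_disjointed_sets) auto
      then show ?thesis unfolding B_def by (intro sets.Int A(1)) auto
    qed
    have B_sets: "range B \<subseteq> sets \<nu>" "range B \<subseteq> sets \<mu>"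
      using B_borel A M(1) * sets by (auto simp: sets_restrict_space_iff B_def)
    have B_disj: "disjoint_family B"
      using disjoint_family_disjointed[of C] by (auto simp: B_def disjoint_family_on_def)
    have B_un: "(\<Union>n. B n) = A"
      using UN_disjointed_eq[of C] C_un A by (auto simp: B_def)
    have "emeasure \<nu> (B n) = emeasure \<mu> (B n)" for n
    proof -
      obtain U and \<phi> :: "real^2 \<Rightarrow> 'e" where \<phi>: "local_param M U \<phi>" "C n = \<phi> ` U"
        using C[of n] by (auto simp: \<F>_def)
      have "B n \<subseteq> \<phi> ` U" using disjointed_subset[of C n] \<phi>(2) by (auto simp: B_def)
      then have Bn: "B n = \<phi> ` (\<phi> -` B n \<inter> U)" by auto
      have V: "\<phi> -` B n \<inter> U \<in> sets borel" by (rule local_param_vimage_borel[OF \<phi>(1) B_borel])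
      show ?thesis
        using *[THEN conjunct2, THEN conjunct2, rule_format, OF \<phi>(1) V] area[OF \<phi>(1) V] Bn by simp
    qed
    then show "emeasure \<nu> A = emeasure \<mu> A"
      using suminf_emeasure[OF B_sets(1) B_disj] suminf_emeasure[OF B_sets(2) B_disj] B_un by simp
  qed
qed (use assms in auto)

section \<open>The two light spheres\<close>

text \<open>T is a frame of the spatial tangent space, P its left inverse, and r will be
  \<open>1 / \<epsilon> t\<close>. The form h is the negated Lorentz metric: indefinite on the whole
  space, but Euclidean on vectors with time component 0, such as those tangent to the
  spheres.\<close>

locale two_spheres =
  fixes T :: "real^3 \<Rightarrow> 'v::euclidean_space" and P :: "'v \<Rightarrow> real^3" and r :: real
    and h :: "real \<times> 'v \<Rightarrow> real \<times> 'v \<Rightarrow> real \<times> 'v \<Rightarrow> real"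
  assumes linear_T: "linear T" and linear_P: "linear P" and P_T: "\<And>y. P (T y) = y" and r_pos: "r > 0"
    and metric: "\<And>x a b y z. h x (a, T y) (b, T z) = y \<bullet> z - a * b"
begin

definition D :: "(real \<times> 'v) set" where
  "D = {(s * r, T y) | s y. s \<in> {1, -1} \<and> y \<bullet> y = r\<^sup>2}"

lemma bounded_linear_T: "bounded_linear T" and bounded_linear_P: "bounded_linear P"
  using linear_T linear_P by (simp_all add: linear_conv_bounded_linear)

lemma continuous_on_T [continuous_intros]: "continuous_on S f \<Longrightarrow> continuous_on S (\<lambda>x. T (f x))"
  and continuous_on_P [continuous_intros]: "continuous_on S g \<Longrightarrow> continuous_on S (\<lambda>x. P (g x))"
  by (simp_all add: bounded_linear.continuous_on bounded_linear_T bounded_linear_P)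

lemma D_iff:
  "x \<in> D \<longleftrightarrow> (fst x = r \<or> fst x = - r) \<and> snd x = T (P (snd x)) \<and> P (snd x) \<bullet> P (snd x) = r\<^sup>2"
proof
  assume "(fst x = r \<or> fst x = - r) \<and> snd x = T (P (snd x)) \<and> P (snd x) \<bullet> P (snd x) = r\<^sup>2"
  then show "x \<in> D" unfolding D_def
    by (intro CollectI exI[of _ "if fst x = r then 1 else -1"] exI[of _ "P (snd x)"])
      (auto simp: prod_eq_iff)
qed (auto simp: D_def P_T)

lemma closed_D: "closed D"
proof -
  have "D = ({x. fst x = r} \<union> {x. fst x = - r}) \<inter> {x. snd x = T (P (snd x))} \<inter> {x. P (snd x) \<bullet> P (snd x) = r\<^sup>2}"
    using D_iff by blast
  then show ?thesis
    by (simp only:) (intro closed_Int closed_Un closed_Collect_eq continuous_intros)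
qed

lemma D_borel: "D \<in> sets borel"
  using closed_D by simp

lemma D_nonempty: "D \<noteq> {}"
proof -
  have "(r, T (axis 1 r)) \<in> D" by (simp add: D_iff P_T inner_axis_axis power2_eq_square)
  then show ?thesis by blast
qed

section \<open>Hemispherical charts of the light spheres\<close>

text \<open>An orthogonal map takes the given point to the pole, so the hemisphere around it is a
  graph over a disc. The sheet is kept fixed by freezing the time component at
  \<open>fst x\<close>.\<close>

lemma chart_at:
  assumes "x \<in> D"
  shows "\<exists>U (\<phi> :: real^2 \<Rightarrow> real \<times> 'v). local_param D U \<phi> \<and> x \<in> \<phi> ` U"
proof -
  let ?y = "P (snd x)"
  have x: "fst x = r \<or> fst x = - r" "snd x = T ?y" "?y \<bullet> ?y = r\<^sup>2" using assms D_iff by auto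
  have "norm ?y = norm (axis 1 r :: real^3)"
    using x(3) by (simp add: norm_eq_sqrt_inner inner_axis_axis power2_eq_square)
  then obtain f :: "real^3 \<Rightarrow> real^3" where f: "orthogonal_transformation f" "f ?y = axis 1 r"
    by (rule orthogonal_transformation_exists)
  define Q where "Q = inv f"
  have Q: "orthogonal_transformation Q" using f(1) by (simp add: Q_def orthogonal_transformation_inv)
  have fQ: "f (Q y) = y" "Q (f y) = y" for y
    using orthogonal_transformation_bij[OF f(1)] by (simp_all add: Q_def bij_is_surj surj_f_inv_f bij_is_inj)
  have bl: "bounded_linear f" "bounded_linear Q"
    using f(1) Q by (simp_all add: orthogonal_transformation_linear linear_linear)
  define \<phi> where "\<phi> u = (fst x, T (Q (cons3 (sqrt (r\<^sup>2 - u \<bullet> u)) u)))" for u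
  define U where "U = {u :: real^2. u \<bullet> u < r\<^sup>2}"
  have U: "open U" unfolding U_def by (intro open_Collect_less continuous_intros)
  have nrm: "cons3 a u \<bullet> cons3 a u = a\<^sup>2 + u \<bullet> u" for a u
    by (simp add: inner_vec_def sum_3 sum_2 power2_eq_square)
  have inner_Q: "Q y \<bullet> Q y = y \<bullet> y" for y using Q by (simp add: orthogonal_transformation_def)
  have inner_f: "f y \<bullet> f y = y \<bullet> y" for y using f by (simp add: orthogonal_transformation_def)
  have lin: "bounded_linear (\<lambda>u. (0 :: real, T (Q (cons3 0 u))))"
  proof -
    have "bounded_linear (cons3 0)"
      by (rule linear_conv_bounded_linear[THEN iffD1], rule linearI) (simp_all add: vec_eq_iff forall_3)
    then show ?thesis
      by (intro bounded_linear_Pair bounded_linear_zero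
          bounded_linear_compose[OF bounded_linear_T] bounded_linear_compose[OF bl(2)])
  qed
  \<comment> \<open>A constant plus a linear map plus a square root times a constant vector: the
    form to which the smoothness rules apply.\<close>
  have \<phi>_eq: "\<phi> u = (fst x, 0) + ((0, T (Q (cons3 0 u))) + sqrt (r\<^sup>2 - u \<bullet> u) *\<^sub>R (0, T (Q (axis 1 1))))" for u
  proof -
    have c: "cons3 (sqrt (r\<^sup>2 - u \<bullet> u)) u = cons3 0 u + sqrt (r\<^sup>2 - u \<bullet> u) *\<^sub>R axis 1 1"
      by (simp add: vec_eq_iff forall_3 axis_def)
    have "linear Q" using bl(2) by (rule bounded_linear.linear)
    then show ?thesis
      unfolding \<phi>_def c by (simp add: linear_add linear_scale linear_T)
  qed
  have "smooth_on U \<phi>"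
  proof -
    have "smooth_on U (\<lambda>u. r\<^sup>2 + - (u \<bullet> u))"
      by (intro smooth_on_add smooth_on_const U smooth_on_linear_compose[of _ uminus] bounded_linear_minus bounded_linear_ident
          smooth_on_bilinear[OF _ bounded_bilinear_inner] smooth_on_bounded_linear)
    then have "smooth_on U (\<lambda>u. sqrt (r\<^sup>2 - u \<bullet> u))"
      by (intro smooth_on_sqrt U) (auto simp: U_def)
    then show ?thesis unfolding \<phi>_eq[abs_def]
      by (rule smooth_on_add[OF U smooth_on_const[OF U] smooth_on_add[OF U
            smooth_on_bounded_linear[OF U lin]
            smooth_on_bilinear[OF U bounded_bilinear_scaleR _ smooth_on_const[OF U]]]])
  qed
  moreover have "bounded_linear (\<lambda>x. tail3 (f (P (snd x))))"
    by (intro bounded_linear_compose[OF bounded_linear_tail3] bounded_linear_compose[OF bl(1)]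
        bounded_linear_compose[OF bounded_linear_P] bounded_linear_snd)
  moreover have "tail3 (f (P (snd (\<phi> u)))) = u" for u by (simp add: \<phi>_def P_T fQ)
  \<comment> \<open>Two strict inequalities, same sheet and positive height over the equator, cut
    the range out of D; this shows that it is relatively open.\<close>
  moreover have img: "\<phi> ` U = D \<inter> {z. fst z * fst x > 0 \<and> f (P (snd z)) $ 1 > 0}"
  proof (intro equalityI subsetI)
    fix z assume "z \<in> \<phi> ` U"
    then obtain u where u: "u \<in> U" "z = \<phi> u" by blast
    then have "fst z = fst x" "P (snd z) = Q (cons3 (sqrt (r\<^sup>2 - u \<bullet> u)) u)" "snd z = T (P (snd z))"
      by (simp_all add: \<phi>_def P_T)
    moreover have "cons3 (sqrt (r\<^sup>2 - u \<bullet> u)) u \<bullet> cons3 (sqrt (r\<^sup>2 - u \<bullet> u)) u = r\<^sup>2"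
      using u by (simp add: nrm U_def)
    ultimately show "z \<in> D \<inter> {z. fst z * fst x > 0 \<and> f (P (snd z)) $ 1 > 0}"
      using x(1) r_pos u by (auto simp: D_iff inner_Q fQ U_def)
  next
    fix z assume "z \<in> D \<inter> {z. fst z * fst x > 0 \<and> f (P (snd z)) $ 1 > 0}"
    then have z: "z \<in> D" "fst z * fst x > 0" "f (P (snd z)) $ 1 > 0" by auto
    define w where "w = f (P (snd z))"
    have w: "w \<bullet> w = r\<^sup>2" using z(1) by (simp add: w_def inner_f D_iff)
    have w2: "w \<bullet> w = (w $ 1)\<^sup>2 + tail3 w \<bullet> tail3 w" using nrm[of "w $ 1" "tail3 w"] by simp
    have pos: "w $ 1 > 0" using z(3) by (simp add: w_def)
    have "fst z = fst x" using z x(1) r_pos by (auto simp: D_iff mult_less_0_iff)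
    moreover have "sqrt (r\<^sup>2 - tail3 w \<bullet> tail3 w) = w $ 1" using w w2 pos by (simp add: real_sqrt_unique)
    ultimately have "\<phi> (tail3 w) = z"
      using z(1) by (simp add: \<phi>_def w_def fQ D_iff prod_eq_iff)
    moreover have "tail3 w \<in> U" using w w2 pos by (simp add: U_def) (metis less_add_same_cancel2 zero_less_power2 less_irrefl)
    ultimately show "z \<in> \<phi> ` U" by blast
  qed
  moreover have "open {z :: real \<times> 'v. fst z * fst x > 0 \<and> f (P (snd z)) $ 1 > 0}"
  proof -
    have "continuous_on UNIV (\<lambda>z :: real \<times> 'v. f (P (snd z)))"
      by (intro bounded_linear.continuous_on[OF bl(1)] continuous_intros)
    then show ?thesis by (intro open_Collect_conj open_Collect_less continuous_intros)
  qed
  ultimately have "local_param D U \<phi>"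
    by (intro local_param_graph[of U \<phi> "\<lambda>x. tail3 (f (P (snd x)))"] U) (auto simp: openin_open)
  moreover have "x \<in> \<phi> ` U"
    unfolding img using assms x(1) r_pos by (auto simp: f(2))
  ultimately show ?thesis by blast
qed

section \<open>Induced metric and curvature in an arbitrary chart\<close>

definition sph :: "(real^2 \<Rightarrow> real \<times> 'v) \<Rightarrow> real^2 \<Rightarrow> real^3" where
  "sph \<phi> u = P (snd (\<phi> u))"

context
  fixes U and \<phi> :: "real^2 \<Rightarrow> real \<times> 'v"
  assumes param: "local_param D U \<phi>"
begin

abbreviation X :: "real^2 \<Rightarrow> real^3" where "X \<equiv> sph \<phi>"

lemma \<phi>_in_D: "u \<in> U \<Longrightarrow> \<phi> u \<in> D"
  using local_param_subset[OF param] by blast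

lemma \<phi>_split: "u \<in> U \<Longrightarrow> \<phi> u = (fst (\<phi> u), T (X u))"
  and X_sphere: "u \<in> U \<Longrightarrow> X u \<bullet> X u = r\<^sup>2"
  and fst_\<phi>: "u \<in> U \<Longrightarrow> fst (\<phi> u) = r \<or> fst (\<phi> u) = - r"
  using \<phi>_in_D[of u] by (auto simp: D_iff sph_def prod_eq_iff)

lemma X_smooth: "smooth_on U X"
  unfolding sph_def[abs_def]
  by (intro smooth_on_linear_compose[of U "\<lambda>x. P (snd x)"] local_param_open[OF param]
      local_param_smooth[OF param] bounded_linear_compose[OF bounded_linear_P] bounded_linear_snd)

text \<open>The domain may be disconnected and meet both sheets, so it is the square of the time
  component that is visibly constant. Its derivative vanishes, and dividing by
  \<open>fst (\<phi> u)\<close>, which is not 0, shows that tangent vectors are purely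
  spatial.\<close>

lemma frechet_\<phi>:
  assumes u: "u \<in> U"
  shows "frechet_derivative \<phi> (at u) v = (0, T (frechet_derivative X (at u) v))"
proof -
  let ?d = "frechet_derivative \<phi> (at u)"
  note U = local_param_open[OF param]
  have d: "(\<phi> has_derivative ?d) (at u)"
    by (rule smooth_on_has_derivative[OF local_param_smooth[OF param] u])
  have dX: "frechet_derivative X (at u) v = P (snd (?d v))"
    unfolding sph_def[abs_def]
    by (rule frechet_derivative_eqI)
      (intro bounded_linear.has_derivative[OF bounded_linear_P] has_derivative_snd d)
  have "((\<lambda>u. T (P (snd (\<phi> u)))) has_derivative (\<lambda>v. T (P (snd (?d v))))) (at u)"
    by (intro bounded_linear.has_derivative[OF bounded_linear_T]
        bounded_linear.has_derivative[OF bounded_linear_P] has_derivative_snd d)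
  then have "((\<lambda>u. snd (\<phi> u)) has_derivative (\<lambda>v. T (P (snd (?d v))))) (at u)"
    by (rule has_derivative_transform_within_open[OF _ U u]) (metis \<phi>_in_D D_iff)
  from fun_cong[OF has_derivative_unique[OF has_derivative_snd[OF d] this], of v]
  have 1: "snd (?d v) = T (P (snd (?d v)))" .
  have "((\<lambda>u. fst (\<phi> u) * fst (\<phi> u)) has_derivative (\<lambda>v. fst (\<phi> u) * fst (?d v) + fst (?d v) * fst (\<phi> u))) (at u)"
    by (intro has_derivative_mult has_derivative_fst d)
  moreover have "((\<lambda>u. fst (\<phi> u) * fst (\<phi> u)) has_derivative (\<lambda>v. 0)) (at u)"
    by (rule has_derivative_transform_within_open[OF has_derivative_const[of "r * r"] U u])
      (use fst_\<phi> in fastforce)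
  ultimately have "fst (\<phi> u) * fst (?d v) + fst (?d v) * fst (\<phi> u) = 0"
    by (rule fun_cong[OF has_derivative_unique])
  then have "fst (?d v) = 0" using fst_\<phi>[OF u] r_pos by auto
  then show ?thesis using 1 dX by (simp add: prod_eq_iff)
qed

lemma coord_metric_\<phi>:
  "u \<in> U \<Longrightarrow> coord_metric h \<phi> u $ i $ j = partial_deriv i X u \<bullet> partial_deriv j X u"
  by (simp add: coord_metric_def partial_deriv_def frechet_\<phi> metric)

lemma X_derivative_inj:
  assumes "u \<in> U"
  shows "inj (frechet_derivative X (at u))"
proof -
  have "inj (frechet_derivative \<phi> (at u))" using param assms by (simp add: local_param_def)
  then show ?thesis unfolding inj_def by (simp add: frechet_\<phi>[OF assms])
qed

lemma curvature_\<phi>: "u \<in> U \<Longrightarrow> coord_gaussian_curvature (coord_metric h \<phi>) u = 1 / r\<^sup>2"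
  by (rule sphere_coord_curvature[OF local_param_open[OF param] X_smooth r_pos X_sphere
        X_derivative_inj coord_metric_\<phi>])

end

text \<open>That \<open>1 / r\<^sup>2\<close> meets the description is
  \<open>curvature_\<phi>\<close>; uniqueness needs an actual chart at x, since otherwise every K
  would satisfy the condition vacuously.\<close>

lemma gaussian_curvature_D:
  assumes "x \<in> D"
  shows "gaussian_curvature D h x = 1 / r\<^sup>2"
  unfolding gaussian_curvature_def
proof (rule the_equality)
  show "\<forall>U (\<phi> :: real^2 \<Rightarrow> _). \<forall>u\<in>U. local_param D U \<phi> \<and> \<phi> u = x \<longrightarrow>
      1 / r\<^sup>2 = coord_gaussian_curvature (coord_metric h \<phi>) u"
    by (intro allI ballI impI) (metis curvature_\<phi>)
next
  fix K assume "\<forall>U (\<phi> :: real^2 \<Rightarrow> _). \<forall>u\<in>U. local_param D U \<phi> \<and> \<phi> u = x \<longrightarrow>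
      K = coord_gaussian_curvature (coord_metric h \<phi>) u"
  then show "K = 1 / r\<^sup>2" using chart_at[OF assms] curvature_\<phi> by blast
qed

section \<open>The area measure as a pushforward\<close>

text \<open>Radial projection to the sphere of radius r inverts the coning, and the norm decides the
  sheet: the inner shell goes to time r, the outer one to time -r.\<close>

definition proj :: "real^3 \<Rightarrow> real \<times> 'v" where
  "proj y = (if norm y < r then r else - r, T ((r / norm y) *\<^sub>R y))"

definition shells :: "(real^3) set" where
  "shells = {y. 0 < norm y \<and> norm y < root 3 2 * r \<and> norm y \<noteq> r}"

text \<open>Over either shell, the cone on a piece of area a of a sphere of radius r has volume r a
  / 3; the scaling undoes this factor.\<close>

definition area :: "(real \<times> 'v) measure" where
  "area = scale_measure (ennreal (3 / r)) (distr (restrict_space lborel shells) (restrict_space borel D) proj)"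

lemma open_shells: "open shells"
  unfolding shells_def by (intro open_Collect_conj open_Collect_less open_Collect_neq continuous_intros)

lemma proj_measurable: "proj \<in> measurable (restrict_space lborel shells) (restrict_space borel D)"
proof (rule measurable_restrict_space2)
  have "T \<in> borel_measurable borel"
    by (intro borel_measurable_continuous_onI continuous_intros)
  then have "proj \<in> borel_measurable borel" unfolding proj_def[abs_def] by measurable
  then show "proj \<in> borel_measurable (restrict_space lborel shells)"
    by (intro measurable_restrict_space1) simp
  show "proj \<in> space (restrict_space lborel shells) \<rightarrow> D"
    by (auto simp: space_restrict_space proj_def D_iff P_T shells_def dot_square_norm power2_eq_square)
qed

lemma sets_area: "sets area = sets (restrict_space borel D)"
  by (simp add: area_def)

lemma space_area: "space area = D"
  using sets_eq_imp_space_eq[OF sets_area] by (simp add: space_restrict_space)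

lemma proj_vimage_borel:
  assumes "A \<in> sets (restrict_space borel D)"
  shows "{y \<in> shells. proj y \<in> A} \<in> sets borel"
proof -
  have "proj -` A \<inter> shells \<in> sets (restrict_space lborel shells)"
    using measurable_sets[OF proj_measurable assms] by (simp add: space_restrict_space)
  then show ?thesis
    using open_shells by (simp add: sets_restrict_space_iff vimage_def Int_def conj_commute)
qed

lemma emeasure_area:
  assumes "A \<in> sets (restrict_space borel D)"
  shows "emeasure area A = ennreal (3 / r) * emeasure lborel {y \<in> shells. proj y \<in> A}"
proof -
  have eq: "proj -` A \<inter> shells = {y \<in> shells. proj y \<in> A}" by auto
  have "emeasure area A = ennreal (3 / r) * emeasure (restrict_space lborel shells) (proj -` A \<inter> shells)"
    unfolding area_def using assms
    by (simp add: emeasure_scale_measure emeasure_distr[OF proj_measurable] space_restrict_space)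
  also have "emeasure (restrict_space lborel shells) (proj -` A \<inter> shells) = emeasure lborel (proj -` A \<inter> shells)"
    using open_shells by (intro emeasure_restrict_space) auto
  finally show ?thesis by (simp add: eq)
qed

text \<open>Positive because \<open>shells\<close> is open and nonempty, finite because it is
  bounded. In either degenerate case \<open>measure\<close> would be 0 and could not be cancelled in
  the mean.\<close>

lemma area_D: "0 < emeasure area D" "emeasure area D < \<infinity>"
proof -
  have "D \<in> sets (restrict_space borel D)" by (metis sets.top space_area sets_area)
  then have e: "emeasure area D = ennreal (3 / r) * emeasure lborel {y \<in> shells. proj y \<in> D}"
    by (rule emeasure_area)
  have eq: "{y \<in> shells. proj y \<in> D} = shells"
    using measurable_space[OF proj_measurable] by (auto simp: space_restrict_space)
  have "(r / 2) *\<^sub>R axis 1 1 \<in> shells"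
    using r_pos less_trans[of "1/2" 1 "root 3 2"] by (simp add: shells_def)
  then have "\<not> negligible shells" using open_not_negligible[OF open_shells] by blast
  then have pos: "emeasure lborel shells \<noteq> 0"
    using open_shells by (auto simp: negligible_iff_null_sets null_sets_completionI null_setsI)
  have "shells \<subseteq> ball 0 (root 3 2 * r)" by (auto simp: shells_def)
  then have "emeasure lborel shells < \<infinity>"
    using emeasure_bounded_finite bounded_subset bounded_ball by blast
  with pos show "0 < emeasure area D" "emeasure area D < \<infinity>"
    unfolding e eq using r_pos
    by (auto simp: ennreal_zero_less_mult_iff ennreal_mult_less_top zero_less_iff_neq_zero)
qed

text \<open>The preimage of a chart image under \<open>proj\<close> is the cone set of
  \<open>nn_integral_cone\<close>, with the sign of \<open>fst (\<phi> u)\<close> selecting the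
  shell. This identification also supplies the Borel measurability of the cone.\<close>

lemma area_chart:
  fixes \<phi> :: "real^2 \<Rightarrow> real \<times> 'v"
  assumes param: "local_param D U \<phi>" and A: "A \<in> sets borel" "A \<subseteq> U"
  shows "emeasure area (\<phi> ` A) = (\<integral>\<^sup>+ u\<in>A. ennreal (sqrt (det (coord_metric h \<phi> u))) \<partial>lborel)"
proof -
  note U = local_param_open[OF param]
  let ?X = "sph \<phi>"
  note smooth = X_smooth[OF param]
  define g where "g u = sqrt (det (coord_metric h \<phi> u))" for u
  have \<phi>A: "\<phi> ` A \<in> sets (restrict_space borel D)" by (rule local_param_image_borel[OF param D_borel A])
  have nX: "norm (?X u) = r" if "u \<in> U" for u
    using X_sphere[OF param that] r_pos by (simp add: norm_eq_sqrt_inner)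
  have cone: "{y \<in> shells. proj y \<in> \<phi> ` A} = {s *\<^sub>R ?X u | s u. u \<in> A \<and> s \<in> shell (fst (\<phi> u) > 0)}"
  proof (intro equalityI subsetI)
    fix y assume "y \<in> {y \<in> shells. proj y \<in> \<phi> ` A}"
    then obtain u where u: "y \<in> shells" "u \<in> A" "proj y = \<phi> u" by auto
    have y: "norm y > 0" "norm y < root 3 2 * r" "norm y \<noteq> r" using u(1) by (auto simp: shells_def)
    have "?X u = (r / norm y) *\<^sub>R y" by (simp add: sph_def u(3)[symmetric] proj_def P_T)
    then have "y = (norm y / r) *\<^sub>R ?X u" using y r_pos by simp
    moreover have "norm y / r \<in> shell (fst (\<phi> u) > 0)"
      using y r_pos by (auto simp: u(3)[symmetric] proj_def shell_def field_simps)
    ultimately show "y \<in> {s *\<^sub>R ?X u | s u. u \<in> A \<and> s \<in> shell (fst (\<phi> u) > 0)}" using u(2) by blast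
  next
    fix y assume "y \<in> {s *\<^sub>R ?X u | s u. u \<in> A \<and> s \<in> shell (fst (\<phi> u) > 0)}"
    then obtain s u where su: "y = s *\<^sub>R ?X u" "u \<in> A" "s \<in> shell (fst (\<phi> u) > 0)" by blast
    have u: "u \<in> U" using su A by auto
    note s = shell_bounds[OF su(3)]
    have ny: "norm y = s * r" using su(1) s nX[OF u] by simp
    have "proj y = (if s < 1 then r else - r, T (?X u))"
      using ny s r_pos su(1) by (simp add: proj_def)
    also have "\<dots> = \<phi> u"
      using s fst_\<phi>[OF param u] r_pos \<phi>_split[OF param u] by (auto simp: prod_eq_iff)
    finally have "proj y \<in> \<phi> ` A" using su(2) by simp
    moreover have "y \<in> shells"
      using s r_pos by (simp only: shells_def ny mem_Collect_eq) simp
    ultimately show "y \<in> {y \<in> shells. proj y \<in> \<phi> ` A}" by blast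
  qed
  have det: "det (coord_metric h \<phi> u) =
      (frechet_derivative ?X (at u) (axis 1 1) \<bullet> frechet_derivative ?X (at u) (axis 1 1)) *
      (frechet_derivative ?X (at u) (axis 2 1) \<bullet> frechet_derivative ?X (at u) (axis 2 1))
      - (frechet_derivative ?X (at u) (axis 1 1) \<bullet> frechet_derivative ?X (at u) (axis 2 1))\<^sup>2" if "u \<in> U" for u
    using coord_metric_\<phi>[OF param that]
    by (simp add: det_2 partial_deriv_def power2_eq_square inner_commute)
  have "emeasure lborel {s *\<^sub>R ?X u | s u. u \<in> A \<and> s \<in> shell (fst (\<phi> u) > 0)} =
      ennreal (r / 3) * (\<integral>\<^sup>+u\<in>A. ennreal (g u) \<partial>lborel)"
  proof (rule nn_integral_cone[where X' = "\<lambda>u. frechet_derivative ?X (at u)"])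
    show "?X u \<bullet> ?X u = r\<^sup>2" if "u \<in> A" for u using X_sphere[OF param] that A by auto
    show der: "(?X has_derivative frechet_derivative ?X (at u)) (at u)" if "u \<in> A" for u
      using smooth_on_has_derivative[OF smooth] that A by auto
    show "?X u \<bullet> frechet_derivative ?X (at u) v = 0" if "u \<in> A" for u v
    proof -
      have u: "u \<in> U" using that A by auto
      have "((\<lambda>w. ?X w \<bullet> ?X w) has_derivative (\<lambda>v. ?X u \<bullet> frechet_derivative ?X (at u) v
          + frechet_derivative ?X (at u) v \<bullet> ?X u)) (at u)"
        by (intro has_derivative_inner der that)
      moreover have "((\<lambda>w. ?X w \<bullet> ?X w) has_derivative (\<lambda>v. 0)) (at u)"
        by (rule has_derivative_transform_within_open[OF has_derivative_const[of "r\<^sup>2"] U u])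
          (simp add: X_sphere[OF param])
      ultimately have "?X u \<bullet> frechet_derivative ?X (at u) v + frechet_derivative ?X (at u) v \<bullet> ?X u = 0"
        by (rule fun_cong[OF has_derivative_unique])
      then show ?thesis by (simp add: inner_commute)
    qed
    \<comment> \<open>A point of D is determined by its spatial part and its sheet, so injectivity
      of \<phi> carries over to the cone.\<close>
    show "u = v" if uv: "u \<in> A" "v \<in> A" "?X u = ?X v" "(0 < fst (\<phi> u)) = (0 < fst (\<phi> v))" for u v
    proof -
      have U': "u \<in> U" "v \<in> U" using uv A by auto
      have "fst (\<phi> u) = fst (\<phi> v)" using uv(4) fst_\<phi>[OF param U'(1)] fst_\<phi>[OF param U'(2)] r_pos by auto
      then have "\<phi> u = \<phi> v"
        using \<phi>_split[OF param U'(1)] \<phi>_split[OF param U'(2)] uv(3) by metis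
      then show ?thesis using local_param_inj[OF param] U' by (auto dest: inj_onD)
    qed
    \<comment> \<open>The sheet condition is open within U, by continuity of \<phi>.\<close>
    show "A \<inter> {u. 0 < fst (\<phi> u)} \<in> sets borel"
    proof -
      have "open (U \<inter> \<phi> -` {z. 0 < fst z})"
        by (intro continuous_open_preimage smooth_on_continuous local_param_smooth[OF param] U
            open_Collect_less continuous_intros)
      moreover have "A \<inter> {u. 0 < fst (\<phi> u)} = A \<inter> (U \<inter> \<phi> -` {z. 0 < fst z})" using A by auto
      ultimately show ?thesis using A by simp
    qed
    show "(\<lambda>u. indicator A u * g u) \<in> borel_measurable borel"
    proof -
      have "continuous_on U (\<lambda>u. frechet_derivative ?X (at u) v)" for v
        by (intro smooth_on_continuous smooth_on_frechet smooth)
      then have "continuous_on U g"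
        unfolding g_def[abs_def] by (simp add: det cong: continuous_on_cong) (intro continuous_intros)
      then have "continuous_on A g" using A continuous_on_subset by blast
      then show ?thesis using borel_measurable_continuous_on_indicator[OF A(1), of g]
        by (simp add: real_scaleR_def[abs_def])
    qed
    show "{s *\<^sub>R ?X u | s u. u \<in> A \<and> s \<in> shell (0 < fst (\<phi> u))} \<in> sets borel"
      using proj_vimage_borel[OF \<phi>A] by (simp only: cone)
  qed (use A r_pos det in \<open>auto simp: g_def subset_iff\<close>)
  then have "emeasure area (\<phi> ` A) =
      ennreal (3 / r) * (ennreal (r / 3) * (\<integral>\<^sup>+u\<in>A. ennreal (g u) \<partial>lborel))"
    by (simp add: emeasure_area[OF \<phi>A] cone)
  also have "\<dots> = (\<integral>\<^sup>+u\<in>A. ennreal (g u) \<partial>lborel)"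
    using r_pos by (simp add: mult.assoc[symmetric] ennreal_mult'[symmetric])
  finally show ?thesis by (simp add: g_def)
qed

lemma surface_measure_D: "surface_measure D h = area"
  by (rule surface_measure_eqI[OF D_borel D_nonempty chart_at space_area sets_area area_chart])

lemma mean_inverse_curvature:
  "1 / (8 * pi / measure (surface_measure D h) D *
     (\<integral>x. 1 / gaussian_curvature D h x \<partial>surface_measure D h)) = 1 / (8 * pi * r\<^sup>2)"
proof -
  have "(\<integral>x. 1 / gaussian_curvature D h x \<partial>area) = (\<integral>x. r\<^sup>2 \<partial>area)"
    by (intro Bochner_Integration.integral_cong) (simp_all add: space_area gaussian_curvature_D)
  also have "\<dots> = measure area D * r\<^sup>2" by (simp add: space_area)
  finally have "(\<integral>x. 1 / gaussian_curvature D h x \<partial>area) = measure area D * r\<^sup>2" .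
  moreover have "measure area D \<noteq> 0"
    using area_D by (auto simp: measure_def enn2real_eq_0_iff less_le)
  ultimately show ?thesis by (simp add: surface_measure_D)
qed

end

section \<open>Spatial slices\<close>

text \<open>The Minkowski form is the Euclidean product with the time-reflected second
  argument.\<close>

lemma bounded_bilinear_slice_metric: "bounded_bilinear (slice_metric k)"
proof (cases k)
  case Hyperbolic
  have "bounded_linear (\<lambda>w :: real^4. w - (2 * w $ 1) *\<^sub>R axis 1 1)"
    by (rule linear_conv_bounded_linear[THEN iffD1], rule linearI) (simp_all add: algebra_simps)
  note bounded_bilinear.comp[OF bounded_bilinear_inner bounded_linear_ident this]
  moreover have "slice_metric k = (\<lambda>v w. v \<bullet> (w - (2 * w $ 1) *\<^sub>R axis 1 1))"
    by (intro ext) (simp add: Hyperbolic inner_diff_right inner_axis)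
  ultimately show ?thesis by simp
next
  case Spherical
  then have "slice_metric k = (\<bullet>)" by (intro ext) simp
  then show ?thesis by (simp add: bounded_bilinear_inner)
next
  case Flat
  then have "slice_metric k = (\<bullet>)" by (intro ext) simp
  then show ?thesis by (simp add: bounded_bilinear_inner)
qed

lemmas slice_metric_simps =
  bounded_bilinear.add_left[OF bounded_bilinear_slice_metric]
  bounded_bilinear.add_right[OF bounded_bilinear_slice_metric]
  bounded_bilinear.diff_left[OF bounded_bilinear_slice_metric]
  bounded_bilinear.diff_right[OF bounded_bilinear_slice_metric]
  bounded_bilinear.scaleR_left[OF bounded_bilinear_slice_metric]
  bounded_bilinear.scaleR_right[OF bounded_bilinear_slice_metric]
  bounded_bilinear.zero_left[OF bounded_bilinear_slice_metric]
  bounded_bilinear.zero_right[OF bounded_bilinear_slice_metric]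

lemma slice_metric_commute: "slice_metric k v w = slice_metric k w v"
  by (cases k) (simp_all add: inner_commute)

lemma bounded_linear_slice_metric_right: "bounded_linear (\<lambda>w. slice_metric k v w)"
  by (rule bounded_bilinear.bounded_linear_right[OF bounded_bilinear_slice_metric])

text \<open>The first coordinate is singled out for several uses: the normal of the flat slice, the
  pole of the sphere, Minkowski time for the hyperboloid, and cosmic time in charts of the
  space-time.\<close>

definition cons4 :: "real \<Rightarrow> real^3 \<Rightarrow> real^4" where
  "cons4 a y = (\<chi> i. if i = 1 then a else if i = 2 then y $ 1 else if i = 3 then y $ 2 else y $ 3)"
definition tail4 :: "real^4 \<Rightarrow> real^3" where "tail4 w = vector [w $ 2, w $ 3, w $ 4]"

lemma cons4_nth [simp]:
  "cons4 a y $ 1 = a" "cons4 a y $ 2 = y $ 1" "cons4 a y $ 3 = y $ 2" "cons4 a y $ 4 = y $ 3"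
  by (simp_all add: cons4_def)

lemma tail4_nth [simp]: "tail4 w $ 1 = w $ 2" "tail4 w $ 2 = w $ 3" "tail4 w $ 3 = w $ 4"
  by (simp_all add: tail4_def)

lemma tail4_cons4 [simp]: "tail4 (cons4 a y) = y"
  by (simp add: vec_eq_iff forall_3)

lemma cons4_tail4 [simp]: "cons4 (w $ 1) (tail4 w) = w"
  by (simp add: vec_eq_iff forall_4)

lemma inner_tail4: "v \<bullet> w = v $ 1 * w $ 1 + tail4 v \<bullet> tail4 w"
  by (simp add: inner_vec_def sum_4 sum_3)

lemma linear_tail4: "linear tail4"
  by (rule linearI) (simp_all add: vec_eq_iff forall_3)

lemma bounded_linear_tail4: "bounded_linear tail4"
  using linear_tail4 linear_conv_bounded_linear by blast

lemma bounded_linear_cons4: "bounded_linear (\<lambda>(a, y). cons4 a y)"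
  by (rule linear_conv_bounded_linear[THEN iffD1], rule linearI) (auto simp: vec_eq_iff forall_4)

section \<open>Frames, tangent spaces and charts of the slices\<close>

definition tangent_hyperplane :: "space_form \<Rightarrow> real^4 \<Rightarrow> (real^4) set" where
  "tangent_hyperplane k x = (if k = Flat then {v. v $ 1 = 0} else {v. slice_metric k x v = 0})"

text \<open>The value of the quadratic form on the quadric, which is also the sign of the curvature
  of the slice. The value 0 for \<open>Flat\<close> lets the graph formulas be shared by all three
  cases.\<close>

fun slice_sign :: "space_form \<Rightarrow> real" where
  "slice_sign Spherical = 1"
| "slice_sign Flat = 0"
| "slice_sign Hyperbolic = -1"

lemma slice_quadric: "x \<in> slice k \<Longrightarrow> k \<noteq> Flat \<Longrightarrow> slice_metric k x x = slice_sign k"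
  by (cases k) (simp_all add: power2_eq_square)

lemma slice_nonempty: "slice k \<noteq> {}"
proof -
  have "(if k = Flat then 0 else axis 1 1) \<in> slice k" by (cases k) (simp_all add: inner_axis_axis)
  then show ?thesis by blast
qed

text \<open>A linear isometry from Euclidean R^3 onto the tangent hyperplane: an inclusion for the
  plane, a rotation from the pole for the sphere, and a Lorentz boost for the hyperboloid.\<close>

lemma slice_frame:
  assumes "x \<in> slice k"
  shows "\<exists>T :: real^3 \<Rightarrow> real^4. linear T \<and> (\<forall>y z. slice_metric k (T y) (T z) = y \<bullet> z) \<and>
    range T = tangent_hyperplane k x"
proof (cases k)
  case Flat
  show ?thesis
  proof (intro exI[of _ "cons4 0"] conjI allI)
    show "linear (cons4 0)" by (rule linearI) (simp_all add: vec_eq_iff forall_4)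
    show "slice_metric k (cons4 0 y) (cons4 0 z) = y \<bullet> z" for y z by (simp add: Flat inner_tail4)
    have "v \<in> range (cons4 0)" if "v $ 1 = 0" for v using cons4_tail4[of v] that by (metis rangeI)
    then show "range (cons4 0) = tangent_hyperplane k x" by (auto simp: Flat tangent_hyperplane_def)
  qed
next
  case Spherical
  then have "norm x = norm (axis 1 1 :: real^4)" using assms by (simp add: norm_eq_sqrt_inner)
  then obtain f :: "real^4 \<Rightarrow> real^4" where f: "orthogonal_transformation f" "f x = axis 1 1"
    by (rule orthogonal_transformation_exists)
  have inv: "f (inv f v) = v" "inv f (f v) = v" for v
    using orthogonal_transformation_bij[OF f(1)] by (simp_all add: bij_is_surj surj_f_inv_f bij_is_inj)
  have g: "orthogonal_transformation (inv f)" using f(1) by (rule orthogonal_transformation_inv)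
  have f1: "f v $ 1 = x \<bullet> v" for v
    using f by (metis cart_eq_inner_axis inner_commute orthogonal_transformation_def)
  show ?thesis
  proof (intro exI[of _ "\<lambda>y. inv f (cons4 0 y)"] conjI allI)
    have "linear (cons4 0)" by (rule linearI) (simp_all add: vec_eq_iff forall_4)
    then show "linear (\<lambda>y. inv f (cons4 0 y))"
      using linear_compose orthogonal_transformation_linear[OF g] by (force simp: o_def)
    show "slice_metric k (inv f (cons4 0 y)) (inv f (cons4 0 z)) = y \<bullet> z" for y z
      using g by (simp add: Spherical orthogonal_transformation_def inner_tail4)
    have "v \<in> range (\<lambda>y. inv f (cons4 0 y))" if "x \<bullet> v = 0" for v
      using cons4_tail4[of "f v"] that f1 inv(2) by (metis rangeI)
    moreover have "x \<bullet> inv f (cons4 0 y) = 0" for y using f1[of "inv f (cons4 0 y)"] by (simp add: inv)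
    ultimately show "range (\<lambda>y. inv f (cons4 0 y)) = tangent_hyperplane k x"
      by (auto simp: Spherical tangent_hyperplane_def)
  qed
next
  case Hyperbolic
  define \<xi> where "\<xi> = tail4 x"
  have x1: "x $ 1 > 0" and \<xi>: "\<xi> \<bullet> \<xi> = (x $ 1)\<^sup>2 - 1"
    using assms by (simp_all add: Hyperbolic inner_tail4[of x x] \<xi>_def power2_eq_square)
  \<comment> \<open>The Lorentz boost that takes \<open>axis 1 1\<close> to \<open>x\<close>, restricted to the spatial vectors.\<close>
  define T where "T y = cons4 (\<xi> \<bullet> y) (y + ((\<xi> \<bullet> y) / (1 + x $ 1)) *\<^sub>R \<xi>)" for y
  have \<sigma>: "slice_metric k v w = tail4 v \<bullet> tail4 w - v $ 1 * w $ 1" for v w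
    by (simp add: Hyperbolic inner_tail4[of v w])
  have n0: "1 + x $ 1 \<noteq> 0" using x1 by simp
  have x2: "((x $ 1)\<^sup>2 - 1) / (1 + x $ 1) = x $ 1 - 1"
    using n0 by (simp add: field_simps power2_eq_square)
  show ?thesis
  proof (intro exI[of _ T] conjI allI)
    show "linear T"
      by (rule linearI)
        (simp_all add: T_def vec_eq_iff forall_4 inner_add_right distrib_right add_divide_distrib algebra_simps)
    show "slice_metric k (T y) (T z) = y \<bullet> z" for y z
    proof -
      \<comment> \<open>These are the coefficients of \<xi> in the two images. In terms of them no
        denominators remain, and the claim is a polynomial identity modulo
        \<open>\<xi> \<bullet> \<xi> = (x $ 1)\<^sup>2 - 1\<close>.\<close>
      define a b where "a = (\<xi> \<bullet> y) / (1 + x $ 1)" and "b = (\<xi> \<bullet> z) / (1 + x $ 1)"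
      have ab: "\<xi> \<bullet> y = a * (1 + x $ 1)" "\<xi> \<bullet> z = b * (1 + x $ 1)" using n0 by (simp_all add: a_def b_def)
      have "slice_metric k (T y) (T z) =
          y \<bullet> z + b * (\<xi> \<bullet> y) + a * (\<xi> \<bullet> z) + a * b * (\<xi> \<bullet> \<xi>) - (\<xi> \<bullet> y) * (\<xi> \<bullet> z)"
        unfolding \<sigma> T_def a_def[symmetric] b_def[symmetric]
        by (simp add: inner_add_left inner_add_right inner_commute[of y \<xi>] algebra_simps)
      then show ?thesis unfolding ab \<xi> by (simp add: algebra_simps power2_eq_square)
    qed
    have "slice_metric k x (T y) = (\<xi> \<bullet> y) * (1 + ((x $ 1)\<^sup>2 - 1) / (1 + x $ 1) - x $ 1)" for y
      by (simp add: \<sigma> T_def \<xi>_def[symmetric] inner_add_right \<xi> algebra_simps)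
    then have 1: "slice_metric k x (T y) = 0" for y by (simp add: x2)
    have "v \<in> range T" if v: "slice_metric k x v = 0" for v
    proof -
      \<comment> \<open>The first component of \<open>T y = v\<close> forces
        \<open>\<xi> \<bullet> y = v $ 1\<close>; inserting this in the other components gives the
        candidate, for which that equation is then confirmed.\<close>
      let ?y = "tail4 v - (v $ 1 / (1 + x $ 1)) *\<^sub>R \<xi>"
      have xv: "\<xi> \<bullet> tail4 v = x $ 1 * v $ 1" using v by (simp add: \<sigma> \<xi>_def)
      have "\<xi> \<bullet> ?y = v $ 1 * (x $ 1 - ((x $ 1)\<^sup>2 - 1) / (1 + x $ 1))"
        by (simp add: inner_diff_right xv \<xi> algebra_simps)
      then have "\<xi> \<bullet> ?y = v $ 1" by (simp add: x2)
      then have "T ?y = v" by (simp add: T_def)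
      then show ?thesis by (metis rangeI)
    qed
    with 1 show "range T = tangent_hyperplane k x" by (auto simp: Hyperbolic tangent_hyperplane_def)
  qed
qed

text \<open>The isometric frame transports Euclidean positivity to the hyperplane, which matters for
  the hyperboloid, where the ambient form is indefinite.\<close>

lemma slice_metric_pos:
  assumes "x \<in> slice k" "v \<in> tangent_hyperplane k x" "v \<noteq> 0"
  shows "slice_metric k v v > 0"
proof -
  obtain T :: "real^3 \<Rightarrow> real^4" where T: "linear T" "\<And>y z. slice_metric k (T y) (T z) = y \<bullet> z"
    "range T = tangent_hyperplane k x"
    using slice_frame[OF assms(1)] by auto
  obtain y where "v = T y" using T(3) assms(2) by blast
  moreover have "y \<noteq> 0" using \<open>v = T y\<close> assms(3) linear_0[OF T(1)] by auto
  ultimately show ?thesis by (simp add: T(2))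
qed

text \<open>For the quadrics, v is orthogonal to x, so the defining equation reduces to the
  condition on f. What remains in the hyperbolic case is to stay on the upper sheet.\<close>

lemma slice_normal_graph:
  assumes x: "x \<in> slice k" and v: "v \<in> tangent_hyperplane k x"
    and f: "f > 0" "f\<^sup>2 = 1 - slice_sign k * slice_metric k v v"
  shows "v + f *\<^sub>R x \<in> slice k"
proof (cases "k = Flat")
  case True
  then show ?thesis using x v by (simp add: tangent_hyperplane_def)
next
  case False
  have "slice_metric k x v = 0" using v False by (simp add: tangent_hyperplane_def)
  then have "slice_metric k (v + f *\<^sub>R x) (v + f *\<^sub>R x) = slice_metric k v v + f\<^sup>2 * slice_sign k"
    using slice_quadric[OF x False] slice_metric_commute[of k v x]
    by (simp add: slice_metric_simps power2_eq_square)
  then have q: "slice_metric k (v + f *\<^sub>R x) (v + f *\<^sub>R x) = slice_sign k"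
    using False f(2) by (cases k) (simp_all add: algebra_simps)
  show ?thesis
  proof (cases k)
    case Hyperbolic
    have x1: "x $ 1 > 0" and xx: "tail4 x \<bullet> tail4 x = (x $ 1)\<^sup>2 - 1"
      using x by (simp_all add: Hyperbolic inner_tail4[of x x] power2_eq_square)
    have xv: "tail4 x \<bullet> tail4 v = x $ 1 * v $ 1"
      using \<open>slice_metric k x v = 0\<close> by (simp add: Hyperbolic inner_tail4[of x v])
    have vv: "tail4 v \<bullet> tail4 v = (v $ 1)\<^sup>2 + (f\<^sup>2 - 1)"
      using f(2) by (simp add: Hyperbolic inner_tail4[of v v] power2_eq_square)
    \<comment> \<open>Cauchy-Schwarz for the spatial parts bounds the first coordinate of v strictly
      by that of \<open>f *\<^sub>R x\<close>, so the sum keeps a positive time coordinate.\<close>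
    have "(x $ 1 * v $ 1)\<^sup>2 \<le> ((x $ 1)\<^sup>2 - 1) * ((v $ 1)\<^sup>2 + (f\<^sup>2 - 1))"
      using Cauchy_Schwarz_ineq[of "tail4 x" "tail4 v"] by (simp add: xx xv vv)
    then have le: "(v $ 1)\<^sup>2 \<le> ((x $ 1)\<^sup>2 - 1) * (f\<^sup>2 - 1)" by (simp add: algebra_simps power_mult_distrib)
    have "f\<^sup>2 \<ge> 1"
    proof (cases "v = 0")
      case True
      then show ?thesis using f(2) by (simp add: slice_metric_simps)
    next
      case False
      then show ?thesis using slice_metric_pos[OF x v False] f(2) by (simp add: Hyperbolic)
    qed
    moreover have "((x $ 1)\<^sup>2 - 1) \<ge> 0" using xx by (metis inner_ge_zero)
    ultimately have "((x $ 1)\<^sup>2 - 1) * (f\<^sup>2 - 1) < (x $ 1)\<^sup>2 * f\<^sup>2"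
      by (simp add: algebra_simps)
    with le have "(v $ 1)\<^sup>2 < (f * x $ 1)\<^sup>2" by (simp add: power_mult_distrib mult.commute)
    then have "\<bar>v $ 1\<bar> < f * x $ 1" using f(1) x1 power2_less_imp_less[of "\<bar>v $ 1\<bar>" "f * x $ 1"] by simp
    then have "(v + f *\<^sub>R x) $ 1 > 0" by simp
    moreover have "(v + f *\<^sub>R x) \<bullet> (v + f *\<^sub>R x) - 2 * ((v + f *\<^sub>R x) $ 1)\<^sup>2 = - 1"
      using q unfolding Hyperbolic slice_metric.simps slice_sign.simps power2_eq_square by (simp only: mult.assoc)
    ultimately show ?thesis by (simp only: Hyperbolic slice.simps mem_Collect_eq)
  qed (use q False in simp_all)
qed

text \<open>One inclusion differentiates the equation of the slice along a curve. The other needs an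
  explicit smooth curve: the line \<open>s *\<^sub>R v\<close>, lifted to the slice along x by
  \<open>slice_normal_graph\<close>.\<close>

lemma tangent_space_slice:
  assumes x: "x \<in> slice k"
  shows "tangent_space (slice k) x = tangent_hyperplane k x"
proof (intro equalityI subsetI)
  fix v assume "v \<in> tangent_space (slice k) x"
  then obtain c \<delta> where c: "\<delta> > 0" "c ` {-\<delta><..<\<delta>} \<subseteq> slice k" "c (0::real) = x"
    "(c has_vector_derivative v) (at 0)" unfolding tangent_space_def by blast
  have 0: "(0::real) \<in> {-\<delta><..<\<delta>}" using c(1) by simp
  show "v \<in> tangent_hyperplane k x"
  proof (cases "k = Flat")
    case True
    have "((\<lambda>s. c s $ 1) has_vector_derivative v $ 1) (at 0)"
      by (rule bounded_linear.has_vector_derivative[OF bounded_linear_vec_nth c(4)])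
    moreover have "((\<lambda>s. c s $ 1) has_vector_derivative 0) (at 0)"
      by (rule has_vector_derivative_transform_within_open[OF has_vector_derivative_const[of 0] open_greaterThanLessThan 0])
        (use c(2) True in \<open>simp add: image_subset_iff\<close>)
    ultimately have "v $ 1 = 0" using vector_derivative_unique_at by blast
    then show ?thesis using True by (simp add: tangent_hyperplane_def)
  next
    case False
    have "((\<lambda>s. slice_metric k (c s) (c s)) has_vector_derivative slice_metric k x v + slice_metric k v x) (at 0)"
      using bounded_bilinear.has_vector_derivative[OF bounded_bilinear_slice_metric c(4) c(4)] c(3) by simp
    moreover have "((\<lambda>s. slice_metric k (c s) (c s)) has_vector_derivative 0) (at 0)"
      by (rule has_vector_derivative_transform_within_open[OF has_vector_derivative_const[of "slice_sign k"]
            open_greaterThanLessThan 0])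
        (use c(2) slice_quadric False in \<open>simp add: image_subset_iff\<close>)
    ultimately have "slice_metric k x v + slice_metric k v x = 0" using vector_derivative_unique_at by blast
    then show ?thesis using False slice_metric_commute[of k v x] by (simp add: tangent_hyperplane_def)
  qed
next
  fix v assume v: "v \<in> tangent_hyperplane k x"
  define q where "q = slice_sign k * slice_metric k v v"
  define c where "c s = s *\<^sub>R v + sqrt (1 + (- q) * (s * s)) *\<^sub>R x" for s
  \<comment> \<open>As \<delta> is at most 1, \<open>s * s\<close> is at most \<delta> for s in the
    interval, so \<open>q * (s * s)\<close> stays below 1 and the radicand positive.\<close>
  define \<delta> where "\<delta> = 1 / (\<bar>q\<bar> + 1)"
  have \<delta>: "\<delta> > 0" "\<delta> \<le> 1" by (simp_all add: \<delta>_def)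
  have pos: "1 + (- q) * (s * s) > 0" if "s \<in> {-\<delta><..<\<delta>}" for s
  proof -
    have s: "\<bar>s\<bar> < \<delta>" using that by auto
    have "q * (s * s) \<le> \<bar>q\<bar> * (\<bar>s\<bar> * \<bar>s\<bar>)" using abs_ge_self[of "q * (s * s)"] by (simp add: abs_mult)
    also have "\<dots> \<le> \<bar>q\<bar> * (\<delta> * 1)" using s \<delta> by (intro mult_left_mono mult_mono) auto
    also have "\<dots> < 1" by (simp add: \<delta>_def)
    finally show ?thesis by simp
  qed
  let ?I = "{-\<delta><..<\<delta>}"
  have sm: "smooth_on ?I (\<lambda>s. s)" by (intro smooth_on_bounded_linear bounded_linear_ident) simp
  have "smooth_on ?I (\<lambda>s. 1 + (- q) * (s * s))"
    by (rule smooth_on_add[OF _ smooth_on_const smooth_on_bilinear[OF _ bounded_bilinear_mult smooth_on_const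
            smooth_on_bilinear[OF _ bounded_bilinear_mult sm sm]]]) simp_all
  then have "smooth_on ?I (\<lambda>s. sqrt (1 + (- q) * (s * s)))"
    by (rule smooth_on_sqrt[OF _ pos, rotated 2]) simp
  then have "smooth_on ?I c" unfolding c_def[abs_def]
    by (intro smooth_on_add smooth_on_bilinear[OF _ bounded_bilinear_scaleR] smooth_on_const sm) simp_all
  moreover have "c ` ?I \<subseteq> slice k"
  proof safe
    fix s assume s: "s \<in> ?I"
    have "s *\<^sub>R v \<in> tangent_hyperplane k x"
      using v by (auto simp: tangent_hyperplane_def slice_metric_simps)
    then show "c s \<in> slice k" unfolding c_def
      using pos[OF s] by (intro slice_normal_graph[OF x]) (simp_all add: slice_metric_simps q_def mult_ac)
  qed
  moreover have "(c has_vector_derivative v) (at 0)"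
    unfolding c_def[abs_def] has_vector_derivative_def
    by (auto intro!: derivative_eq_intros simp: fun_eq_iff)
  ultimately show "v \<in> tangent_space (slice k) x"
    unfolding tangent_space_def using \<delta>(1) by (intro CollectI exI[of _ c] exI[of _ \<delta>]) (simp add: c_def)
qed

text \<open>The slice near x is a graph over its tangent hyperplane, in direction x for the
  quadrics. Reading off frame coefficients with the slice metric gives the linear left inverse that
  \<open>local_param_graph\<close> asks for.\<close>

lemma slice_chart:
  assumes x: "x \<in> slice k"
  obtains U :: "(real^3) set" and \<psi> :: "real^3 \<Rightarrow> real^4" and P V where
    "open U" "smooth_on U \<psi>" "bounded_linear P" "\<And>y. y \<in> U \<Longrightarrow> P (\<psi> y) = y"
    "open V" "x \<in> V" "\<psi> ` U = slice k \<inter> V"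
proof -
  obtain T :: "real^3 \<Rightarrow> real^4" where T: "linear T" "\<And>y z. slice_metric k (T y) (T z) = y \<bullet> z"
    "range T = tangent_hyperplane k x"
    using slice_frame[OF x] by auto
  have blT: "bounded_linear T" using T(1) linear_conv_bounded_linear by blast
  \<comment> \<open>P must annihilate the graph direction. A point x of a quadric is orthogonal to
    its hyperplane; the flat slice is its own hyperplane and needs no lifting.\<close>
  define b where "b = (if k = Flat then 0 else x)"
  define f where "f y = sqrt (1 + - (slice_sign k * (y \<bullet> y)))" for y :: "real^3"
  define \<psi> where "\<psi> y = T y + f y *\<^sub>R b" for y
  define U where "U = {y :: real^3. slice_sign k * (y \<bullet> y) < 1}"
  define P where "P w = (\<chi> i. slice_metric k (T (axis i 1)) w)" for w
  define V where "V = {w. k = Flat \<or> slice_sign k * slice_metric k x w > 0}"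
  have U: "open U" unfolding U_def by (intro open_Collect_less continuous_intros)
  have blP: "bounded_linear P"
    unfolding P_def[abs_def] by (rule linear_conv_bounded_linear[THEN iffD1], rule linearI)
      (simp_all add: vec_eq_iff slice_metric_simps)
  have P_T: "P (T y) = y" for y by (simp add: P_def T(2) vec_eq_iff inner_commute[of "axis _ _"] inner_axis)
  have TW: "T y \<in> tangent_hyperplane k x" for y using T(3) by auto
  have orth: "k \<noteq> Flat \<Longrightarrow> slice_metric k x (T y) = 0" for y using TW[of y] by (simp add: tangent_hyperplane_def)
  have P_b: "P b = 0"
    using orth slice_metric_commute[of k "T _" x] by (simp add: P_def b_def vec_eq_iff slice_metric_simps)
  have P_\<psi>: "P (\<psi> y) = y" for y
    using blP[THEN bounded_linear.linear] by (simp add: \<psi>_def linear_add linear_scale P_T P_b)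
  have fpos: "f y > 0" "(f y)\<^sup>2 = 1 - slice_sign k * (y \<bullet> y)" if "y \<in> U" for y
    using that by (simp_all add: f_def U_def)
  have "smooth_on U \<psi>"
  proof -
    have "smooth_on U (\<lambda>y. 1 + - (slice_sign k * (y \<bullet> y)))"
      by (rule smooth_on_add[OF U smooth_on_const[OF U] smooth_on_linear_compose[OF U bounded_linear_minus[OF bounded_linear_ident]
            smooth_on_bilinear[OF U bounded_bilinear_mult smooth_on_const[OF U] smooth_on_bilinear[OF U bounded_bilinear_inner
            smooth_on_bounded_linear[OF U bounded_linear_ident] smooth_on_bounded_linear[OF U bounded_linear_ident]]]]])
    then have "smooth_on U f" unfolding f_def[abs_def]
      by (rule smooth_on_sqrt[OF U, rotated]) (simp add: U_def)
    then show ?thesis unfolding \<psi>_def[abs_def]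
      by (rule smooth_on_add[OF U smooth_on_bounded_linear[OF U blT]
            smooth_on_bilinear[OF U bounded_bilinear_scaleR _ smooth_on_const[OF U]]])
  qed
  moreover have "open V"
  proof (cases "k = Flat")
    case False
    then have "V = {w. 0 < slice_sign k * slice_metric k x w}" by (simp add: V_def)
    moreover have "open {w. 0 < slice_sign k * slice_metric k x w}"
      by (intro open_Collect_less continuous_intros linear_continuous_on bounded_linear_slice_metric_right)
    ultimately show ?thesis by simp
  qed (simp add: V_def)
  moreover have sgn: "k \<noteq> Flat \<Longrightarrow> slice_sign k * slice_sign k = 1" by (cases k) auto
  then have "x \<in> V" using slice_quadric[OF x] by (cases "k = Flat") (simp_all add: V_def)
  moreover have "\<psi> ` U = slice k \<inter> V"
  proof (intro equalityI subsetI)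
    fix w assume "w \<in> \<psi> ` U"
    then obtain y where y: "y \<in> U" "w = \<psi> y" by blast
    show "w \<in> slice k \<inter> V"
    proof (cases "k = Flat")
      case True
      then show ?thesis using TW[of y] by (simp add: y \<psi>_def b_def V_def tangent_hyperplane_def)
    next
      case False
      have "\<psi> y \<in> slice k" unfolding \<psi>_def b_def using False slice_normal_graph[OF x TW fpos(1)[OF y(1)]] fpos(2)[OF y(1)]
        by (simp add: T(2))
      moreover have "slice_sign k * slice_metric k x (\<psi> y) = f y"
        using False orth[of y] slice_quadric[OF x False] sgn
        by (simp add: \<psi>_def b_def slice_metric_simps mult.left_commute)
      ultimately show ?thesis using y fpos(1) by (simp add: V_def)
    qed
  next
    fix w assume w: "w \<in> slice k \<inter> V"
    show "w \<in> \<psi> ` U"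
    proof (cases "k = Flat")
      case True
      then have "w \<in> range T" using w T(3) by (simp add: tangent_hyperplane_def)
      then obtain y where "w = T y" by blast
      then show ?thesis using True by (intro image_eqI[of _ _ y]) (simp_all add: \<psi>_def b_def U_def)
    next
      case False
      \<comment> \<open>The coefficient of w along x: the form takes the value
        \<open>slice_sign k\<close> on x, and this sign is its own inverse.\<close>
      define a where "a = slice_sign k * slice_metric k x w"
      have a: "a > 0" using w False by (simp add: a_def V_def)
      have "slice_metric k x (w - a *\<^sub>R x) = slice_metric k x w - slice_metric k x w * (slice_sign k * slice_sign k)"
        using slice_quadric[OF x False] by (simp add: slice_metric_simps a_def)
      then have "w - a *\<^sub>R x \<in> range T"
        unfolding T(3) tangent_hyperplane_def using False sgn by simp
      then obtain y where y: "w - a *\<^sub>R x = T y" by blast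
      then have wy: "w = T y + a *\<^sub>R x" by (simp add: algebra_simps)
      have "slice_sign k = slice_metric k w w" using slice_quadric w False by simp
      also have "\<dots> = y \<bullet> y + a\<^sup>2 * slice_sign k"
        unfolding wy using orth[OF False, of y] slice_metric_commute[of k "T y" x] slice_quadric[OF x False]
        by (simp add: slice_metric_simps T(2) power2_eq_square)
      finally have "slice_sign k * slice_sign k = slice_sign k * (y \<bullet> y) + a\<^sup>2 * (slice_sign k * slice_sign k)"
        by (metis distrib_left mult.assoc mult.commute)
      then have a2: "a\<^sup>2 = 1 - slice_sign k * (y \<bullet> y)" using sgn False by simp
      then have "y \<in> U" using a by (simp add: U_def) (metis diff_gt_0_iff_gt zero_less_power)
      moreover have "f y = a" using a a2 by (simp add: f_def real_sqrt_unique)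
      ultimately show ?thesis using wy False by (intro image_eqI[of _ _ y]) (simp_all add: \<psi>_def b_def)
    qed
  qed
  ultimately show ?thesis using that[OF U _ blP P_\<psi>] by blast
qed

lemma tangent_hyperplane_differential:
  assumes "open U" "smooth_on U \<psi>" "\<psi> ` U \<subseteq> slice k" "y \<in> U"
  shows "frechet_derivative \<psi> (at y) v \<in> tangent_hyperplane k (\<psi> y)"
proof -
  let ?d = "frechet_derivative \<psi> (at y)"
  have d: "(\<psi> has_derivative ?d) (at y)" by (rule smooth_on_has_derivative[OF assms(2,4)])
  show ?thesis
  proof (cases "k = Flat")
    case True
    have "((\<lambda>y. \<psi> y $ 1) has_derivative (\<lambda>v. ?d v $ 1)) (at y)"
      by (rule bounded_linear.has_derivative[OF bounded_linear_vec_nth d])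
    moreover have "((\<lambda>y. \<psi> y $ 1) has_derivative (\<lambda>v. 0)) (at y)"
      by (rule has_derivative_transform_within_open[OF has_derivative_const[of 0] assms(1,4)])
        (use assms(3) True in auto)
    ultimately have "?d v $ 1 = 0" by (rule fun_cong[OF has_derivative_unique])
    then show ?thesis using True by (simp add: tangent_hyperplane_def)
  next
    case False
    have "((\<lambda>y. slice_metric k (\<psi> y) (\<psi> y)) has_derivative
        (\<lambda>v. slice_metric k (\<psi> y) (?d v) + slice_metric k (?d v) (\<psi> y))) (at y)"
      by (rule bounded_bilinear.FDERIV[OF bounded_bilinear_slice_metric d d])
    moreover have "((\<lambda>y. slice_metric k (\<psi> y) (\<psi> y)) has_derivative (\<lambda>v. 0)) (at y)"
      by (rule has_derivative_transform_within_open[OF has_derivative_const[of "slice_sign k"] assms(1,4)])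
        (use assms(3) False slice_quadric in \<open>simp add: image_subset_iff\<close>)
    ultimately have "slice_metric k (\<psi> y) (?d v) + slice_metric k (?d v) (\<psi> y) = 0"
      by (rule fun_cong[OF has_derivative_unique])
    then show ?thesis
      using False slice_metric_commute[of k "?d v" "\<psi> y"] by (simp add: tangent_hyperplane_def)
  qed
qed

section \<open>Null geodesics\<close>

text \<open>Row i of the product of A with its inverse is row i of the inverse. Applied to the time
  row of the metric, it leaves a single term in the sum defining a Christoffel symbol.\<close>

lemma matrix_inv_unit_row:
  fixes A :: "real^'n^'n"
  assumes "invertible A" "\<And>j. A $ i $ j = (if j = i then 1 else 0)"
  shows "matrix_inv A $ i $ l = (if l = i then 1 else 0)"
proof -
  have "(A ** matrix_inv A) $ i $ l = (mat 1 :: real^'n^'n) $ i $ l"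
    by (simp add: matrix_inv_inverse(1)[OF assms(1)])
  then show ?thesis
    by (simp add: matrix_matrix_mult_def mat_def assms(2) if_distrib[of "\<lambda>x. x * _"] cong: if_cong)
qed

lemma slice_metric_expansion:
  fixes d :: "real^4 \<Rightarrow> real^4" and v :: "real^4"
  assumes "linear d"
  shows "(\<Sum>i\<in>UNIV. \<Sum>j\<in>UNIV. slice_metric k (d (axis i 1)) (d (axis j 1)) * v $ i * v $ j) =
    slice_metric k (d v) (d v)"
proof -
  have "d v = (\<Sum>i\<in>UNIV. v $ i *\<^sub>R d (axis i 1))"
    by (subst basis_expansion[symmetric, of v, unfolded scalar_mult_eq_scaleR])
      (simp add: linear_sum[OF assms] linear_scale[OF assms])
  then show ?thesis
    by (simp add: bounded_bilinear.sum_left[OF bounded_bilinear_slice_metric]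
        bounded_bilinear.sum_right[OF bounded_bilinear_slice_metric] slice_metric_simps mult_ac)
      (subst sum.swap, simp add: sum_distrib_left mult_ac)
qed

section \<open>Product charts of the space-time and their time Christoffel symbols\<close>

locale frw_chart =
  fixes k :: space_form and J :: "real set" and R :: "real \<Rightarrow> real"
    and U :: "(real^3) set" and \<psi> :: "real^3 \<Rightarrow> real^4" and P :: "real^4 \<Rightarrow> real^3"
  assumes open_J: "open J" and smooth_R: "smooth_on J R" and R_pos: "\<And>t. t \<in> J \<Longrightarrow> R t > 0"
    and open_U: "open U" and smooth_\<psi>: "smooth_on U \<psi>" and bounded_linear_P: "bounded_linear P"
    and P_\<psi>: "\<And>y. y \<in> U \<Longrightarrow> P (\<psi> y) = y" and \<psi>_slice: "\<psi> ` U \<subseteq> slice k"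
begin

definition W :: "(real^4) set" where "W = {u. u $ 1 \<in> J \<and> tail4 u \<in> U}"
definition \<eta> :: "real^4 \<Rightarrow> real^4" where "\<eta> u = \<psi> (tail4 u)"
definition \<phi> :: "real^4 \<Rightarrow> real \<times> (real^4)" where "\<phi> u = (u $ 1, \<eta> u)"

lemma open_W: "open W"
proof -
  have "W = (\<lambda>u. u $ 1) -` J \<inter> tail4 -` U" by (auto simp: W_def)
  then show ?thesis
    by (simp add: open_Int open_vimage[OF open_J] open_vimage[OF open_U] linear_continuous_on
        bounded_linear_tail4 bounded_linear_vec_nth)
qed

lemma smooth_\<eta>: "smooth_on W \<eta>"
proof -
  have "smooth_on (tail4 -` U) \<eta>"
    unfolding \<eta>_def[abs_def] by (rule smooth_on_compose_linear[OF open_U bounded_linear_tail4 smooth_\<psi>])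
  then show ?thesis unfolding smooth_on_def using Ck_on_subset[of _ "tail4 -` U" \<eta> W] by (force simp: W_def)
qed

lemma smooth_\<phi>: "smooth_on W \<phi>"
proof -
  have "bounded_linear (\<lambda>u :: real^4. (u $ 1, 0 :: real^4))"
    by (intro bounded_linear_Pair bounded_linear_vec_nth bounded_linear_zero)
  note time = smooth_on_bounded_linear[OF open_W this]
  have "bounded_linear (\<lambda>x :: real^4. (0 :: real, x))"
    by (intro bounded_linear_Pair bounded_linear_ident bounded_linear_zero)
  from smooth_on_add[OF open_W time smooth_on_linear_compose[OF open_W this smooth_\<eta>]]
  have "smooth_on W (\<lambda>u. (u $ 1, 0) + (0, \<eta> u))" .
  then show ?thesis by (simp add: \<phi>_def[abs_def])
qed

definition Q :: "real \<times> (real^4) \<Rightarrow> real^4" where "Q z = cons4 (fst z) (P (snd z))"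

lemma bounded_linear_Q: "bounded_linear Q"
proof -
  have "bounded_linear (\<lambda>z. (fst z, P (snd z)))"
    by (intro bounded_linear_Pair bounded_linear_fst bounded_linear_compose[OF bounded_linear_P] bounded_linear_snd)
  from bounded_linear_compose[OF bounded_linear_cons4 this] show ?thesis by (simp add: Q_def[abs_def])
qed

lemma Q_\<phi>: "u \<in> W \<Longrightarrow> Q (\<phi> u) = u"
  by (simp add: Q_def \<phi>_def \<eta>_def W_def P_\<psi>)

lemma fst_Q [simp]: "Q z $ 1 = fst z"
  by (simp add: Q_def)

lemma local_param_\<phi>:
  assumes "open V" "\<psi> ` U = slice k \<inter> V"
  shows "local_param (frw_manifold k J) W \<phi>"
proof (rule local_param_graph[OF open_W smooth_\<phi> bounded_linear_Q Q_\<phi>])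
  have "\<phi> ` W = frw_manifold k J \<inter> (UNIV \<times> V)"
  proof (intro equalityI subsetI)
    fix z assume "z \<in> frw_manifold k J \<inter> (UNIV \<times> V)"
    then have z: "fst z \<in> J" "snd z \<in> \<psi> ` U" using assms(2) by (auto simp: frw_manifold_def)
    then obtain y where y: "y \<in> U" "snd z = \<psi> y" by blast
    then show "z \<in> \<phi> ` W"
      using z by (intro image_eqI[of _ _ "cons4 (fst z) y"]) (auto simp: \<phi>_def \<eta>_def W_def prod_eq_iff)
  qed (use assms(2) in \<open>auto simp: \<phi>_def \<eta>_def W_def frw_manifold_def\<close>)
  then show "openin (top_of_set (frw_manifold k J)) (\<phi> ` W)"
    using assms(1) by (auto simp: openin_open intro!: exI[of _ "UNIV \<times> V"] open_Times)
qed

lemma frechet_\<eta>: "u \<in> W \<Longrightarrow> frechet_derivative \<eta> (at u) v = frechet_derivative \<psi> (at (tail4 u)) (tail4 v)"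
  unfolding \<eta>_def[abs_def]
  by (rule frechet_derivative_eqI)
    (use diff_chain_at[OF bounded_linear_imp_has_derivative[OF bounded_linear_tail4]
        smooth_on_has_derivative[OF smooth_\<psi>]] in \<open>simp add: o_def W_def\<close>)

lemma frechet_\<phi>: "u \<in> W \<Longrightarrow> frechet_derivative \<phi> (at u) v = (v $ 1, frechet_derivative \<eta> (at u) v)"
  unfolding \<phi>_def[abs_def]
  by (rule frechet_derivative_eqI)
    (intro has_derivative_Pair bounded_linear_imp_has_derivative bounded_linear_vec_nth
      smooth_on_has_derivative[OF smooth_\<eta>])

text \<open>\<open>P \<circ> \<psi> = id\<close> makes the differential injective, and its values
  lie in the tangent hyperplane, where the form is positive.\<close>

lemma frechet_\<psi>_pos:
  assumes "y \<in> U" "v \<noteq> 0"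
  shows "slice_metric k (frechet_derivative \<psi> (at y) v) (frechet_derivative \<psi> (at y) v) > 0"
proof (rule slice_metric_pos)
  show "\<psi> y \<in> slice k" using \<psi>_slice assms by auto
  show "frechet_derivative \<psi> (at y) v \<in> tangent_hyperplane k (\<psi> y)"
    by (rule tangent_hyperplane_differential[OF open_U smooth_\<psi> \<psi>_slice assms(1)])
  have "((\<lambda>y. P (\<psi> y)) has_derivative (\<lambda>v. P (frechet_derivative \<psi> (at y) v))) (at y)"
    by (rule bounded_linear.has_derivative[OF bounded_linear_P smooth_on_has_derivative[OF smooth_\<psi> assms(1)]])
  moreover have "((\<lambda>y. P (\<psi> y)) has_derivative (\<lambda>v. v)) (at y)"
    by (rule has_derivative_transform_within_open[OF has_derivative_ident open_U assms(1)]) (simp add: P_\<psi>)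
  ultimately have "P (frechet_derivative \<psi> (at y) v) = v" by (rule fun_cong[OF has_derivative_unique])
  then show "frechet_derivative \<psi> (at y) v \<noteq> 0"
    using assms(2) linear_0[OF bounded_linear.linear[OF bounded_linear_P]] by auto
qed

abbreviation G :: "real^4 \<Rightarrow> real^4^4" where "G \<equiv> coord_metric (frw_metric k R) \<phi>"

lemma partial_\<eta>_time: "u \<in> W \<Longrightarrow> partial_deriv 1 \<eta> u = 0"
proof -
  assume u: "u \<in> W"
  have "tail4 (axis 1 1) = 0" by (simp add: vec_eq_iff forall_3 axis_def)
  moreover have "linear (frechet_derivative \<psi> (at (tail4 u)))"
    using u smooth_on_differentiable[OF smooth_\<psi>] by (intro linear_frechet_derivative) (simp add: W_def)
  ultimately show ?thesis by (simp add: partial_deriv_def frechet_\<eta>[OF u] linear_0)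
qed

lemma G_eq:
  "u \<in> W \<Longrightarrow> G u $ i $ j = (if i = 1 \<and> j = 1 then 1 else 0)
     - (R (u $ 1))\<^sup>2 * slice_metric k (partial_deriv i \<eta> u) (partial_deriv j \<eta> u)"
  by (auto simp: coord_metric_def frw_metric_def partial_deriv_def frechet_\<phi> \<phi>_def axis_def)

lemma G_time: "u \<in> W \<Longrightarrow> G u $ 1 $ j = (if j = 1 then 1 else 0)"
  and G_time': "u \<in> W \<Longrightarrow> G u $ i $ 1 = (if i = 1 then 1 else 0)"
  by (simp_all add: G_eq partial_\<eta>_time slice_metric_simps)

lemma G_quadratic:
  assumes "u \<in> W"
  shows "v \<bullet> (G u *v v) = (v $ 1)\<^sup>2
    - (R (u $ 1))\<^sup>2 * slice_metric k (frechet_derivative \<eta> (at u) v) (frechet_derivative \<eta> (at u) v)"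
proof -
  have "linear (frechet_derivative \<eta> (at u))"
    by (intro linear_frechet_derivative smooth_on_differentiable[OF smooth_\<eta> assms])
  note expansion = slice_metric_expansion[OF this, of k v]
  let ?c = "\<lambda>i j. slice_metric k (frechet_derivative \<eta> (at u) (axis i 1)) (frechet_derivative \<eta> (at u) (axis j 1))"
  have "v \<bullet> (G u *v v) = (\<Sum>i\<in>UNIV. \<Sum>j\<in>UNIV. v $ i * (G u $ i $ j * v $ j))"
    by (simp add: inner_vec_def matrix_vector_mult_def sum_distrib_left)
  also have "\<dots> = (\<Sum>i\<in>UNIV. \<Sum>j\<in>UNIV. (if i = 1 \<and> j = 1 then v $ i * v $ j else 0)
      - (R (u $ 1))\<^sup>2 * (?c i j * v $ i * v $ j))"
    by (intro sum.cong refl) (simp add: G_eq[OF assms] partial_deriv_def right_diff_distrib left_diff_distrib mult_ac)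
  also have "\<dots> = (\<Sum>i\<in>UNIV. \<Sum>j\<in>UNIV. if i = 1 \<and> j = 1 then v $ i * v $ j else 0)
      - (R (u $ 1))\<^sup>2 * (\<Sum>i\<in>UNIV. \<Sum>j\<in>UNIV. ?c i j * v $ i * v $ j)"
    by (simp only: sum_subtractf sum_distrib_left)
  also have "(\<Sum>i\<in>UNIV. \<Sum>j\<in>UNIV. if i = 1 \<and> j = 1 then v $ i * v $ j else 0) = (v $ 1)\<^sup>2"
    by (simp only: sum_4) (simp add: power2_eq_square)
  finally show ?thesis unfolding expansion .
qed

text \<open>For a vector in the kernel, the time row kills its time component; the remaining
  quadratic form is -R^2 times a positive one, which kills the rest. Only for an invertible matrix
  does \<open>matrix_inv\<close> have a known meaning.\<close>

lemma invertible_G: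
  assumes "u \<in> W"
  shows "invertible (G u)"
proof -
  have "v = 0" if v: "G u *v v = 0" for v
  proof -
    have "(G u *v v) $ 1 = v $ 1"
      by (simp add: matrix_vector_mult_def G_time[OF assms] if_distrib[of "\<lambda>x. x * _"] cong: if_cong)
    then have v1: "v $ 1 = 0" using v by simp
    have "R (u $ 1) > 0" using assms R_pos by (simp add: W_def)
    then have "slice_metric k (frechet_derivative \<eta> (at u) v) (frechet_derivative \<eta> (at u) v) = 0"
      using G_quadratic[OF assms, of v] v v1 by simp
    then have "tail4 v = 0"
      using frechet_\<psi>_pos[of "tail4 u" "tail4 v"] assms by (force simp: frechet_\<eta> W_def)
    then show "v = 0" using cons4_tail4[of v] v1 by (metis cons4_tail4 zero_index linear_0[OF linear_tail4])
  qed
  then show ?thesis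
    by (simp add: invertible_left_inverse matrix_left_invertible_ker)
qed

text \<open>The time row of G is a constant unit vector, so the symbol is minus half the time
  derivative of the entry i, j of G, and in that entry only the factor \<open>R\<^sup>2\<close>
  depends on time.\<close>

lemma christoffel_time:
  assumes u: "u \<in> W"
  shows "christoffel G 1 i j u =
    R (u $ 1) * deriv R (u $ 1) * slice_metric k (partial_deriv i \<eta> u) (partial_deriv j \<eta> u)"
proof -
  let ?c = "\<lambda>w. slice_metric k (partial_deriv i \<eta> w) (partial_deriv j \<eta> w)"
  have const: "partial_deriv m (\<lambda>w. G w $ l $ 1) u = 0" for m l
  proof -
    have "partial_deriv m (\<lambda>w. G w $ l $ 1) u = partial_deriv m (\<lambda>w. if l = 1 then 1 else 0) u"
      by (rule partial_deriv_cong[OF open_W u G_time'])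
    then show ?thesis by (simp add: partial_deriv_def frechet_derivative_const)
  qed
  have R': "(R has_real_derivative deriv R (u $ 1)) (at (u $ 1))"
    using smooth_on_differentiable[OF smooth_R] u
    by (simp add: W_def DERIV_deriv_iff_real_differentiable)
  have dR: "((\<lambda>w. (R (w $ 1))\<^sup>2) has_derivative (\<lambda>v. 2 * R (u $ 1) * deriv R (u $ 1) * v $ 1)) (at u)"
  proof -
    have "((\<lambda>t. (R t)\<^sup>2) has_real_derivative 2 * R (u $ 1) * deriv R (u $ 1)) (at (u $ 1))"
      using DERIV_power[OF R', of 2] by (simp add: mult_ac)
    then have "((\<lambda>t. (R t)\<^sup>2) has_derivative (\<lambda>h. (2 * R (u $ 1) * deriv R (u $ 1)) * h)) (at (u $ 1))"
      by (simp add: has_field_derivative_def)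
    from diff_chain_at[OF bounded_linear_imp_has_derivative[OF bounded_linear_vec_nth] this]
    show ?thesis by (simp add: o_def)
  qed
  have d\<eta>: "(partial_deriv m \<eta> has_derivative frechet_derivative (partial_deriv m \<eta>) (at u)) (at u)" for m
    by (rule smooth_on_has_derivative[OF smooth_on_partial_deriv[OF smooth_\<eta>] u])
  \<comment> \<open>Second derivatives commute and \<eta> is independent of the time
    coordinate.\<close>
  have zero: "frechet_derivative (partial_deriv m \<eta>) (at u) (axis 1 1) = 0" for m
  proof -
    have "partial_deriv 1 (partial_deriv m \<eta>) u = partial_deriv m (partial_deriv 1 \<eta>) u"
      by (rule partial_deriv_commute[OF open_W smooth_\<eta> u])
    also have "\<dots> = partial_deriv m (\<lambda>w. 0) u"
      by (rule partial_deriv_cong[OF open_W u partial_\<eta>_time])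
    finally show ?thesis by (simp add: partial_deriv_def frechet_derivative_const)
  qed
  have "((\<lambda>w. (if i = 1 \<and> j = 1 then 1 else 0) - (R (w $ 1))\<^sup>2 * ?c w) has_derivative
     (\<lambda>v. 0 - ((R (u $ 1))\<^sup>2 * (slice_metric k (partial_deriv i \<eta> u) (frechet_derivative (partial_deriv j \<eta>) (at u) v)
          + slice_metric k (frechet_derivative (partial_deriv i \<eta>) (at u) v) (partial_deriv j \<eta> u))
        + 2 * R (u $ 1) * deriv R (u $ 1) * v $ 1 * ?c u))) (at u)"
    by (rule has_derivative_diff[OF has_derivative_const has_derivative_mult[OF dR
          bounded_bilinear.FDERIV[OF bounded_bilinear_slice_metric d\<eta> d\<eta>]]])
  from frechet_derivative_eqI[OF this, of "axis 1 1"]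
  have "partial_deriv 1 (\<lambda>w. (if i = 1 \<and> j = 1 then 1 else 0) - (R (w $ 1))\<^sup>2 * ?c w) u
      = - (2 * R (u $ 1) * deriv R (u $ 1) * ?c u)"
    by (simp add: partial_deriv_def[of 1] zero slice_metric_simps)
  then have time: "partial_deriv 1 (\<lambda>w. G w $ i $ j) u = - (2 * R (u $ 1) * deriv R (u $ 1) * ?c u)"
    using partial_deriv_cong[OF open_W u, of "\<lambda>w. G w $ i $ j" _ 1, OF G_eq] by simp
  have "christoffel G 1 i j u = 1/2 * (- partial_deriv 1 (\<lambda>w. G w $ i $ j) u)"
    by (simp add: christoffel_def matrix_inv_unit_row[OF invertible_G[OF u] G_time[OF u]]
        if_distrib[of "\<lambda>x. x * _"] const cong: if_cong)
  then show ?thesis by (simp add: time)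
qed

end

section \<open>Conservation along null geodesics\<close>

lemma smooth_curve_has_vector_derivative:
  fixes c :: "real \<Rightarrow> 'b::real_normed_vector"
  assumes "smooth_on I c" "s \<in> I"
  shows "(c has_vector_derivative vector_derivative c (at s)) (at s)"
  using smooth_on_differentiable[OF assms] vector_derivative_works by blast

lemma smooth_curve_velocity_smooth:
  fixes c :: "real \<Rightarrow> 'b::real_normed_vector"
  assumes "open I" "smooth_on I c"
  shows "smooth_on I (\<lambda>s. vector_derivative c (at s))"
proof (rule smooth_on_cong[OF assms(1) _ smooth_on_frechet[OF assms(2), of 1]])
  fix s assume "s \<in> I"
  from smooth_curve_has_vector_derivative[OF assms(2) this]
  show "frechet_derivative c (at s) 1 = vector_derivative c (at s)"
    unfolding has_vector_derivative_def by (simp add: frechet_derivative_eqI)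
qed

text \<open>The time component \<open>t'' + R R' \<sigma>(x', x') = 0\<close> of the geodesic equation, combined with
  \<open>t'\<^sup>2 = R\<^sup>2 \<sigma>(x', x')\<close>, says that \<open>R t'\<close> is conserved.\<close>

lemma null_geodesic_redshift:
  assumes J: "open J" and smooth_R: "smooth_on J R" and R_pos: "\<And>t. t \<in> J \<Longrightarrow> R t > 0"
    and geo: "geodesic (frw_manifold k J) (frw_metric k R) (\<gamma>, I)" and \<tau>: "\<tau> \<in> I"
    and null: "frw_metric k R (\<gamma> \<tau>) (vector_derivative \<gamma> (at \<tau>)) (vector_derivative \<gamma> (at \<tau>)) = 0"
  shows "((\<lambda>s. R (fst (\<gamma> s)) * fst (vector_derivative \<gamma> (at s))) has_real_derivative 0) (at \<tau>)"
proof -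
  have I: "open I" and smooth_\<gamma>: "smooth_on I \<gamma>" and \<gamma>_M: "\<gamma> ` I \<subseteq> frw_manifold k J"
    and acc: "\<And>U (\<phi> :: real^4 \<Rightarrow> _). local_param (frw_manifold k J) U \<phi> \<Longrightarrow> \<gamma> \<tau> \<in> \<phi> ` U \<Longrightarrow>
        coord_acceleration (frw_metric k R) U \<phi> \<gamma> \<tau> = 0"
    using geo \<tau> unfolding geodesic_def by auto
  define v where "v s = vector_derivative \<gamma> (at s)" for s
  define a where "a = vector_derivative v (at \<tau>)"
  have d\<gamma>: "(\<gamma> has_vector_derivative v s) (at s)" if "s \<in> I" for s
    unfolding v_def by (rule smooth_curve_has_vector_derivative[OF smooth_\<gamma> that])
  have dv: "(v has_vector_derivative a) (at \<tau>)"
    unfolding a_def v_def[abs_def]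
    by (rule smooth_curve_has_vector_derivative[OF smooth_curve_velocity_smooth[OF I smooth_\<gamma>] \<tau>])
  have x: "snd (\<gamma> \<tau>) \<in> slice k" and t: "fst (\<gamma> \<tau>) \<in> J"
    using \<gamma>_M \<tau> by (auto simp: frw_manifold_def)
  obtain U :: "(real^3) set" and \<psi> P V where chart:
    "open U" "smooth_on U \<psi>" "bounded_linear P" "\<And>y. y \<in> U \<Longrightarrow> P (\<psi> y) = y"
    "open V" "snd (\<gamma> \<tau>) \<in> V" "\<psi> ` U = slice k \<inter> V"
    using slice_chart[OF x] by metis
  interpret frw_chart k J R U \<psi> P
    by (rule frw_chart.intro) (use J smooth_R R_pos chart in simp_all)
  have lp: "local_param (frw_manifold k J) W \<phi>"
    by (rule local_param_\<phi>[OF chart(5,7)])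
  obtain y where y: "y \<in> U" "snd (\<gamma> \<tau>) = \<psi> y" using x chart(6,7) by blast
  have \<gamma>\<tau>: "\<gamma> \<tau> \<in> \<phi> ` W"
    using t y by (intro image_eqI[of _ _ "cons4 (fst (\<gamma> \<tau>)) y"]) (auto simp: \<phi>_def \<eta>_def W_def prod_eq_iff)
  obtain O' where O': "open O'" "\<phi> ` W = frw_manifold k J \<inter> O'"
    using local_param_openin[OF lp] by (auto simp: openin_open)
  define N where "N = I \<inter> \<gamma> -` O'"
  have N: "open N"
    unfolding N_def by (intro continuous_open_preimage smooth_on_continuous[OF smooth_\<gamma>] I O'(1))
  have \<tau>N: "\<tau> \<in> N" using \<tau> \<gamma>\<tau> O'(2) by (auto simp: N_def)
  have NI: "N \<subseteq> I" by (auto simp: N_def)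
  have \<gamma>N: "\<gamma> s \<in> \<phi> ` W" if "s \<in> N" for s
    using that O'(2) \<gamma>_M by (auto simp: N_def)
  define u where "u s = inv_into W \<phi> (\<gamma> s)" for s
  \<comment> \<open>Near \<tau> the coordinates of the curve are a linear image of it, so they can
    be differentiated without differentiating \<open>inv_into\<close>.\<close>
  have uQ: "u s = Q (\<gamma> s)" and uW: "u s \<in> W" and \<phi>u: "\<phi> (u s) = \<gamma> s" if s: "s \<in> N" for s
  proof -
    obtain w where w: "w \<in> W" "\<gamma> s = \<phi> w" using \<gamma>N[OF s] by blast
    then have "u s = w" using local_param_inj[OF lp] by (simp add: u_def inv_into_f_f)
    then show "u s = Q (\<gamma> s)" "u s \<in> W" "\<phi> (u s) = \<gamma> s" using w Q_\<phi> by simp_all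
  qed
  have u': "(u has_vector_derivative Q (v s)) (at s)" if "s \<in> N" for s
    by (rule has_vector_derivative_transform_within_open[OF
          bounded_linear.has_vector_derivative[OF bounded_linear_Q d\<gamma>] N that])
      (use that NI uQ in auto)
  have u'_eq: "vector_derivative u (at s) = Q (v s)" if "s \<in> N" for s
    by (rule vector_derivative_at[OF u'[OF that]])
  have "((\<lambda>s. vector_derivative u (at s)) has_vector_derivative Q a) (at \<tau>)"
    by (rule has_vector_derivative_transform_within_open[OF
          bounded_linear.has_vector_derivative[OF bounded_linear_Q dv] N \<tau>N]) (simp add: u'_eq)
  then have u'': "vector_derivative (\<lambda>s. vector_derivative u (at s)) (at \<tau>) = Q a"
    by (rule vector_derivative_at)
  let ?u = "u \<tau>" and ?w = "Q (v \<tau>)"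
  have uW': "?u \<in> W" by (rule uW[OF \<tau>N])
  have u1: "?u $ 1 = fst (\<gamma> \<tau>)" by (simp add: uQ[OF \<tau>N])
  let ?t = "fst (\<gamma> \<tau>)"
  have "coord_acceleration (frw_metric k R) W \<phi> \<gamma> \<tau> $ 1 =
     fst a + (\<Sum>i\<in>UNIV. \<Sum>j\<in>UNIV. christoffel G 1 i j ?u * ?w $ i * ?w $ j)"
    unfolding coord_acceleration_def Let_def u_def[symmetric] u'' u'_eq[OF \<tau>N] by simp
  then have "0 = fst a + (\<Sum>i\<in>UNIV. \<Sum>j\<in>UNIV. christoffel G 1 i j ?u * ?w $ i * ?w $ j)"
    using acc[OF lp \<gamma>\<tau>] by simp
  also have "(\<Sum>i\<in>UNIV. \<Sum>j\<in>UNIV. christoffel G 1 i j ?u * ?w $ i * ?w $ j) =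
     R ?t * deriv R ?t * (\<Sum>i\<in>UNIV. \<Sum>j\<in>UNIV. slice_metric k (frechet_derivative \<eta> (at ?u) (axis i 1))
       (frechet_derivative \<eta> (at ?u) (axis j 1)) * ?w $ i * ?w $ j)"
    by (simp add: christoffel_time[OF uW'] u1 partial_deriv_def sum_distrib_left mult.assoc)
  also have "\<dots> = R ?t * deriv R ?t *
      slice_metric k (frechet_derivative \<eta> (at ?u) ?w) (frechet_derivative \<eta> (at ?u) ?w)"
    by (subst slice_metric_expansion)
      (intro linear_frechet_derivative smooth_on_differentiable[OF smooth_\<eta> uW'], simp)
  \<comment> \<open>On N the chart gives \<open>\<eta> (u s) = snd (\<gamma> s)\<close>; the chain
    rule compares the two velocities.\<close>
  also have "frechet_derivative \<eta> (at ?u) ?w = snd (v \<tau>)"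
  proof -
    have "((\<lambda>s. \<eta> (u s)) has_vector_derivative frechet_derivative \<eta> (at ?u) ?w) (at \<tau>)"
    proof -
      have "(\<eta> \<circ> u has_derivative frechet_derivative \<eta> (at ?u) \<circ> (\<lambda>h. h *\<^sub>R ?w)) (at \<tau>)"
        by (rule diff_chain_at[OF u'[OF \<tau>N, unfolded has_vector_derivative_def]
              smooth_on_has_derivative[OF smooth_\<eta> uW']])
      moreover have "linear (frechet_derivative \<eta> (at ?u))"
        by (intro linear_frechet_derivative smooth_on_differentiable[OF smooth_\<eta> uW'])
      ultimately show ?thesis by (simp add: has_vector_derivative_def o_def linear_scale)
    qed
    then have "((\<lambda>s. snd (\<gamma> s)) has_vector_derivative frechet_derivative \<eta> (at ?u) ?w) (at \<tau>)"
      by (rule has_vector_derivative_transform_within_open[OF _ N \<tau>N])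
        (simp add: \<phi>u[symmetric] \<phi>_def)
    moreover have "((\<lambda>s. snd (\<gamma> s)) has_vector_derivative snd (v \<tau>)) (at \<tau>)"
      by (rule bounded_linear.has_vector_derivative[OF bounded_linear_snd d\<gamma>[OF \<tau>]])
    ultimately show ?thesis by (rule vector_derivative_unique_at)
  qed
  finally have geodesic_eq: "fst a = - (R ?t * deriv R ?t * slice_metric k (snd (v \<tau>)) (snd (v \<tau>)))"
    by simp
  have null_eq: "fst (v \<tau>) * fst (v \<tau>) = R ?t * R ?t * slice_metric k (snd (v \<tau>)) (snd (v \<tau>))"
    using null by (simp add: frw_metric_def v_def power2_eq_square)
  have dt: "((\<lambda>s. fst (\<gamma> s)) has_real_derivative fst (v \<tau>)) (at \<tau>)"
    using bounded_linear.has_vector_derivative[OF bounded_linear_fst d\<gamma>[OF \<tau>]]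
    by (simp add: has_real_derivative_iff_has_vector_derivative)
  have dv1: "((\<lambda>s. fst (v s)) has_real_derivative fst a) (at \<tau>)"
    using bounded_linear.has_vector_derivative[OF bounded_linear_fst dv]
    by (simp add: has_real_derivative_iff_has_vector_derivative)
  have "(R has_real_derivative deriv R ?t) (at ?t)"
    using smooth_on_differentiable[OF smooth_R t] by (simp add: DERIV_deriv_iff_real_differentiable)
  from DERIV_mult[OF DERIV_chain2[OF this dt] dv1]
  have "((\<lambda>s. R (fst (\<gamma> s)) * fst (v s)) has_real_derivative
      deriv R ?t * fst (v \<tau>) * fst (v \<tau>) + fst a * R ?t) (at \<tau>)" .
  \<comment> \<open>With \<sigma> the squared slice length of the spatial velocity, the null
    condition turns the first summand into \<open>R' R\<^sup>2 \<sigma>\<close>, and the geodesic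
    equation makes the second its negative.\<close>
  moreover have "deriv R ?t * fst (v \<tau>) * fst (v \<tau>) + fst a * R ?t = 0"
    unfolding geodesic_eq mult.assoc[of "deriv R ?t"] null_eq by simp
  ultimately show ?thesis by (simp add: v_def)
qed

section \<open>The DGC function of a homogeneous and isotropic family\<close>

text \<open>Dividing an isometric frame by R absorbs the scale function, so the spatial parts of the
  light directions become a round sphere in Euclidean R^3 in all three geometries.\<close>

lemma light_sphere_frame:
  assumes x: "x \<in> slice k" and R: "R > 0"
  obtains T :: "real^3 \<Rightarrow> real^4" and P where "linear T" "linear P" "\<And>y. P (T y) = y"
    "\<And>y z. R\<^sup>2 * slice_metric k (T y) (T z) = y \<bullet> z" "range T = tangent_space (slice k) x"
proof -
  obtain T0 :: "real^3 \<Rightarrow> real^4" where T0: "linear T0" "\<And>y z. slice_metric k (T0 y) (T0 z) = y \<bullet> z"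
    "range T0 = tangent_hyperplane k x"
    using slice_frame[OF x] by auto
  define T where "T y = T0 ((1 / R) *\<^sub>R y)" for y
  define P where "P w = (\<chi> i. R\<^sup>2 * slice_metric k (T (axis i 1)) w)" for w
  have T: "R\<^sup>2 * slice_metric k (T y) (T z) = y \<bullet> z" for y z
    using R by (simp add: T_def T0(2) power2_eq_square)
  show ?thesis
  proof
    show "linear T"
      using T0(1) by (intro linearI) (simp_all add: T_def linear_add linear_scale scaleR_add_right)
    show "linear P"
      by (rule linearI) (simp_all add: P_def vec_eq_iff slice_metric_simps distrib_left)
    show "P (T y) = y" for y
      by (simp add: P_def T vec_eq_iff inner_commute[of "axis _ _"] inner_axis)
    have "T0 y \<in> range T" for y
      using R by (intro image_eqI[of _ _ "R *\<^sub>R y"]) (simp_all add: T_def)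
    then show "range T = tangent_space (slice k) x"
      unfolding tangent_space_slice[OF x] T0(3)[symmetric] by (auto simp: T_def)
  qed (rule T)
qed

text \<open>In the family the sign acts on time and space together, whereas \<open>D\<close> chooses
  the sheet and the point of the sphere independently. Both give the same set because the sphere is
  invariant under the antipodal map.\<close>

lemma dgc_light_spheres:
  assumes x: "x \<in> slice k" and R: "R t > 0" and \<epsilon>: "\<epsilon> > 0"
    and D: "family_directions L (t, x) = {(s / \<epsilon>) *\<^sub>R (1, n) | s n.
        s \<in> {1, -1} \<and> n \<in> tangent_space (slice k) x \<and> (R t)\<^sup>2 * slice_metric k n n = 1}"
  shows "dgc (frw_metric k R) L (t, x) = \<epsilon>\<^sup>2 / (8 * pi)"
proof -
  obtain T :: "real^3 \<Rightarrow> real^4" and P where T: "linear T" "linear P" "\<And>y. P (T y) = y"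
    "\<And>y z. (R t)\<^sup>2 * slice_metric k (T y) (T z) = y \<bullet> z" "range T = tangent_space (slice k) x"
    using light_sphere_frame[OF x R] by metis
  interpret two_spheres T P "1 / \<epsilon>" "directions_metric (frw_metric k R) (t, x)"
    by (rule two_spheres.intro) (use T(1-4) \<epsilon> in \<open>simp_all add: directions_metric_def frw_metric_def\<close>)
  have "family_directions L (t, x) = D"
  proof (intro equalityI subsetI)
    fix w assume "w \<in> family_directions L (t, x)"
    then obtain s n where w: "w = (s / \<epsilon>) *\<^sub>R (1, n)" "s \<in> {1, -1}" "n \<in> range T"
      "(R t)\<^sup>2 * slice_metric k n n = 1" unfolding D T(5) by blast
    then obtain m where m: "n = T m" by blast
    then have "m \<bullet> m = 1" using w(4) T(4) by simp
    then show "w \<in> D" unfolding D_def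
      using w(1,2) by (intro CollectI exI[of _ s] exI[of _ "(s / \<epsilon>) *\<^sub>R m"])
        (auto simp: m linear_scale[OF T(1)] power2_eq_square)
  next
    fix w assume "w \<in> D"
    then obtain s y where w: "w = (s * (1 / \<epsilon>), T y)" "s \<in> {1, -1}" "y \<bullet> y = (1 / \<epsilon>)\<^sup>2"
      unfolding D_def by blast
    show "w \<in> family_directions L (t, x)" unfolding D
    \<comment> \<open>The spatial part is \<open>(s / \<epsilon>) *\<^sub>R n\<close>, and s is its
      own inverse; this determines n.\<close>
    proof (intro CollectI exI[of _ s] exI[of _ "T ((s * \<epsilon>) *\<^sub>R y)"] conjI)
      show "w = (s / \<epsilon>) *\<^sub>R (1, T ((s * \<epsilon>) *\<^sub>R y))"
        using w(1,2) \<epsilon> by (auto simp: linear_scale[OF T(1)])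
      show "T ((s * \<epsilon>) *\<^sub>R y) \<in> tangent_space (slice k) x" using T(5) by blast
      show "(R t)\<^sup>2 * slice_metric k (T ((s * \<epsilon>) *\<^sub>R y)) (T ((s * \<epsilon>) *\<^sub>R y)) = 1"
        unfolding T(4) using w(2,3) \<epsilon> by (auto simp: power2_eq_square)
    qed (rule w(2))
  qed
  then show ?thesis
    unfolding dgc_def Let_def by (simp only: mean_inverse_curvature) (simp add: power_divide)
qed

text \<open>One member of the family through time t0 suffices: its time function has nonzero
  derivative there, so it sweeps out an open interval of times around t0, and the conservation law
  compares \<open>R / \<epsilon>\<close> at any two of them.\<close>

lemma family_scale_locally_constant:
  assumes J: "open J" and smooth_R: "smooth_on J R" and R_pos: "\<forall>t\<in>J. R t > 0"
    and L: "null_geodesic_family (frw_manifold k J) (frw_metric k R) L"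
    and \<epsilon>_pos: "\<forall>t\<in>J. \<epsilon> t > 0"
    and D: "\<forall>t\<in>J. \<forall>x\<in>slice k. family_directions L (t, x) =
        {(s / \<epsilon> t) *\<^sub>R (1, n) | s n.
          s \<in> {1, -1} \<and> n \<in> tangent_space (slice k) x \<and> (R t)\<^sup>2 * slice_metric k n n = 1}"
    and t0: "t0 \<in> J"
  shows "\<forall>\<^sub>F t in at t0 within J. R t0 / \<epsilon> t0 = R t / \<epsilon> t"
proof -
  obtain x where x: "x \<in> slice k" using slice_nonempty by blast
  have R0: "R t0 > 0" and \<epsilon>0: "\<epsilon> t0 > 0" using R_pos \<epsilon>_pos t0 by auto
  obtain T :: "real^3 \<Rightarrow> real^4" and P where T: "linear T" "linear P" "\<And>y. P (T y) = y"
    "\<And>y z. (R t0)\<^sup>2 * slice_metric k (T y) (T z) = y \<bullet> z" "range T = tangent_space (slice k) x"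
    using light_sphere_frame[where R = "R t0", OF x R0] by metis
  \<comment> \<open>Any spatial light direction would do; T takes unit vectors of R^3 to such
    directions.\<close>
  let ?n = "T (axis 1 1)"
  have "(1 / \<epsilon> t0) *\<^sub>R (1, ?n) \<in> family_directions L (t0, x)"
    unfolding D[rule_format, OF t0 x] using T(4)[of "axis 1 1" "axis 1 1"] T(5)
    by (intro CollectI exI[of _ 1] exI[of _ ?n]) (auto simp: inner_axis_axis)
  then obtain \<gamma> I \<tau>0 where \<gamma>: "(\<gamma>, I) \<in> L" "\<tau>0 \<in> I" "\<gamma> \<tau>0 = (t0, x)"
    "vector_derivative \<gamma> (at \<tau>0) = (1 / \<epsilon> t0) *\<^sub>R (1, ?n)"
    unfolding family_directions_def by auto
  have "maximal_null_geodesic (frw_manifold k J) (frw_metric k R) (\<gamma>, I)"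
    using L \<gamma>(1) unfolding null_geodesic_family_def by blast
  then have geo: "geodesic (frw_manifold k J) (frw_metric k R) (\<gamma>, I)"
    and null: "\<And>\<tau>. \<tau> \<in> I \<Longrightarrow>
      frw_metric k R (\<gamma> \<tau>) (vector_derivative \<gamma> (at \<tau>)) (vector_derivative \<gamma> (at \<tau>)) = 0"
    by (auto simp: maximal_null_geodesic_def maximal_geodesic_def)
  have I: "open I" "is_interval I" and smooth_\<gamma>: "smooth_on I \<gamma>" and \<gamma>_M: "\<gamma> ` I \<subseteq> frw_manifold k J"
    using geo unfolding geodesic_def by auto
  define t where "t \<tau> = fst (\<gamma> \<tau>)" for \<tau>
  define t' where "t' \<tau> = fst (vector_derivative \<gamma> (at \<tau>))" for \<tau>
  have dt: "(t has_real_derivative t' \<tau>) (at \<tau>)" if "\<tau> \<in> I" for \<tau>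
    using bounded_linear.has_vector_derivative[OF bounded_linear_fst
        smooth_curve_has_vector_derivative[OF smooth_\<gamma> that]]
    by (simp add: t_def[abs_def] t'_def has_real_derivative_iff_has_vector_derivative)
  have tJ: "t \<tau> \<in> J" "snd (\<gamma> \<tau>) \<in> slice k" if "\<tau> \<in> I" for \<tau>
    using \<gamma>_M that by (auto simp: t_def frw_manifold_def)
  have "\<exists>c. \<forall>\<tau>\<in>I. R (t \<tau>) * t' \<tau> = c"
  proof (rule has_field_derivative_zero_constant)
    show "convex I" using I(2) is_interval_convex by blast
    show "((\<lambda>\<tau>. R (t \<tau>) * t' \<tau>) has_real_derivative 0) (at \<tau> within I)" if "\<tau> \<in> I" for \<tau>
      unfolding t_def t'_def
      by (rule has_field_derivative_at_within[OF null_geodesic_redshift[OF J smooth_R _ geo that null[OF that]]])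
        (use R_pos in auto)
  qed
  then obtain c where c: "\<And>\<tau>. \<tau> \<in> I \<Longrightarrow> R (t \<tau>) * t' \<tau> = c" by blast
  have t'0: "t' \<tau>0 = 1 / \<epsilon> t0" "t \<tau>0 = t0" by (simp_all add: t'_def t_def \<gamma>)
  have c0: "c = R t0 / \<epsilon> t0" using c[OF \<gamma>(2)] by (simp add: t'0)
  have scale: "R t0 / \<epsilon> t0 = R (t \<tau>) / \<epsilon> (t \<tau>)" if \<tau>: "\<tau> \<in> I" for \<tau>
  proof -
    have "vector_derivative \<gamma> (at \<tau>) \<in> family_directions L (t \<tau>, snd (\<gamma> \<tau>))"
      unfolding family_directions_def t_def using \<gamma>(1) \<tau> by auto
    then obtain s n where s: "s \<in> {1, -1}" "vector_derivative \<gamma> (at \<tau>) = (s / \<epsilon> (t \<tau>)) *\<^sub>R (1, n)"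
      unfolding D[rule_format, OF tJ[OF \<tau>]] by blast
    have t'_eq: "t' \<tau> = s / \<epsilon> (t \<tau>)" by (simp add: t'_def s(2))
    have pos: "R (t \<tau>) / \<epsilon> (t \<tau>) > 0" using tJ[OF \<tau>] R_pos \<epsilon>_pos by simp
    have eq: "s * (R (t \<tau>) / \<epsilon> (t \<tau>)) = R t0 / \<epsilon> t0"
      using c[OF \<tau>] unfolding c0 t'_eq by (simp add: mult.commute)
    have "R t0 / \<epsilon> t0 > 0" using R0 \<epsilon>0 by simp
    \<comment> \<open>The conserved quantity is positive at the start, so the velocity can never lie
      on the sheet of negative time component.\<close>
    then have "s = 1" using eq pos s(1) by auto
    then show ?thesis using eq by simp
  qed
  obtain r where r: "r > 0" "ball \<tau>0 r \<subseteq> I" using I(1) \<gamma>(2) openE by blast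
  have t'pos: "t' \<tau>0 > 0" using \<epsilon>0 by (simp add: t'0)
  \<comment> \<open>The positive derivative at \<tau>0 yields parameters whose times lie on either
    side of t0; connectedness of the image of I fills the interval between them.\<close>
  obtain d1 where d1: "d1 > 0" "\<And>h. h > 0 \<Longrightarrow> h < d1 \<Longrightarrow> t \<tau>0 < t (\<tau>0 + h)"
    using DERIV_pos_inc_right[OF dt[OF \<gamma>(2)] t'pos] by blast
  obtain d2 where d2: "d2 > 0" "\<And>h. h > 0 \<Longrightarrow> h < d2 \<Longrightarrow> t (\<tau>0 - h) < t \<tau>0"
    using DERIV_pos_inc_left[OF dt[OF \<gamma>(2)] t'pos] by blast
  define h where "h = min r (min d1 d2) / 2"
  have h: "h > 0" "h < r" "h < d1" "h < d2" using r(1) d1(1) d2(1) by (auto simp: h_def)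
  have hI: "\<tau>0 + h \<in> I" "\<tau>0 - h \<in> I" using h r(2) by (auto simp: subset_iff dist_real_def)
  have "connected (t ` I)"
  proof (rule connected_continuous_image)
    show "continuous_on I t"
      using dt by (meson DERIV_isCont continuous_at_imp_continuous_on)
    show "connected I" using I(2) is_interval_connected by blast
  qed
  then have "{t (\<tau>0 - h)..t (\<tau>0 + h)} \<subseteq> t ` I"
    using hI by (intro connected_contains_Icc) auto
  then have sub: "{t (\<tau>0 - h)<..<t (\<tau>0 + h)} \<subseteq> t ` I" by auto
  have mem: "t0 \<in> {t (\<tau>0 - h)<..<t (\<tau>0 + h)}"
    using d1(2)[of h] d2(2)[of h] h by (simp add: t'0)
  show ?thesis
    unfolding eventually_at_topological
    by (intro exI[of _ "{t (\<tau>0 - h)<..<t (\<tau>0 + h)}"]) (use sub mem scale in auto)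
qed

theorem mainTheorem3:
  fixes k :: space_form and J :: "real set" and R \<epsilon> :: "real \<Rightarrow> real"
    and L :: "((real \<Rightarrow> real \<times> (real^4)) \<times> real set) set"
  assumes "open J" and "is_interval J" and "J \<noteq> {}"
    and "smooth_on J R" and "\<forall>t\<in>J. R t > 0"
    and "null_geodesic_family (frw_manifold k J) (frw_metric k R) L"
    and "\<forall>t\<in>J. \<epsilon> t > 0"
    and "\<forall>t\<in>J. \<forall>x\<in>slice k. family_directions L (t, x) =
           {(s / \<epsilon> t) *\<^sub>R (1, n) | s n.
              s \<in> {1, -1} \<and> n \<in> tangent_space (slice k) x \<and> (R t)\<^sup>2 * slice_metric k n n = 1}"
  shows "\<exists>\<kappa> :: real \<Rightarrow> real. \<exists>\<kappa>\<^sub>0 > 0.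
           (\<forall>t\<in>J. \<forall>x\<in>slice k. dgc (frw_metric k R) L (t, x) = \<kappa> t) \<and>
           (\<forall>t\<in>J. \<kappa> t = (R t)\<^sup>2 * \<kappa>\<^sub>0)"
proof -
  obtain t0 where t0: "t0 \<in> J" using assms(3) by blast
  \<comment> \<open>The value of \<open>R / \<epsilon>\<close>, constant on the connected J. Then
    \<open>\<epsilon> = R / q\<close>, and \<open>\<epsilon>\<^sup>2 / (8 \<pi>)\<close> becomes
    \<open>R\<^sup>2\<close> times \<open>1 / (8 \<pi> q\<^sup>2)\<close>, the required
    constant.\<close>
  define q where "q = R t0 / \<epsilon> t0"
  have q: "q > 0" using assms(5,7) t0 by (simp add: q_def)
  have "connected J" using assms(2) is_interval_connected by blast
  then have "R t0 / \<epsilon> t0 = R t / \<epsilon> t" if "t \<in> J" for t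
    using family_scale_locally_constant[OF assms(1,4,5,6,7,8)]
    by (intro connected_local_const[of J t0 t "\<lambda>t. R t / \<epsilon> t"] t0 that ballI)
  then have \<epsilon>: "\<epsilon> t = R t / q" if "t \<in> J" for t
    using assms(5,7) that q by (force simp: q_def field_simps)
  have dgc: "dgc (frw_metric k R) L (t, x) = (R t)\<^sup>2 * (1 / (8 * pi * q\<^sup>2))" if "t \<in> J" "x \<in> slice k" for t x
  proof -
    have "dgc (frw_metric k R) L (t, x) = (\<epsilon> t)\<^sup>2 / (8 * pi)"
      using assms(5,7,8) that by (intro dgc_light_spheres) auto
    then show ?thesis by (simp add: \<epsilon>[OF that(1)] power_divide)
  qed
  show ?thesis
    using dgc q by (intro exI[of _ "\<lambda>t. (R t)\<^sup>2 * (1 / (8 * pi * q\<^sup>2))"] exI[of _ "1 / (8 * pi * q\<^sup>2)"]) auto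
qed

end
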